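(* Let $n\ge4$ be even, $m=\frac{n+2}{2}$, and let $A$ be a positive definite even symmetric matrix in $M_{n-2}(\mathbb Z)$ with $\det A=1$ and $n\equiv2\pmod8$. Let $p$ be a prime and let $\eta\in V'(\mathbb Z_p)$ with $q(\eta)\ne0$. Let $k\ge0$ be such that $p^k$ exactly divides $\eta$ (i.e. $k$ is the minimum of the $p$-adic valuations of the coordinates of $\eta$), and define $k'$ by $p^{2k+k'}\| q(\eta)$. Then $$J(s,\eta,\Phi_p)=(1-p^{m-1-s})\,Q_{\eta,p}(p^{m-s}),$$ where $Q_{\eta,p}(X)\in\mathbb Z[X]$ is a polynomial of degree $2k+k'$ satisfying $X^{2k+k'}Q_{\eta,p}(X^{-1})=Q_{\eta,p}(X)$.
   Context: $J_{2,n}=\begin{pmatrix}0&0&1\\0&J_{1,n-1}&0\\1&0&0\end{pmatrix}$ with $J_{1,n-1}=\begin{pmatrix}0&0&1\\0&-A&0\\1&0&0\end{pmatrix}$. $V'(\mathbb Z_p)=\mathbb Z_p^{n+2}\subset V'(\mathbb Q_p)=\mathbb Q_p^{n+2}$ with quadratic form $q(x)=\frac12xJ_{2,n}{}^tx$ and bilinear form $(x,y)=q(x+y)-q(x)-q(y)$. $\Phi_p$ is the characteristic function of $V'(\mathbb Z_p)$, $\psi_p(x)=e^{2\pi i\{x\}_p}$ ($\{x\}_p$ the $p$-adic fractional part), $dx$ the Haar measure on $V'(\mathbb Q_p)$ with $V'(\mathbb Z_p)$ of volume 1, and $$J(s,\eta,\Phi_p)=\sum_{r\ge0}p^{-rs}\int_{p^{-r}V'(\mathbb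 Z_p)}\psi_p((\eta,x))\,\mathbf 1[p^rq(x)\in\mathbb Z_p]\,dx.$$ *)

theory Defs
  imports
    "HOL-Analysis.Bochner_Integration"
    "HOL-Analysis.Set_Integral"
    "HOL-Analysis.Complex_Transcendental"
    "HOL-Computational_Algebra.Polynomial_Factorial"
    "Berlekamp_Zassenhaus.Finite_Field"
    "Jordan_Normal_Form.Determinant"
begin

unbundle no vec_syntax and no inner_syntax

section \<open>The \<open>p\<close>-adic integers and the \<open>p\<close>-adic numbers\<close>

text \<open>The prime \<open>p\<close> is carried by a type \<open>'p\<close> of class \<^class>\<open>prime_card\<close> as its cardinality.
  The ring \<open>\<int>\<^sub>p\<close> is the inverse limit of the rings \<open>\<int>/p\<^sup>k\<int>\<close>: an element is the sequence of its
  residues, the \<open>k\<close>-th being represented in \<open>[0, p\<^sup>k)\<close> (the range condition is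
  implied by compatibility).\<close>

typedef (overloaded) ('p::prime_card) padic_int =
  "{a :: nat \<Rightarrow> int. \<forall>k. a (Suc k) mod int CARD('p) ^ k = a k}"
  morphisms residue Abs_padic_int
  by (rule exI[of _ "\<lambda>_. 0"]) simp

setup_lifting type_definition_padic_int

lemma mod_power_Suc_mod:
  fixes a p :: int
  shows "a mod p ^ Suc k mod p ^ k = a mod p ^ k"
  by (rule mod_mod_cancel) (simp add: le_imp_power_dvd)

lemma compatible_mod:
  fixes a :: "nat \<Rightarrow> int"
  assumes "\<forall>k. a (Suc k) mod p ^ k = a k"
  shows "a k mod p ^ k = a k"
  using assms by (metis mod_mod_trivial)

lemma compatible_op:
  fixes a b :: "nat \<Rightarrow> int"
  assumes a: "\<forall>k. a (Suc k) mod p ^ k = a k" and b: "\<forall>k. b (Suc k) mod p ^ k = b k"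
  shows compatible_add: "(a (Suc k) + b (Suc k)) mod p ^ Suc k mod p ^ k = (a k + b k) mod p ^ k"
    and compatible_diff: "(a (Suc k) - b (Suc k)) mod p ^ Suc k mod p ^ k = (a k - b k) mod p ^ k"
    and compatible_mult: "(a (Suc k) * b (Suc k)) mod p ^ Suc k mod p ^ k = (a k * b k) mod p ^ k"
proof -
  have ak: "a k = a (Suc k) mod p ^ k" and bk: "b k = b (Suc k) mod p ^ k"
    using a b by auto
  show "(a (Suc k) + b (Suc k)) mod p ^ Suc k mod p ^ k = (a k + b k) mod p ^ k"
    unfolding mod_power_Suc_mod ak bk by (rule mod_add_eq[symmetric])
  show "(a (Suc k) - b (Suc k)) mod p ^ Suc k mod p ^ k = (a k - b k) mod p ^ k"
    unfolding mod_power_Suc_mod ak bk by (rule mod_diff_eq[symmetric])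
  show "(a (Suc k) * b (Suc k)) mod p ^ Suc k mod p ^ k = (a k * b k) mod p ^ k"
    unfolding mod_power_Suc_mod ak bk by (rule mod_mult_eq[symmetric])
qed

instantiation padic_int :: (prime_card) comm_ring_1
begin

lift_definition zero_padic_int :: "'a padic_int" is "\<lambda>_. 0" by simp

lift_definition one_padic_int :: "'a padic_int" is "\<lambda>k. 1 mod int CARD('a) ^ k"
  by (intro allI mod_power_Suc_mod)

lift_definition plus_padic_int :: "'a padic_int \<Rightarrow> 'a padic_int \<Rightarrow> 'a padic_int"
  is "\<lambda>a b k. (a k + b k) mod int CARD('a) ^ k"
  by (intro allI compatible_add)

lift_definition uminus_padic_int :: "'a padic_int \<Rightarrow> 'a padic_int"
  is "\<lambda>a k. (0 - a k) mod int CARD('a) ^ k"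
  by (intro allI compatible_diff[where a = "\<lambda>_. 0"]) simp_all

lift_definition minus_padic_int :: "'a padic_int \<Rightarrow> 'a padic_int \<Rightarrow> 'a padic_int"
  is "\<lambda>a b k. (a k - b k) mod int CARD('a) ^ k"
  by (intro allI compatible_diff)

lift_definition times_padic_int :: "'a padic_int \<Rightarrow> 'a padic_int \<Rightarrow> 'a padic_int"
  is "\<lambda>a b k. (a k * b k) mod int CARD('a) ^ k"
  by (intro allI compatible_mult)

instance
proof
  fix a b c :: "'a padic_int"
  show "a * b * c = a * (b * c)"
    by transfer (simp add: mod_simps mult.assoc)
  show "a * b = b * a"
    by transfer (simp add: mult.commute)
  show "1 * a = a"
    by transfer (simp add: mod_simps compatible_mod)
  show "a + b + c = a + (b + c)"
    by transfer (simp add: mod_simps add.assoc)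
  show "a + b = b + a"
    by transfer (simp add: add.commute)
  show "0 + a = a"
    by transfer (simp add: compatible_mod)
  show "- a + a = 0"
    by transfer (simp add: mod_simps)
  show "a - b = a + - b"
    by transfer (simp add: mod_simps)
  show "(a + b) * c = a * c + b * c"
    by transfer (simp add: mod_simps distrib_right)
  have "residue (0::'a padic_int) 1 \<noteq> residue 1 1"
    using prime_gt_1_int[OF prime_card_int[where 'a = 'a]]
    by (simp add: zero_padic_int.rep_eq one_padic_int.rep_eq)
  then show "(0::'a padic_int) \<noteq> 1"
    by metis
qed

end

lemma residue_mod:
  fixes a :: "'p::prime_card padic_int"
  shows "residue a (k + l) mod int CARD('p) ^ k = residue a k"
proof (induction l)
  case 0
  show ?case
    using residue[of a] by (simp add: compatible_mod)
next
  case (Suc l)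
  have "residue a (Suc (k + l)) mod int CARD('p) ^ (k + l) = residue a (k + l)"
    using residue[of a] by blast
  moreover have "int CARD('p) ^ k dvd int CARD('p) ^ (k + l)"
    by (simp add: le_imp_power_dvd)
  ultimately show ?case
    using Suc by (metis add_Suc_right mod_mod_cancel)
qed

instance padic_int :: (prime_card) idom
proof
  fix a b :: "'a padic_int"
  assume "a \<noteq> 0" "b \<noteq> 0"
  let ?p = "int CARD('a)"
  have ex: "\<exists>k. residue x k \<noteq> 0" if "x \<noteq> 0" for x :: "'a padic_int"
    using that by transfer auto
  obtain k l where kl: "residue a k \<noteq> 0" "residue b l \<noteq> 0"
    using ex \<open>a \<noteq> 0\<close> \<open>b \<noteq> 0\<close> by metis
  let ?a = "residue a (k + l)" and ?b = "residue b (k + l)"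
  have nd: "\<not> ?p ^ k dvd ?a" "\<not> ?p ^ l dvd ?b"
    using kl residue_mod[of a k l] residue_mod[of b l k]
    by (auto simp: dvd_eq_mod_eq_0 add.commute)
  have pr: "prime ?p"
    by (rule prime_card_int)
  have nz: "?a \<noteq> 0" "?b \<noteq> 0"
    using nd by auto
  have "multiplicity ?p ?a < k" "multiplicity ?p ?b < l"
    using nd nz pr by (meson multiplicity_dvd' not_less)+
  then have "multiplicity ?p (?a * ?b) < k + l"
    using nz pr by (simp add: prime_elem_multiplicity_mult_distrib)
  then have "\<not> ?p ^ (k + l) dvd ?a * ?b"
    using nz pr by (metis mult_eq_0_iff not_less power_dvd_iff_le_multiplicity
        not_prime_unit)
  then have "residue (a * b) (k + l) \<noteq> 0"
    by (simp add: times_padic_int.rep_eq dvd_eq_mod_eq_0)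
  then show "a * b \<noteq> 0"
    by (auto simp: zero_padic_int.rep_eq)
qed

type_synonym 'p padic = "'p padic_int fract"

definition padic_integers :: "'p::prime_card padic set" where
  "padic_integers = range to_fract"

text \<open>The \<open>p\<close>-adic fractional part: the unique \<open>t \<in> \<int>[1/p] \<inter> [0, 1)\<close> with
  \<open>x - t \<in> \<int>\<^sub>p\<close>.\<close>

definition padic_frac :: "'p::prime_card padic \<Rightarrow> real" where
  "padic_frac x = (THE t. 0 \<le> t \<and> t < 1 \<and>
     (\<exists>(a::int) (k::nat). t = of_int a / of_nat CARD('p) ^ k \<and>
        x - of_int a / of_nat CARD('p) ^ k \<in> padic_integers))"

definition padic_char :: "'p::prime_card padic \<Rightarrow> complex" where
  "padic_char x = exp (2 * pi * \<i> * padic_frac x)"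

definition exactly_divides :: "nat \<Rightarrow> 'p::prime_card padic \<Rightarrow> bool" where
  "exactly_divides e x \<longleftrightarrow>
     x \<in> (\<lambda>z. of_nat CARD('p) ^ e * z) ` padic_integers \<and>
     x \<notin> (\<lambda>z. of_nat CARD('p) ^ Suc e * z) ` padic_integers"

section \<open>Lattices and Haar measure on \<open>\<rat>\<^sub>p\<^sup>N\<close>\<close>

definition padic_lattice :: "nat \<Rightarrow> 'p::prime_card padic vec set" where
  "padic_lattice N = {x \<in> carrier_vec N. \<forall>i<N. x $ i \<in> padic_integers}"

definition scaled_lattice :: "nat \<Rightarrow> 'p::prime_card padic \<Rightarrow> 'p padic vec set" where
  "scaled_lattice N c = (\<lambda>x. c \<cdot>\<^sub>v x) ` padic_lattice N"

text \<open>\<open>p\<^sup>e\<close> exactly divides the vector \<open>x\<close>, i.e. \<open>e\<close> is the minimum of the valuations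
  of its coordinates.\<close>

definition exactly_divides_vec :: "nat \<Rightarrow> 'p::prime_card padic vec \<Rightarrow> bool" where
  "exactly_divides_vec e x \<longleftrightarrow>
     x \<in> scaled_lattice (dim_vec x) (of_nat CARD('p) ^ e) \<and>
     x \<notin> scaled_lattice (dim_vec x) (of_nat CARD('p) ^ Suc e)"

definition padic_open :: "nat \<Rightarrow> 'p::prime_card padic vec set \<Rightarrow> bool" where
  "padic_open N U \<longleftrightarrow> U \<subseteq> carrier_vec N \<and>
     (\<forall>x\<in>U. \<exists>r::nat. \<forall>y\<in>scaled_lattice N (of_nat CARD('p) ^ r). x + y \<in> U)"

text \<open>The Haar measure on the Borel sets of \<open>\<rat>\<^sub>p\<^sup>N\<close>, normalised on \<open>\<int>\<^sub>p\<^sup>N\<close>, is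
  determined by these conditions.\<close>

definition padic_haar :: "nat \<Rightarrow> 'p::prime_card padic vec measure \<Rightarrow> bool" where
  "padic_haar N M \<longleftrightarrow>
     space M = carrier_vec N \<and>
     sets M = sigma_sets (carrier_vec N) {U. padic_open N U} \<and>
     (\<forall>v\<in>carrier_vec N. \<forall>B\<in>sets M. emeasure M ((\<lambda>x. v + x) ` B) = emeasure M B) \<and>
     emeasure M (padic_lattice N) = 1"

section \<open>The quadratic space\<close>

definition pos_def_mat :: "int mat \<Rightarrow> bool" where
  "pos_def_mat A \<longleftrightarrow> (\<forall>v\<in>carrier_vec (dim_row A). v \<noteq> 0\<^sub>v (dim_row A) \<longrightarrow>
     v \<bullet> (map_mat real_of_int A *\<^sub>v v) > 0)"

definition even_symmetric_mat :: "int mat \<Rightarrow> bool" where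
  "even_symmetric_mat A \<longleftrightarrow>
     transpose_mat A = A \<and> (\<forall>i<dim_row A. even (A $$ (i, i)))"

text \<open>The block matrix with rows \<open>(0, 0, 1)\<close>, \<open>(0, B, 0)\<close>, \<open>(1, 0, 0)\<close>.\<close>

definition hyperbolic_border :: "int mat \<Rightarrow> int mat" where
  "hyperbolic_border B = (let d = dim_row B in
     mat (d + 2) (d + 2) (\<lambda>(i, j).
       if (i = 0 \<and> j = d + 1) \<or> (i = d + 1 \<and> j = 0) then 1
       else if i \<in> {1..d} \<and> j \<in> {1..d} then B $$ (i - 1, j - 1)
       else 0))"

definition J1_mat :: "int mat \<Rightarrow> int mat" where
  "J1_mat A = hyperbolic_border (- A)"

definition J2_mat :: "int mat \<Rightarrow> int mat" where
  "J2_mat A = hyperbolic_border (J1_mat A)"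

definition qform :: "int mat \<Rightarrow> 'p::prime_card padic vec \<Rightarrow> 'p padic" where
  "qform A x = (x \<bullet> (map_mat of_int (J2_mat A) *\<^sub>v x)) / 2"

definition bform :: "int mat \<Rightarrow> 'p::prime_card padic vec \<Rightarrow> 'p padic vec \<Rightarrow> 'p padic" where
  "bform A x y = qform A (x + y) - qform A x - qform A y"

section \<open>The series \<open>J(s, \<eta>, \<Phi>\<^sub>p)\<close>\<close>

definition J_term ::
  "int mat \<Rightarrow> 'p::prime_card padic vec measure \<Rightarrow> complex \<Rightarrow> 'p padic vec \<Rightarrow> nat \<Rightarrow> complex" where
  "J_term A M s \<eta> r =
     of_nat CARD('p) powr (- (of_nat r * s)) *
     (LINT x:scaled_lattice (dim_vec \<eta>) (1 / of_nat CARD('p) ^ r)|M.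
        padic_char (bform A \<eta> x) *
        of_bool (of_nat CARD('p) ^ r * qform A x \<in> padic_integers))"

definition J_series ::
  "int mat \<Rightarrow> 'p::prime_card padic vec measure \<Rightarrow> complex \<Rightarrow> 'p padic vec \<Rightarrow> complex" where
  "J_series A M s \<eta> = (\<Sum>r. J_term A M s \<eta> r)"

end

theory Submission
  imports Defs "HOL-Number_Theory.Euler_Criterion"
begin

text \<open>The \<open>r\<close>-th integral is the sum \<open>S(r, h)\<close> of \<open>e((h, y) / p ^ r)\<close> over the zeros \<open>y\<close> of \<open>q\<close> modulo
  \<open>p ^ r\<close>, where \<open>h\<close> is an integral approximation of \<open>\<eta>\<close>. Detect \<open>p ^ r dvd q(y)\<close> by the additive
  characters \<open>c\<close> modulo \<open>p ^ r\<close>. The units \<open>c\<close> contribute, after completing the square, a Gauss sum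
  \<open>p ^ (r m)\<close> times a Ramanujan sum of \<open>q(h)\<close>; the multiples of \<open>p\<close> contribute only if \<open>p\<close> divides \<open>h\<close>,
  and then give \<open>p ^ (2 m - 1) S(r - 1, h / p)\<close>. Summing this recursion over \<open>r\<close> yields \<open>Q\<close> as the sum over
  \<open>j \<le> k\<close> of \<open>p ^ (j (m - 1)) X ^ j (1 + X + \<dots> + X ^ (2 k + k' - 2 j))\<close>, which is visibly palindromic.

  The sign of the Gauss sum is found by elimination over the integers. For odd \<open>p\<close> it is governed by the
  Legendre symbol of the determinant; for \<open>p = 2\<close> one splits off binary blocks and reads the Arf invariant
  off the determinant modulo 8. As the determinant is 1 and \<open>m\<close> is even, the sign is positive.\<close>

section \<open>Roots of unity\<close>

text \<open>The prime 2 is included, so nothing may be divided by 2. The form is therefore carried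
  by a triangular integral matrix, and the square is completed with an inverse \<open>w\<close> of
  \<open>u\<close> alone: \<open>u q(y + w h)\<close> is congruent to
  \<open>u q(y) + (h, y) + w q(h)\<close>.

  Gauss sums are evaluated modulo \<open>p\<close> and then propagated, because raising the modulus
  from \<open>p^t\<close> to \<open>p^(t+2)\<close> multiplies the sum by \<open>p^(2m)\<close>.
  Elimination uses integral congruence matrices whose determinant is merely prime to
  \<open>p\<close>. The denominators cleared in this way change determinants by squares of units,
  which alter neither the Legendre symbol nor the residue modulo 8. The dimension \<open>2m\<close>
  is a multiple of 4, so the one-variable sum at an odd prime enters through its fourth power, which
  is \<open>p^2\<close>.

  The approximation \<open>h\<close> depends on \<open>r\<close>, but \<open>S(r, h)\<close> depends
  only on \<open>r\<close>, \<open>k\<close> and \<open>2k + k'\<close>. The terms of the series are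
  thus explicit numbers, all but finitely many of them zero, and the identity holds for every
  complex \<open>s\<close>. The two terms of the Ramanujan sum produce the factor
  \<open>1 - p^(m-1-s)\<close>.\<close>

definition unity :: "int \<Rightarrow> int \<Rightarrow> complex" where
  "unity N a = cis (2 * pi * of_int a / of_int N)"

lemma unity_0 [simp]: "unity N 0 = 1"
  by (simp add: unity_def)

lemma unity_add: "unity N (a + b) = unity N a * unity N b"
  by (simp add: unity_def cis_mult add_divide_distrib distrib_left)

lemma unity_scale: "c \<noteq> 0 \<Longrightarrow> unity (N * c) (a * c) = unity N a"
  unfolding unity_def by (rule arg_cong[of _ _ cis]) simp

lemma unity_eq_1_iff:
  assumes "N > 0"
  shows "unity N a = 1 \<longleftrightarrow> N dvd a"
proof
  assume "unity N a = 1"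
  then have "cos (2 * pi * of_int a / of_int N) = 1"
    unfolding unity_def by (metis cis.sel(1) one_complex.sel(1))
  then obtain k :: int where "2 * pi * of_int a / of_int N = of_int k * 2 * pi"
    using cos_one_2pi_int by auto
  then have "real_of_int a = of_int (N * k)"
    using assms by (simp add: field_simps)
  then have "a = N * k"
    by linarith
  then show "N dvd a" by simp
next
  assume "N dvd a"
  then obtain k where "a = N * k" by auto
  then have "unity N a = cis (2 * pi * of_int k)"
    using assms unfolding unity_def by (intro arg_cong[of _ _ cis]) simp
  then show "unity N a = 1"
    by (simp only: cis_multiple_2pi Ints_of_int)
qed

lemma unity_cong:
  assumes "N > 0" "[a = b] (mod N)"
  shows "unity N a = unity N b"
proof -
  have "unity N a = unity N (b + (a - b))" by simp
  also have "\<dots> = unity N b"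
    using unity_eq_1_iff[of N "a - b"] assms
    by (simp only: unity_add cong_iff_dvd_diff) simp
  finally show ?thesis .
qed

lemma sum_unity:
  assumes "N > 0"
  shows "(\<Sum>c\<in>{0..<N}. unity N (c * a)) = (if N dvd a then of_int N else 0)"
proof (cases "N dvd a")
  case True
  then have "unity N (c * a) = 1" for c
    using assms by (simp add: unity_eq_1_iff)
  then show ?thesis using True assms by simp
next
  case False
  have "unity N a ^ k = unity N (int k * a)" for k
    by (induction k) (simp_all add: unity_add distrib_right)
  moreover have "(\<Sum>c\<in>{0..<N}. unity N (c * a)) = (\<Sum>k<nat N. unity N (int k * a))"
    by (rule sum.reindex_bij_witness[of _ int nat]) (use assms in auto)
  ultimately have "(\<Sum>c\<in>{0..<N}. unity N (c * a)) = (\<Sum>k<nat N. unity N a ^ k)"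
    by simp
  also have "\<dots> = (1 - unity N a ^ nat N) / (1 - unity N a)"
    using False assms unity_eq_1_iff by (intro sum_gp_strict[THEN trans]) auto
  also have "unity N a ^ nat N = 1"
    using \<open>\<And>k. unity N a ^ k = unity N (int k * a)\<close> assms
    by (simp add: unity_eq_1_iff)
  finally show ?thesis using False by simp
qed

section \<open>Sums over cubes\<close>

text \<open>Representatives of the residue vectors modulo \<open>N\<close>. A sum over residue
  classes is a sum over this set of a function that satisfies \<open>periodic\<close>.\<close>

definition cube :: "nat \<Rightarrow> int \<Rightarrow> int vec set" where
  "cube d N = {y \<in> carrier_vec d. \<forall>i<d. y $ i \<in> {0..<N}}"

definition periodic :: "nat \<Rightarrow> int \<Rightarrow> (int vec \<Rightarrow> 'a) \<Rightarrow> bool" where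
  "periodic d N f \<longleftrightarrow> (\<forall>y\<in>carrier_vec d. \<forall>z\<in>carrier_vec d. f (y + N \<cdot>\<^sub>v z) = f y)"

definition reduce :: "int \<Rightarrow> int vec \<Rightarrow> int vec" where
  "reduce N y = map_vec (\<lambda>a. a mod N) y"

lemma cube_carrier: "y \<in> cube d N \<Longrightarrow> y \<in> carrier_vec d"
  by (simp add: cube_def)

lemma finite_cube [simp]: "finite (cube d N)"
proof -
  have "cube d N \<subseteq> (\<lambda>f. vec d f) ` ({..<d} \<rightarrow>\<^sub>E {0..<N})"
  proof
    fix y assume y: "y \<in> cube d N"
    then have "y = vec d (restrict (($) y) {..<d})"
      by (intro eq_vecI) (auto simp: cube_def)
    moreover have "restrict (($) y) {..<d} \<in> {..<d} \<rightarrow>\<^sub>E {0..<N}"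
      using y by (auto simp: cube_def)
    ultimately show "y \<in> (\<lambda>f. vec d f) ` ({..<d} \<rightarrow>\<^sub>E {0..<N})"
      by blast
  qed
  then show ?thesis
    by (rule finite_subset) (intro finite_imageI finite_PiE; simp)
qed

lemma cube_0 [simp]: "cube 0 N = {vNil}"
  by (auto simp: cube_def)

lemma cube_1: "cube d 1 = {0\<^sub>v d}"
  by (force simp: cube_def intro!: eq_vecI)

lemma reduce_carrier [simp]: "reduce N y \<in> carrier_vec d \<longleftrightarrow> y \<in> carrier_vec d"
  by (simp add: reduce_def)

lemma reduce_in_cube: "N > 0 \<Longrightarrow> y \<in> carrier_vec d \<Longrightarrow> reduce N y \<in> cube d N"
  by (auto simp: reduce_def cube_def)

lemma reduce_eq_iff:
  assumes "x \<in> carrier_vec d" "y \<in> carrier_vec d"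
  shows "reduce N x = reduce N y \<longleftrightarrow> (\<forall>i<d. [x $ i = y $ i] (mod N))"
  using assms by (auto simp: reduce_def cong_def vec_eq_iff)

lemma periodic_reduce:
  assumes "periodic d N f" "y \<in> carrier_vec d"
  shows "f (reduce N y) = f y"
proof -
  let ?z = "map_vec (\<lambda>a. a div N) y"
  have "y = reduce N y + N \<cdot>\<^sub>v ?z"
    using assms(2) by (intro eq_vecI) (auto simp: reduce_def)
  then show ?thesis
    using assms unfolding periodic_def by (metis map_carrier_vec reduce_carrier)
qed

text \<open>A map that is injective modulo \<open>N\<close> permutes the finite set of residue
  vectors. \<open>g\<close> may leave the cube, because its values are reduced before the reindexing
  and \<open>f\<close> does not see the reduction.\<close>

lemma sum_cube_reindex:
  fixes f :: "int vec \<Rightarrow> 'a::comm_monoid_add"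
  assumes "N > 0" "periodic d N f"
    and carrier: "\<And>y. y \<in> carrier_vec d \<Longrightarrow> g y \<in> carrier_vec d"
    and inj: "\<And>x y. x \<in> cube d N \<Longrightarrow> y \<in> cube d N \<Longrightarrow>
      (\<forall>i<d. [g x $ i = g y $ i] (mod N)) \<Longrightarrow> (\<forall>i<d. [x $ i = y $ i] (mod N))"
  shows "(\<Sum>y\<in>cube d N. f (g y)) = (\<Sum>y\<in>cube d N. f y)"
proof -
  have fix': "reduce N y = y" if "y \<in> cube d N" for y
    using that by (intro eq_vecI) (auto simp: reduce_def cube_def)
  have "inj_on (\<lambda>y. reduce N (g y)) (cube d N)"
  proof (rule inj_onI)
    fix x y assume xy: "x \<in> cube d N" "y \<in> cube d N" and "reduce N (g x) = reduce N (g y)"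
    then have "reduce N x = reduce N y"
      using inj[of x y] xy carrier by (simp add: reduce_eq_iff[where d = d] cube_carrier)
    then show "x = y" using xy fix' by simp
  qed
  then have "bij_betw (\<lambda>y. reduce N (g y)) (cube d N) (cube d N)"
    unfolding bij_betw_def
  proof (intro conjI endo_inj_surj finite_cube)
    show "(\<lambda>y. reduce N (g y)) ` cube d N \<subseteq> cube d N"
      using assms(1) by (auto intro!: reduce_in_cube carrier dest: cube_carrier)
  qed
  then have "(\<Sum>y\<in>cube d N. f (reduce N (g y))) = (\<Sum>y\<in>cube d N. f y)"
    by (rule sum.reindex_bij_betw)
  then show ?thesis
    using assms carrier by (simp add: periodic_reduce[OF assms(2)] cube_carrier)
qed

lemma sum_cube_shift:
  fixes f :: "int vec \<Rightarrow> 'a::comm_monoid_add"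
  assumes "N > 0" "periodic d N f" "v \<in> carrier_vec d"
  shows "(\<Sum>y\<in>cube d N. f (y + v)) = (\<Sum>y\<in>cube d N. f y)"
  by (rule sum_cube_reindex)
     (use assms in \<open>auto simp: cong_add_rcancel dest!: cube_carrier\<close>)

text \<open>Each coordinate is split into remainder and quotient by \<open>N\<close>. With
  \<open>N\<close> a power of \<open>p\<close> and \<open>M = p\<close> this isolates the top digit,
  on which the exponents below become linear.\<close>

lemma sum_cube_mult:
  fixes f :: "int vec \<Rightarrow> 'a::comm_monoid_add"
  assumes "N > 0" "M > 0"
  shows "(\<Sum>y\<in>cube d (N * M). f y) = (\<Sum>y\<in>cube d N. \<Sum>z\<in>cube d M. f (y + N \<cdot>\<^sub>v z))"
proof -
  have "(\<Sum>y\<in>cube d N. \<Sum>z\<in>cube d M. f (y + N \<cdot>\<^sub>v z)) =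
      (\<Sum>(y, z)\<in>cube d N \<times> cube d M. f (y + N \<cdot>\<^sub>v z))"
    by (simp add: sum.cartesian_product)
  also have "\<dots> = (\<Sum>y\<in>cube d (N * M). f y)"
  proof (rule sum.reindex_bij_witness[of _ "\<lambda>y. (reduce N y, map_vec (\<lambda>a. a div N) y)"
        "\<lambda>(y, z). y + N \<cdot>\<^sub>v z"])
    fix a assume "a \<in> cube d N \<times> cube d M"
    then obtain y z where a: "a = (y, z)" "y \<in> cube d N" "z \<in> cube d M" by auto
    then have yz: "y \<in> carrier_vec d" "z \<in> carrier_vec d"
      by (auto dest: cube_carrier)
    have "0 \<le> y $ i + N * z $ i \<and> y $ i + N * z $ i < N * M" if "i < d" for i
    proof -
      have b: "0 \<le> y $ i" "y $ i < N" "0 \<le> z $ i" "z $ i + 1 \<le> M"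
        using a that by (auto simp: cube_def)
      then have "N * (z $ i + 1) \<le> N * M"
        using assms by (intro mult_left_mono) auto
      then show ?thesis using b assms by (simp add: distrib_left)
    qed
    then show "(case a of (y, z) \<Rightarrow> y + N \<cdot>\<^sub>v z) \<in> cube d (N * M)"
      using a yz by (auto simp: cube_def)
    have "reduce N (y + N \<cdot>\<^sub>v z) = y"
      using a yz assms by (intro eq_vecI) (auto simp: reduce_def cube_def)
    moreover have "map_vec (\<lambda>a. a div N) (y + N \<cdot>\<^sub>v z) = z"
      using a yz assms by (intro eq_vecI) (auto simp: cube_def)
    ultimately show "(reduce N (case a of (y, z) \<Rightarrow> y + N \<cdot>\<^sub>v z),
        map_vec (\<lambda>a. a div N) (case a of (y, z) \<Rightarrow> y + N \<cdot>\<^sub>v z)) = a"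
      using a by simp
  next
    fix y assume y: "y \<in> cube d (N * M)"
    show "(case (reduce N y, map_vec (\<lambda>a. a div N) y) of (y, z) \<Rightarrow> y + N \<cdot>\<^sub>v z) = y"
      by (auto simp: reduce_def)
    have "y $ i div N < M" if "i < d" for i
    proof -
      have "y $ i div N * N + y $ i mod N < M * N" "0 \<le> y $ i mod N"
        using y that assms by (auto simp: cube_def mult.commute[of N M])
      then have "y $ i div N * N < M * N"
        by linarith
      then show ?thesis using assms by simp
    qed
    moreover have "0 \<le> y $ i div N" if "i < d" for i
      using y that assms by (auto simp: cube_def pos_imp_zdiv_nonneg_iff)
    ultimately show "(reduce N y, map_vec (\<lambda>a. a div N) y) \<in> cube d N \<times> cube d M"
      using y assms by (auto simp: cube_def reduce_def)
  qed auto
  finally show ?thesis by simp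
qed

lemma sum_cube_append:
  fixes f :: "int vec \<Rightarrow> 'a::comm_monoid_add"
  shows "(\<Sum>y\<in>cube (b + c) N. f y) = (\<Sum>x\<in>cube b N. \<Sum>y\<in>cube c N. f (x @\<^sub>v y))"
proof -
  have "(\<Sum>x\<in>cube b N. \<Sum>y\<in>cube c N. f (x @\<^sub>v y)) = (\<Sum>(x, y)\<in>cube b N \<times> cube c N. f (x @\<^sub>v y))"
    by (simp add: sum.cartesian_product)
  also have "\<dots> = (\<Sum>y\<in>cube (b + c) N. f y)"
  proof (rule sum.reindex_bij_witness[of _ "\<lambda>y. (vec_first y b, vec_last y c)" "\<lambda>(x, y). x @\<^sub>v y"])
    fix y assume y: "y \<in> cube (b + c) N"
    then show "(case (vec_first y b, vec_last y c) of (x, y) \<Rightarrow> x @\<^sub>v y) = y"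
      by (auto dest: cube_carrier)
    show "(vec_first y b, vec_last y c) \<in> cube b N \<times> cube c N"
      using y by (auto simp: cube_def vec_first_def vec_last_def)
  next
    fix a assume "a \<in> cube b N \<times> cube c N"
    then obtain x y where a: "a = (x, y)" "x \<in> cube b N" "y \<in> cube c N" by auto
    then have xy: "x \<in> carrier_vec b" "y \<in> carrier_vec c" by (auto dest: cube_carrier)
    show "(vec_first (case a of (x, y) \<Rightarrow> x @\<^sub>v y) b, vec_last (case a of (x, y) \<Rightarrow> x @\<^sub>v y) c) = a"
      using a xy by (auto simp: vec_first_def vec_last_def intro!: eq_vecI)
    show "(case a of (x, y) \<Rightarrow> x @\<^sub>v y) \<in> cube (b + c) N"
      using a xy by (auto simp: cube_def)
  qed auto
  finally show ?thesis by simp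
qed

lemma bij_cube_Suc_0: "bij_betw (\<lambda>a. vec (Suc 0) (\<lambda>_. a)) {0..<N} (cube (Suc 0) N)"
  by (rule bij_betw_byWitness[of _ "\<lambda>y. y $ 0"])
     (auto simp: cube_def intro!: eq_vecI)

lemma card_cube:
  assumes "N > 0"
  shows "card (cube d N) = nat N ^ d"
proof (induction d)
  case (Suc d)
  have "card (cube (Suc 0) N) = nat N"
    using bij_betw_same_card[OF bij_cube_Suc_0, of N] by simp
  then show ?case
    using Suc sum_cube_append[of "\<lambda>_. 1 :: nat" "Suc 0" d N] by simp
qed simp

text \<open>Orthogonality of characters: a shift by the unit vector of a coordinate with
  \<open>\<not> N dvd v $ i\<close> multiplies the sum by a factor other than 1.\<close>

lemma sum_cube_linear:
  assumes "N > 0" "v \<in> carrier_vec d"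
  shows "(\<Sum>z\<in>cube d N. unity N (v \<bullet> z)) = (if \<forall>i<d. N dvd v $ i then of_int N ^ d else 0)"
proof (cases "\<forall>i<d. N dvd v $ i")
  case True
  then have "unity N (v \<bullet> z) = 1" if "z \<in> cube d N" for z
    using that assms by (auto simp: unity_eq_1_iff scalar_prod_def cube_def intro!: dvd_sum)
  then show ?thesis
    using True assms by (simp add: card_cube)
next
  case False
  then obtain i where i: "i < d" "\<not> N dvd v $ i" by auto
  let ?f = "\<lambda>z. unity N (v \<bullet> z)"
  let ?S = "\<Sum>z\<in>cube d N. ?f z"
  have "periodic d N ?f"
    unfolding periodic_def using assms
    by (auto simp: scalar_prod_add_distrib[where n = d] unity_add unity_eq_1_iff)
  then have "?S = (\<Sum>z\<in>cube d N. ?f (z + unit_vec d i))"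
    using assms by (intro sum_cube_shift[symmetric]) auto
  also have "\<dots> = (\<Sum>z\<in>cube d N. unity N (v $ i) * ?f z)"
    using assms i by (intro sum.cong refl)
      (auto simp: scalar_prod_add_distrib[where n = d] unity_add dest!: cube_carrier)
  also have "\<dots> = unity N (v $ i) * ?S"
    by (simp add: sum_distrib_left)
  finally have "?S = 0"
    using i assms unity_eq_1_iff[of N "v $ i"] by auto
  with False show ?thesis by (simp only: if_False)
qed

section \<open>Even integral quadratic forms\<close>

text \<open>For even symmetric \<open>A\<close> the halving of the diagonal is exact, and this is
  the upper triangular \<open>U\<close> with \<open>U + U^T = A\<close>. It writes the quadratic
  form with integral coefficients, so that it can be evaluated modulo 2 and over any commutative
  ring.\<close>

definition half_mat :: "int mat \<Rightarrow> int mat" where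
  "half_mat A = mat (dim_row A) (dim_row A) (\<lambda>(i, j).
     if i < j then A $$ (i, j) else if i = j then A $$ (i, i) div 2 else 0)"

text \<open>Polymorphic in the ring, since one integral matrix is evaluated on integer vectors in
  the finite sums and on \<open>p\<close>-adic vectors in the integrand.\<close>

definition bil :: "int mat \<Rightarrow> 'a::comm_ring_1 vec \<Rightarrow> 'a vec \<Rightarrow> 'a" where
  "bil A x y = x \<bullet> (map_mat of_int A *\<^sub>v y)"

text \<open>Half of \<open>bil A x x\<close>, over rings in which 2 need not be invertible.\<close>

definition quad :: "int mat \<Rightarrow> 'a::comm_ring_1 vec \<Rightarrow> 'a" where
  "quad A x = bil (half_mat A) x x"

lemma even_symmetric_mat_index:
  assumes "even_symmetric_mat A" "A \<in> carrier_mat d d" "i < d" "j < d"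
  shows "A $$ (i, j) = A $$ (j, i)"
  using assms unfolding even_symmetric_mat_def
  by (metis carrier_matD index_transpose_mat(1))

lemma half_mat_carrier [simp]: "A \<in> carrier_mat d d \<Longrightarrow> half_mat A \<in> carrier_mat d d"
  by (simp add: half_mat_def)

lemma half_mat_add_transpose:
  assumes "even_symmetric_mat A" "A \<in> carrier_mat d d"
  shows "half_mat A + transpose_mat (half_mat A) = A"
proof (rule eq_matI)
  fix i j assume "i < dim_row A" "j < dim_col A"
  then show "(half_mat A + transpose_mat (half_mat A)) $$ (i, j) = A $$ (i, j)"
    using assms even_symmetric_mat_index[OF assms, of i j]
    by (auto simp: half_mat_def even_symmetric_mat_def)
qed (use assms in \<open>auto simp: half_mat_def\<close>)

lemma bil_add:
  assumes "A \<in> carrier_mat d d" "x \<in> carrier_vec d" "y \<in> carrier_vec d" "z \<in> carrier_vec d"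
  shows bil_add_left: "bil A (x + y) z = bil A x z + bil A y z"
    and bil_add_right: "bil A x (y + z) = bil A x y + bil A x z"
  using assms by (auto simp: bil_def add_scalar_prod_distrib[where n = d]
      scalar_prod_add_distrib[where n = d] mult_add_distrib_mat_vec[where nr = d and nc = d])

lemma bil_smult:
  assumes "A \<in> carrier_mat d d" "x \<in> carrier_vec d" "y \<in> carrier_vec d"
  shows bil_smult_left: "bil A (c \<cdot>\<^sub>v x) y = c * bil A x y"
    and bil_smult_right: "bil A x (c \<cdot>\<^sub>v y) = c * bil A x y"
proof -
  have "map_mat of_int A *\<^sub>v (c \<cdot>\<^sub>v y) = c \<cdot>\<^sub>v (map_mat of_int A *\<^sub>v y)"
    using assms by (intro eq_vecI) auto
  then show "bil A (c \<cdot>\<^sub>v x) y = c * bil A x y" "bil A x (c \<cdot>\<^sub>v y) = c * bil A x y"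
    using assms by (auto simp: bil_def)
qed

lemma bil_transpose:
  assumes "A \<in> carrier_mat d d" "x \<in> carrier_vec d" "y \<in> carrier_vec d"
  shows "bil (transpose_mat A) x y = bil A y x"
proof -
  have "map_mat of_int (transpose_mat A) = transpose_mat (map_mat of_int A :: 'a mat)"
    by (intro eq_matI) auto
  then have "bil (transpose_mat A) x y = (transpose_mat (map_mat of_int A) *\<^sub>v y) \<bullet> x"
    using assms unfolding bil_def by (subst comm_scalar_prod[where n = d]) auto
  then show ?thesis
    using assms unfolding bil_def by (subst (asm) transpose_vec_mult_scalar[where nr = d and nc = d]) auto
qed

lemma bil_sym:
  assumes "even_symmetric_mat A" "A \<in> carrier_mat d d" "x \<in> carrier_vec d" "y \<in> carrier_vec d"
  shows "bil A x y = bil A y x"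
  using bil_transpose[OF assms(2-4)] assms(1) by (simp add: even_symmetric_mat_def)

lemma bil_add_mat:
  assumes "A \<in> carrier_mat d d" "B \<in> carrier_mat d d" "x \<in> carrier_vec d" "y \<in> carrier_vec d"
  shows "bil (A + B) x y = bil A x y + bil B x y"
proof -
  have "map_mat of_int (A + B) = (map_mat of_int A + map_mat of_int B :: 'a mat)"
    using assms by (intro eq_matI) auto
  then show ?thesis
    using assms unfolding bil_def
    by (simp add: add_mult_distrib_mat_vec[where nr = d and nc = d]
        scalar_prod_add_distrib[where n = d])
qed

lemma bil_half:
  assumes "even_symmetric_mat A" "A \<in> carrier_mat d d" "x \<in> carrier_vec d" "y \<in> carrier_vec d"
  shows "bil (half_mat A) x y + bil (half_mat A) y x = bil A x y"
proof -
  let ?U = "half_mat A"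
  have "bil ?U x y + bil ?U y x = bil ?U x y + bil (transpose_mat ?U) x y"
    using assms by (simp add: bil_transpose[where d = d])
  also have "\<dots> = bil (?U + transpose_mat ?U) x y"
    using assms by (intro bil_add_mat[symmetric]) auto
  finally show ?thesis
    by (simp add: half_mat_add_transpose[OF assms(1,2)])
qed

lemma two_quad:
  assumes "even_symmetric_mat A" "A \<in> carrier_mat d d" "x \<in> carrier_vec d"
  shows "2 * quad A x = bil A x x"
  using bil_half[OF assms assms(3)] by (simp add: quad_def)

lemma quad_add:
  assumes "even_symmetric_mat A" "A \<in> carrier_mat d d" "x \<in> carrier_vec d" "y \<in> carrier_vec d"
  shows "quad A (x + y) = quad A x + quad A y + bil A x y"
  using assms
  by (simp add: quad_def bil_add[where d = d] bil_half[OF assms, symmetric] algebra_simps)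

lemma quad_smult:
  assumes "A \<in> carrier_mat d d" "x \<in> carrier_vec d"
  shows "quad A (c \<cdot>\<^sub>v x) = c\<^sup>2 * quad A x"
  using assms by (simp add: quad_def bil_smult[where d = d] power2_eq_square)

lemma bil_map_vec:
  assumes "comm_ring_hom h" "A \<in> carrier_mat d d" "x \<in> carrier_vec d" "y \<in> carrier_vec d"
  shows "bil A (map_vec h x) (map_vec h y) = h (bil A x y)"
proof -
  interpret comm_ring_hom h by fact
  have "map_mat of_int A = map_mat h (map_mat of_int A)"
    by (intro eq_matI) (auto simp: hom_of_int)
  then have "map_mat of_int A *\<^sub>v map_vec h y = map_vec h (map_mat of_int A *\<^sub>v y)"
    using assms by (simp add: mult_mat_vec_hom[where nr = d and n = d])
  then show ?thesis
    using assms by (auto simp: bil_def scalar_prod_def hom_distribs)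
qed

lemma quad_map_vec:
  assumes "comm_ring_hom h" "A \<in> carrier_mat d d" "x \<in> carrier_vec d"
  shows "quad A (map_vec h x) = h (quad A x)"
  using bil_map_vec[OF assms(1) _ assms(3,3), of "half_mat A"] assms by (simp add: quad_def)

lemma bil_int: "bil A x y = x \<bullet> (A *\<^sub>v y)" for x :: "int vec"
proof -
  have "map_mat id A = A"
    by (intro eq_matI) auto
  then show ?thesis by (simp add: bil_def)
qed

lemma even_bil_self:
  fixes x :: "int vec"
  assumes "even_symmetric_mat A" "A \<in> carrier_mat d d" "x \<in> carrier_vec d"
  shows "even (bil A x x)"
  using two_quad[OF assms] by (metis dvd_triv_left)

text \<open>The diagonal entries of the new matrix are the values \<open>bil A x x\<close> at the
  rows \<open>x\<close> of \<open>P\<close>, hence even.\<close>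

lemma even_symmetric_congruence:
  assumes "even_symmetric_mat A" "A \<in> carrier_mat d d" "P \<in> carrier_mat c d"
  shows "even_symmetric_mat (P * A * transpose_mat P)"
proof -
  have PA: "P * A \<in> carrier_mat c d" using assms by auto
  have "transpose_mat (P * A * transpose_mat P) = P * (transpose_mat A * transpose_mat P)"
    using assms by (simp add: transpose_mult[where n = d and nr = c and nc = c] transpose_mult[where nr = d and n = d and nc = c])
  also have "\<dots> = P * A * transpose_mat P"
    using assms by (simp add: even_symmetric_mat_def assoc_mult_mat[where n\<^sub>2 = d and n\<^sub>3 = d])
  finally have sym: "transpose_mat (P * A * transpose_mat P) = P * A * transpose_mat P" .
  have "even ((P * A * transpose_mat P) $$ (i, i))" if "i < c" for i
  proof -
    have "(P * A * transpose_mat P) $$ (i, i) = (P * (A * transpose_mat P)) $$ (i, i)"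
      using assms by (simp add: assoc_mult_mat[where n\<^sub>2 = d and n\<^sub>3 = d])
    also have "\<dots> = row P i \<bullet> col (A * transpose_mat P) i"
      using assms that by (intro index_mult_mat) auto
    also have "col (A * transpose_mat P) i = A *\<^sub>v row P i"
      using assms that by (auto simp: col_mult2[where nr = d and nc = c and n = d])
    finally have "(P * A * transpose_mat P) $$ (i, i) = row P i \<bullet> (A *\<^sub>v row P i)" .
    moreover have "row P i \<in> carrier_vec d"
      using assms(3) by (simp add: row_def)
    ultimately show ?thesis
      using even_bil_self[OF assms(1,2), of "row P i"] by (simp only: bil_int)
  qed
  with sym show ?thesis
    using assms by (auto simp: even_symmetric_mat_def)
qed

lemma quad_congruence:
  fixes x :: "int vec"
  assumes "even_symmetric_mat A" "A \<in> carrier_mat d d" "P \<in> carrier_mat c d" "x \<in> carrier_vec c"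
  shows "quad (P * A * transpose_mat P) x = quad A (transpose_mat P *\<^sub>v x)"
proof -
  have PA: "P * A \<in> carrier_mat c d" and tP: "transpose_mat P \<in> carrier_mat d c" using assms by auto
  have "2 * quad (P * A * transpose_mat P) x = bil (P * A * transpose_mat P) x x"
    using assms by (intro two_quad[where d = c] even_symmetric_congruence[where d = d]) auto
  also have "\<dots> = x \<bullet> (P *\<^sub>v (A *\<^sub>v (transpose_mat P *\<^sub>v x)))"
    using assms PA tP by (simp add: bil_int assoc_mult_mat_vec[where n\<^sub>1 = c and n\<^sub>2 = d and n\<^sub>3 = c]
      assoc_mult_mat_vec[where n\<^sub>1 = c and n\<^sub>2 = d and n\<^sub>3 = d])
  also have "\<dots> = (transpose_mat P *\<^sub>v x) \<bullet> (A *\<^sub>v (transpose_mat P *\<^sub>v x))"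
    using assms by (subst transpose_vec_mult_scalar[where nr = c and nc = d, symmetric]) auto
  also have "\<dots> = 2 * quad A (transpose_mat P *\<^sub>v x)"
    using assms by (simp add: two_quad[where d = d] bil_int)
  finally show ?thesis by simp
qed

text \<open>Multiplication by the adjugate turns \<open>A *\<^sub>v v\<close> into
  \<open>det A\<close> times \<open>v\<close>, and \<open>det A\<close> can be cancelled modulo
  \<open>N\<close>.\<close>

lemma mod_nonsingular:
  fixes A :: "int mat"
  assumes "A \<in> carrier_mat d d" "coprime (det A) N" "v \<in> carrier_vec d"
    and "\<forall>i<d. N dvd (A *\<^sub>v v) $ i"
  shows "\<forall>i<d. N dvd v $ i"
proof (intro allI impI)
  fix i assume i: "i < d"
  have "adj_mat A *\<^sub>v (A *\<^sub>v v) = det A \<cdot>\<^sub>v v"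
    using assms(1,3) adj_mat[OF assms(1)]
    by (subst assoc_mult_mat_vec[where n\<^sub>1 = d and n\<^sub>2 = d and n\<^sub>3 = d, symmetric]) auto
  moreover have "(adj_mat A *\<^sub>v (A *\<^sub>v v)) $ i = row (adj_mat A) i \<bullet> (A *\<^sub>v v)"
    using adj_mat(1)[OF assms(1)] i by auto
  moreover have "N dvd row (adj_mat A) i \<bullet> (A *\<^sub>v v)"
    using assms unfolding scalar_prod_def by (auto intro!: dvd_sum)
  ultimately have "N dvd det A * v $ i"
    using assms i by (metis carrier_vecD index_smult_vec(1))
  then show "N dvd v $ i"
    using assms(2) by (simp add: coprime_dvd_mult_right_iff coprime_commute)
qed

section \<open>Quadratic Gauss sums\<close>

lemma even_symmetric_mat_iff:
  assumes "A \<in> carrier_mat d d"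
  shows "even_symmetric_mat A \<longleftrightarrow>
    (\<forall>i<d. \<forall>j<d. A $$ (i, j) = A $$ (j, i)) \<and> (\<forall>i<d. even (A $$ (i, i)))"
  using assms even_symmetric_mat_index[of A d]
  by (auto simp: even_symmetric_mat_def intro!: eq_matI)

definition gauss_sum :: "int mat \<Rightarrow> int \<Rightarrow> int \<Rightarrow> complex" where
  "gauss_sum A u N = (\<Sum>y\<in>cube (dim_row A) N. unity N (u * quad A y))"

lemma periodic_unity_quad:
  assumes "even_symmetric_mat A" "A \<in> carrier_mat d d" "h \<in> carrier_vec d" "N > 0"
  shows "periodic d N (\<lambda>y. unity N (u * quad A y + bil A h y))"
  unfolding periodic_def
proof (intro ballI)
  fix y z :: "int vec" assume yz: "y \<in> carrier_vec d" "z \<in> carrier_vec d"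
  have "u * quad A (y + N \<cdot>\<^sub>v z) + bil A h (y + N \<cdot>\<^sub>v z) =
      u * quad A y + bil A h y + N * (u * N * quad A z + u * bil A y z + bil A h z)"
    using assms yz
    by (simp add: quad_add[where d = d] quad_smult[where d = d] bil_smult[where d = d]
        bil_add[where d = d] power2_eq_square algebra_simps)
  then show "unity N (u * quad A (y + N \<cdot>\<^sub>v z) + bil A h (y + N \<cdot>\<^sub>v z)) =
      unity N (u * quad A y + bil A h y)"
    using assms by (simp add: unity_add unity_eq_1_iff)
qed

lemma periodic_unity_quad':
  assumes "even_symmetric_mat A" "A \<in> carrier_mat d d" "N > 0"
  shows "periodic d N (\<lambda>y. unity N (u * quad A y))"
  using periodic_unity_quad[OF assms(1,2) zero_carrier_vec assms(3), of u] assms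
  by (auto simp: periodic_def bil_int)

text \<open>A determinant prime to \<open>N\<close> suffices for \<open>transpose_mat P\<close> to
  permute the residue vectors. This leaves room for integral matrices that clear denominators and
  are not invertible over the integers.\<close>

lemma gauss_sum_congruence:
  assumes "even_symmetric_mat A" "A \<in> carrier_mat d d" "P \<in> carrier_mat d d"
    and "coprime (det P) N" "N > 0"
  shows "gauss_sum (P * A * transpose_mat P) u N = gauss_sum A u N"
proof -
  let ?Q = "transpose_mat P"
  have "gauss_sum (P * A * ?Q) u N = (\<Sum>y\<in>cube d N. unity N (u * quad A (?Q *\<^sub>v y)))"
    using assms(3) unfolding gauss_sum_def
    by (intro sum.cong) (simp_all add: quad_congruence[OF assms(1-3) cube_carrier] del: assoc_mult_mat)
  also have "\<dots> = (\<Sum>y\<in>cube d N. unity N (u * quad A y))"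
  proof (rule sum_cube_reindex[OF \<open>N > 0\<close> periodic_unity_quad'[OF assms(1,2,5)]])
    fix x y assume "x \<in> cube d N" "y \<in> cube d N"
    then have xy: "x \<in> carrier_vec d" "y \<in> carrier_vec d" by (auto dest: cube_carrier)
    assume "\<forall>i<d. [(?Q *\<^sub>v x) $ i = (?Q *\<^sub>v y) $ i] (mod N)"
    moreover have "?Q *\<^sub>v (x - y) = ?Q *\<^sub>v x - ?Q *\<^sub>v y"
      using xy assms by (simp add: mult_minus_distrib_mat_vec[where nr = d and nc = d])
    ultimately have dvd: "\<forall>i<d. N dvd (?Q *\<^sub>v (x - y)) $ i"
      using assms(3) xy by (simp add: cong_iff_dvd_diff)
    have Q: "?Q \<in> carrier_mat d d" "coprime (det ?Q) N"
      using assms(3,4) by (simp_all add: det_transpose)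
    have "\<forall>i<d. N dvd (x - y) $ i"
      by (rule mod_nonsingular[OF Q minus_carrier_vec[OF xy] dvd])
    then show "\<forall>i<d. [x $ i = y $ i] (mod N)"
      using xy by (auto simp: cong_iff_dvd_diff)
  qed (use assms(3) in simp)
  finally show ?thesis
    using assms(2) by (simp add: gauss_sum_def)
qed

lemma even_symmetric_four_block:
  assumes "even_symmetric_mat (four_block_mat M B D C)"
    and "M \<in> carrier_mat b b" "C \<in> carrier_mat c c"
  shows "even_symmetric_mat M" and "even_symmetric_mat C"
proof -
  have "four_block_mat M B D C \<in> carrier_mat (b + c) (b + c)"
    using assms by auto
  then have sym: "i < b + c \<Longrightarrow> j < b + c \<Longrightarrow>
        four_block_mat M B D C $$ (i, j) = four_block_mat M B D C $$ (j, i)"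
      "i < b + c \<Longrightarrow> even (four_block_mat M B D C $$ (i, i))" for i j
    using assms(1) even_symmetric_mat_iff by blast+
  have "M $$ (i, j) = M $$ (j, i)" "even (M $$ (i, i))" if "i < b" "j < b" for i j
    using sym(1)[of i j] sym(2)[of i] that assms by auto
  then show "even_symmetric_mat M"
    using assms by (auto simp: even_symmetric_mat_iff)
  have "C $$ (i, j) = C $$ (j, i)" "even (C $$ (i, i))" if "i < c" "j < c" for i j
    using sym(1)[of "b + i" "b + j"] sym(2)[of "b + i"] that assms by auto
  then show "even_symmetric_mat C"
    using assms by (auto simp: even_symmetric_mat_iff)
qed

lemma gauss_sum_four_block:
  assumes "even_symmetric_mat (four_block_mat M (0\<^sub>m b c) (0\<^sub>m c b) C)"
    and "M \<in> carrier_mat b b" "C \<in> carrier_mat c c"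
  shows "gauss_sum (four_block_mat M (0\<^sub>m b c) (0\<^sub>m c b) C) u N = gauss_sum M u N * gauss_sum C u N"
proof -
  let ?A = "four_block_mat M (0\<^sub>m b c) (0\<^sub>m c b) C"
  have A: "?A \<in> carrier_mat (b + c) (b + c)" using assms by auto
  have "quad ?A (x @\<^sub>v y) = quad M x + quad C y" if "x \<in> carrier_vec b" "y \<in> carrier_vec c" for x y :: "int vec"
  proof -
    have "2 * quad ?A (x @\<^sub>v y) = (x @\<^sub>v y) \<bullet> (?A *\<^sub>v (x @\<^sub>v y))"
      using that by (simp add: two_quad[OF assms(1) A] bil_int)
    also have "?A *\<^sub>v (x @\<^sub>v y) = (M *\<^sub>v x) @\<^sub>v (C *\<^sub>v y)"
      using assms that
      by (subst four_block_mat_mult_vec[where ?nr1.0 = b and ?nr2.0 = c and ?nc1.0 = b and ?nc2.0 = c]) auto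
    also have "(x @\<^sub>v y) \<bullet> ((M *\<^sub>v x) @\<^sub>v (C *\<^sub>v y)) = bil M x x + bil C y y"
      using assms that by (simp add: scalar_prod_append[where ?n1.0 = b and ?n2.0 = c] bil_int)
    also have "\<dots> = 2 * (quad M x + quad C y)"
      using even_symmetric_four_block[OF assms] assms that
      by (simp add: two_quad[where d = b, symmetric] two_quad[where d = c, symmetric])
    finally show ?thesis by simp
  qed
  then have "gauss_sum ?A u N =
      (\<Sum>x\<in>cube b N. \<Sum>y\<in>cube c N. unity N (u * quad M x) * unity N (u * quad C y))"
    using assms unfolding gauss_sum_def
    by (auto simp: sum_cube_append distrib_left unity_add dest!: cube_carrier intro!: sum.cong)
  also have "\<dots> = gauss_sum M u N * gauss_sum C u N"
    using assms unfolding gauss_sum_def by (simp add: sum_product)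
  finally show ?thesis .
qed

text \<open>Completing the square with respect to the leading block \<open>M\<close>, whose inverse is \<open>\<delta>\<^sup>-\<^sup>1 E\<close>. The
  Schur complement is multiplied by \<open>\<delta>\<^sup>2\<close> to stay integral.\<close>

lemma gauss_sum_schur:
  assumes A: "even_symmetric_mat A" "A \<in> carrier_mat (b + c) (b + c)"
    and M: "M = mat b b (\<lambda>(i, j). A $$ (i, j))"
    and E: "E \<in> carrier_mat b b" "transpose_mat E = E" "M * E = \<delta> \<cdot>\<^sub>m 1\<^sub>m b" "E * M = \<delta> \<cdot>\<^sub>m 1\<^sub>m b"
    and N: "coprime \<delta> N" "N > 0"
  obtains C where "C \<in> carrier_mat c c" "even_symmetric_mat C"
    "\<delta> ^ (2 * c) * det A = det M * det C"
    "\<And>u. gauss_sum A u N = gauss_sum M u N * gauss_sum C u N"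
proof -
  define B where "B = mat b c (\<lambda>(i, j). A $$ (i, b + j))"
  define D where "D = mat c c (\<lambda>(i, j). A $$ (b + i, b + j))"
  have carr: "M \<in> carrier_mat b b" "B \<in> carrier_mat b c" "D \<in> carrier_mat c c"
    "transpose_mat B \<in> carrier_mat c b"
    by (auto simp: M B_def D_def)
  have A_eq: "A = four_block_mat M B (transpose_mat B) D"
    using A even_symmetric_mat_index[OF A]
    by (intro eq_matI) (auto simp: M B_def D_def)
  let ?F = "transpose_mat B * E"
  \<comment> \<open>Ordinary elimination would subtract \<open>B^T M^-1\<close> times the first
    block row from the second. With \<open>M^-1 = E / \<delta>\<close> the second block row is
    multiplied through by \<open>\<delta>\<close>, which gives \<open>det P = \<delta> ^ c\<close>,
    prime to \<open>N\<close>.\<close>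
  define P where "P = four_block_mat (1\<^sub>m b) (0\<^sub>m b c) (- ?F) (\<delta> \<cdot>\<^sub>m 1\<^sub>m c)"
  define C where "C = \<delta> \<cdot>\<^sub>m (\<delta> \<cdot>\<^sub>m D - ?F * B)"
  have F: "?F \<in> carrier_mat c b" using carr E by auto
  have P: "P \<in> carrier_mat (b + c) (b + c)" by (auto simp: P_def)
  define D' where "D' = \<delta> \<cdot>\<^sub>m D - ?F * B"
  have FB: "?F * B \<in> carrier_mat c c"
    by (rule mult_carrier_mat[OF F carr(2)])
  then have D': "D' \<in> carrier_mat c c"
    unfolding D'_def by (rule minus_carrier_mat)
  have C_eq: "C = \<delta> \<cdot>\<^sub>m D'"
    unfolding C_def D'_def ..
  have C: "C \<in> carrier_mat c c"
    unfolding C_eq by (rule smult_carrier_mat[OF D'])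
  have scal: "\<delta> \<cdot>\<^sub>m 1\<^sub>m k * X = \<delta> \<cdot>\<^sub>m X" if "X \<in> carrier_mat k l" for X k l
    using that by (simp add: mult_smult_assoc_mat[where nr = k and n = k and nc = l])
  have scal': "X * (\<delta> \<cdot>\<^sub>m 1\<^sub>m k) = \<delta> \<cdot>\<^sub>m X" if "X \<in> carrier_mat l k" for X k l
    using that by (simp add: mult_smult_distrib[where nr = l and n = k and nc = k])
  have FM: "?F * M = \<delta> \<cdot>\<^sub>m transpose_mat B"
    using assoc_mult_mat[OF carr(4) E(1) carr(1)] scal'[OF carr(4)] by (simp only: E(4))
  have tF: "transpose_mat ?F = E * B"
    unfolding transpose_mult[OF carr(4) E(1)] E(2) transpose_transpose ..
  have EB: "E * B \<in> carrier_mat b c" by (rule mult_carrier_mat[OF E(1) carr(2)])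
  have MF: "M * (E * B) = \<delta> \<cdot>\<^sub>m B"
    using assoc_mult_mat[OF carr(1) E(1) carr(2)] scal[OF carr(2)] by (simp only: E(3))
  have um: "- ?F * M = - (?F * M)" "- ?F * B = - (?F * B)" "M * - (E * B) = - (M * (E * B))"
    "0\<^sub>m c b * - (E * B) = - (0\<^sub>m c b * (E * B))"
    using F[THEN carrier_matD(2)] carr[THEN carrier_matD(1)] carr[THEN carrier_matD(2)]
      EB[THEN carrier_matD(1)] by simp_all
  have zEB: "0\<^sub>m c b * (E * B) = 0\<^sub>m c c" by (rule left_mult_zero_mat[OF EB])
  have PA: "P * A = four_block_mat M B (0\<^sub>m c b) D'"
  proof -
    have 1: "- ?F * M + \<delta> \<cdot>\<^sub>m 1\<^sub>m c * transpose_mat B = 0\<^sub>m c b"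
      unfolding um FM scal[OF carr(4)] using carr(2) by (intro eq_matI) auto
    have 2: "- ?F * B + \<delta> \<cdot>\<^sub>m 1\<^sub>m c * D = D'"
    proof -
      have "- ?F * B + \<delta> \<cdot>\<^sub>m 1\<^sub>m c * D = - (?F * B) + \<delta> \<cdot>\<^sub>m D"
        by (simp only: um scal[OF carr(3)])
      also have "\<dots> = \<delta> \<cdot>\<^sub>m D + - (?F * B)"
        by (rule comm_add_mat[OF uminus_carrier_mat[OF FB] smult_carrier_mat[OF carr(3)]])
      also have "\<dots> = D'"
        unfolding D'_def by (rule minus_add_uminus_mat[OF smult_carrier_mat[OF carr(3)] FB, symmetric])
      finally show ?thesis .
    qed
    have 3: "1\<^sub>m b * M + 0\<^sub>m b c * transpose_mat B = M" "1\<^sub>m b * B + 0\<^sub>m b c * D = B"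
      using carr by auto
    have "P * A = four_block_mat (1\<^sub>m b * M + 0\<^sub>m b c * transpose_mat B) (1\<^sub>m b * B + 0\<^sub>m b c * D)
        (- ?F * M + \<delta> \<cdot>\<^sub>m 1\<^sub>m c * transpose_mat B) (- ?F * B + \<delta> \<cdot>\<^sub>m 1\<^sub>m c * D)"
      unfolding P_def A_eq by (rule mult_four_block_mat[where ?nr1.0 = b and ?n1.0 = b and ?n2.0 = c and ?nr2.0 = c and ?nc1.0 = b and ?nc2.0 = c]) (use carr F in auto)
    then show ?thesis by (simp only: 1 2 3)
  qed
  have tP: "transpose_mat P = four_block_mat (1\<^sub>m b) (- (E * B)) (0\<^sub>m c b) (\<delta> \<cdot>\<^sub>m 1\<^sub>m c)"
  proof -
    have "transpose_mat P = four_block_mat (transpose_mat (1\<^sub>m b)) (transpose_mat (- ?F))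
        (transpose_mat (0\<^sub>m b c)) (transpose_mat (\<delta> \<cdot>\<^sub>m 1\<^sub>m c))"
      unfolding P_def by (rule transpose_four_block_mat[where ?nr1.0 = b and ?nc1.0 = b and ?nr2.0 = c and ?nc2.0 = c]) (use F in auto)
    moreover have "transpose_mat (\<delta> \<cdot>\<^sub>m 1\<^sub>m c) = \<delta> \<cdot>\<^sub>m 1\<^sub>m c" "transpose_mat (0\<^sub>m b c) = (0\<^sub>m c b :: int mat)"
      by auto
    ultimately show ?thesis by (simp only: transpose_uminus tF transpose_one)
  qed
  have PAP: "P * A * transpose_mat P = four_block_mat M (0\<^sub>m b c) (0\<^sub>m c b) C"
  proof -
    have 1: "M * - (E * B) + B * (\<delta> \<cdot>\<^sub>m 1\<^sub>m c) = 0\<^sub>m b c"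
      unfolding um MF scal'[OF carr(2)] using carr(2) by (intro eq_matI) auto
    have 2: "0\<^sub>m c b * - (E * B) + D' * (\<delta> \<cdot>\<^sub>m 1\<^sub>m c) = C"
      unfolding um zEB scal'[OF D'] C_eq using D' by (intro eq_matI) auto
    have 3: "M * 1\<^sub>m b + B * 0\<^sub>m c b = M" "0\<^sub>m c b * 1\<^sub>m b + D' * 0\<^sub>m c b = 0\<^sub>m c b"
      using carr D' by auto
    have "P * A * transpose_mat P = four_block_mat (M * 1\<^sub>m b + B * 0\<^sub>m c b)
        (M * - (E * B) + B * (\<delta> \<cdot>\<^sub>m 1\<^sub>m c)) (0\<^sub>m c b * 1\<^sub>m b + D' * 0\<^sub>m c b)
        (0\<^sub>m c b * - (E * B) + D' * (\<delta> \<cdot>\<^sub>m 1\<^sub>m c))"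
      unfolding PA tP by (rule mult_four_block_mat[where ?nr1.0 = b and ?n1.0 = b and ?n2.0 = c and ?nr2.0 = c and ?nc1.0 = b and ?nc2.0 = c]) (use carr D' EB in auto)
    then show ?thesis by (simp only: 1 2 3)
  qed
  have det_P: "det P = \<delta> ^ c"
    unfolding P_def using F by (subst det_four_block_mat_upper_right_zero[where n = b and m = c]) auto
  have "det (P * A * transpose_mat P) = \<delta> ^ (2 * c) * det A"
  proof -
    have "det (P * A * transpose_mat P) = det (P * A) * det (transpose_mat P)"
      using A P by (intro det_mult[where n = "b + c"]) auto
    then show ?thesis
      using A P by (simp add: det_mult[where n = "b + c"] det_transpose[where n = "b + c"] det_P mult_2 power_add)
  qed
  moreover have "det (P * A * transpose_mat P) = det M * det C"
    unfolding PAP using carr C by (subst det_four_block_mat_upper_right_zero[where n = b and m = c]) auto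
  ultimately have det: "\<delta> ^ (2 * c) * det A = det M * det C" by simp
  have ev: "even_symmetric_mat (four_block_mat M (0\<^sub>m b c) (0\<^sub>m c b) C)"
    using even_symmetric_congruence[OF A P] by (simp only: PAP)
  have "gauss_sum A u N = gauss_sum M u N * gauss_sum C u N" for u
    using gauss_sum_congruence[OF A P, of N u] gauss_sum_four_block[OF ev carr(1) C, of u N] N
    unfolding PAP det_P by simp
  with that[OF C even_symmetric_four_block(2)[OF ev carr(1) C] det] show thesis by blast
qed

section \<open>Quadratic Gauss sums in one variable at an odd prime\<close>

lemma sum_residues_reindex:
  fixes f :: "int \<Rightarrow> 'a::comm_monoid_add"
  assumes "N > 0" and f: "\<And>x. f (x mod N) = f x"
    and inj: "\<And>x y. [g x = g y] (mod N) \<Longrightarrow> [x = y] (mod N)"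
  shows "(\<Sum>x\<in>{0..<N}. f (g x)) = (\<Sum>x\<in>{0..<N}. f x)"
proof -
  have "inj_on (\<lambda>x. g x mod N) {0..<N}"
  proof (rule inj_onI)
    fix x y assume "x \<in> {0..<N}" "y \<in> {0..<N}" "g x mod N = g y mod N"
    then show "x = y" using inj[of x y] by (simp add: cong_def)
  qed
  then have "bij_betw (\<lambda>x. g x mod N) {0..<N} {0..<N}"
    unfolding bij_betw_def
  proof (intro conjI endo_inj_surj)
    show "(\<lambda>x. g x mod N) ` {0..<N} \<subseteq> {0..<N}"
      using assms(1) by auto
  qed simp_all
  then have "(\<Sum>x\<in>{0..<N}. f (g x mod N)) = (\<Sum>x\<in>{0..<N}. f x)"
    by (rule sum.reindex_bij_betw)
  then show ?thesis by (simp add: f)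
qed

definition gauss1 :: "int \<Rightarrow> int \<Rightarrow> complex" where
  "gauss1 p u = (\<Sum>x\<in>{0..<p}. unity p (u * x\<^sup>2))"

context
  fixes p :: int
  assumes p: "prime p" "odd p"
begin

lemma odd_prime_gt_2: "p > 2"
  using p by (metis le_neq_trans linorder_not_le order.order_iff_strict prime_ge_2_int even_numeral)

lemma Legendre_cases:
  assumes "\<not> p dvd a"
  shows "Legendre a p = 1 \<or> Legendre a p = - 1"
  using assms by (auto simp: Legendre_def cong_0_iff)

lemma Legendre_mod: "Legendre (a mod p) p = Legendre a p"
  by (simp add: Legendre_def QuadRes_def cong_def)

text \<open>Both sides agree modulo \<open>p\<close> by Euler's criterion, and they differ by at
  most 2, which is less than \<open>p\<close>.\<close>

lemma Legendre_mult: "Legendre (a * b) p = Legendre a p * Legendre b p"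
proof -
  have crit: "[Legendre x p = x ^ ((nat p - 1) div 2)] (mod p)" for x
    using euler_criterion[of "nat p" x] p odd_prime_gt_2 by simp
  have "[Legendre (a * b) p = Legendre a p * Legendre b p] (mod p)"
    using crit[of "a * b"] cong_sym[OF cong_mult[OF crit[of a] crit[of b]]]
    unfolding power_mult_distrib by (rule cong_trans)
  then have "p dvd Legendre (a * b) p - Legendre a p * Legendre b p"
    by (simp add: cong_iff_dvd_diff)
  moreover have "\<bar>Legendre (a * b) p - Legendre a p * Legendre b p\<bar> < p"
    using odd_prime_gt_2 by (auto simp: Legendre_def)
  ultimately show ?thesis
    by (metis dvd_imp_le_int linorder_not_le abs_of_nonneg odd_prime_gt_2 eq_iff_diff_eq_0 order.strict_implies_order zero_less_numeral order.strict_trans)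
qed

lemma Legendre_square: "\<not> p dvd a \<Longrightarrow> Legendre a p * Legendre a p = 1"
  using Legendre_cases by fastforce

lemma Legendre_1: "Legendre 1 p = 1"
proof -
  have "QuadRes p 1" by (auto simp: QuadRes_def intro!: exI[of _ 1])
  then show ?thesis
    using odd_prime_gt_2 by (auto simp: Legendre_def cong_0_iff)
qed

text \<open>The roots of a nonzero square are \<open>b\<close> and \<open>p - b\<close>. Counting
  through the Legendre symbol also covers \<open>z = 0\<close>, where the symbol is 0 and the root
  is unique.\<close>

lemma card_sqrt_mod:
  assumes "z \<in> {0..<p}"
  shows "int (card {x \<in> {0..<p}. x\<^sup>2 mod p = z}) = 1 + Legendre z p"
proof (cases "z = 0")
  case True
  have "{x \<in> {0..<p}. x\<^sup>2 mod p = z} = {0}"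
    using True p odd_prime_gt_2 by (auto simp: prime_dvd_power_iff dest: zdvd_imp_le simp flip: dvd_eq_mod_eq_0)
  then show ?thesis using True by (simp add: Legendre_def)
next
  case False
  then have z: "\<not> [z = 0] (mod p)" using assms by (simp add: cong_def)
  show ?thesis
  proof (cases "QuadRes p z")
    case nres: False
    then have empty: "{x \<in> {0..<p}. x\<^sup>2 mod p = z} = {}"
      using assms by (auto simp: QuadRes_def cong_def)
    show ?thesis unfolding empty using z nres by (simp add: Legendre_def)
  next
    case True
    then obtain y where "[y\<^sup>2 = z] (mod p)" by (auto simp: QuadRes_def)
    define b where "b = y mod p"
    have b: "b\<^sup>2 mod p = z" "0 \<le> b" "b < p"
      using \<open>[y\<^sup>2 = z] (mod p)\<close> assms odd_prime_gt_2 by (auto simp: b_def cong_def power_mod)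
    then have "b \<noteq> 0" using False by auto
    have "{x \<in> {0..<p}. x\<^sup>2 mod p = z} = {b, p - b}"
    proof (intro equalityI subsetI)
      fix x assume "x \<in> {x \<in> {0..<p}. x\<^sup>2 mod p = z}"
      then have x: "0 \<le> x" "x < p" "x\<^sup>2 mod p = b\<^sup>2 mod p" using b by auto
      then have "p dvd x\<^sup>2 - b\<^sup>2" by (simp add: mod_eq_dvd_iff)
      then have "p dvd (x - b) * (x + b)" by (simp add: power2_eq_square algebra_simps)
      then consider "p dvd x - b" | "p dvd x + b" using p by (auto simp: prime_dvd_mult_iff)
      then show "x \<in> {b, p - b}"
      proof cases
        case 1
        then have "x mod p = b mod p" by (simp add: mod_eq_dvd_iff)
        then show ?thesis using x b by simp
      next
        case 2
        then obtain t where t: "x + b = p * t" by auto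
        have "0 < p * t" "p * t < p * 2" using x b \<open>b \<noteq> 0\<close> t by linarith+
        then have "0 < t" "t < 2" using odd_prime_gt_2 by (simp_all add: zero_less_mult_iff)
        then have "t = 1" by simp
        then show ?thesis using t by simp
      qed
    next
      fix x assume x: "x \<in> {b, p - b}"
      have "(p - b)\<^sup>2 = b\<^sup>2 + p * (p - 2 * b)" by (simp add: power2_eq_square algebra_simps)
      then show "x \<in> {x \<in> {0..<p}. x\<^sup>2 mod p = z}"
        using x b \<open>b \<noteq> 0\<close> by auto
    qed
    moreover have "b \<noteq> p - b" using p by auto
    ultimately show ?thesis using z True by (simp add: Legendre_def)
  qed
qed

lemma unity_mod: "unity p (u * (x mod p)) = unity p (u * x)"
  using odd_prime_gt_2 by (intro unity_cong) (auto simp: cong_def mod_simps)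

text \<open>Terms are grouped by the value of the square. The constant 1 in the number of square
  roots contributes a full character sum, which vanishes.\<close>

lemma gauss1_Legendre:
  assumes "\<not> p dvd u"
  shows "gauss1 p u = (\<Sum>z\<in>{0..<p}. of_int (Legendre z p) * unity p (u * z))"
proof -
  have "gauss1 p u = (\<Sum>z\<in>{0..<p}. \<Sum>x\<in>{x \<in> {0..<p}. x\<^sup>2 mod p = z}. unity p (u * x\<^sup>2))"
    unfolding gauss1_def using odd_prime_gt_2 by (intro sum.group[symmetric]) auto
  also have "\<dots> = (\<Sum>z\<in>{0..<p}. of_int (1 + Legendre z p) * unity p (u * z))"
  proof (intro sum.cong refl)
    fix z assume z: "z \<in> {0..<p}"
    have "(\<Sum>x\<in>{x \<in> {0..<p}. x\<^sup>2 mod p = z}. unity p (u * x\<^sup>2)) =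
        (\<Sum>x\<in>{x \<in> {0..<p}. x\<^sup>2 mod p = z}. unity p (u * z))"
      using unity_mod by (intro sum.cong refl) (metis (mono_tags, lifting) mem_Collect_eq)
    also have "\<dots> = of_int (int (card {x \<in> {0..<p}. x\<^sup>2 mod p = z})) * unity p (u * z)"
      by simp
    finally show "(\<Sum>x\<in>{x \<in> {0..<p}. x\<^sup>2 mod p = z}. unity p (u * x\<^sup>2)) =
        of_int (1 + Legendre z p) * unity p (u * z)"
      by (simp only: card_sqrt_mod[OF z])
  qed
  also have "\<dots> = (\<Sum>z\<in>{0..<p}. unity p (z * u)) + (\<Sum>z\<in>{0..<p}. of_int (Legendre z p) * unity p (u * z))"
    by (simp add: distrib_left sum.distrib mult.commute)
  finally show ?thesis
    using assms odd_prime_gt_2 by (simp add: sum_unity)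
qed

text \<open>With the sum written over Legendre symbols, the substitution of \<open>a * z\<close> for
  \<open>z\<close> pulls out the symbol of \<open>a\<close>.\<close>

lemma gauss1_mult:
  assumes "\<not> p dvd u" "\<not> p dvd a"
  shows "gauss1 p (u * a) = of_int (Legendre a p) * gauss1 p u"
proof -
  have ua: "\<not> p dvd u * a" using assms p by (simp add: prime_dvd_mult_iff)
  have "gauss1 p u = (\<Sum>z\<in>{0..<p}. of_int (Legendre (a * z) p) * unity p (u * (a * z)))"
    unfolding gauss1_Legendre[OF assms(1)]
  proof (rule sum_residues_reindex[symmetric])
    fix x y assume "[a * x = a * y] (mod p)"
    then show "[x = y] (mod p)"
      using prime_imp_coprime[OF p(1) assms(2)] cong_mult_lcancel[of a p x y]
      by (simp add: coprime_commute)
  qed (use odd_prime_gt_2 in \<open>auto simp: Legendre_mod unity_mod\<close>)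
  also have "\<dots> = of_int (Legendre a p) * gauss1 p (u * a)"
    unfolding gauss1_Legendre[OF ua] by (simp add: sum_distrib_left Legendre_mult mult.assoc)
  finally show ?thesis
    using Legendre_square[OF assms(2)] Legendre_cases[OF assms(2)] by auto
qed

text \<open>Writing \<open>G\<close> for the sum, \<open>G(u) G(-u) = p\<close> and
  \<open>G(-u) = (-1/p) G(u)\<close>, so the square of \<open>G(u)\<close> is \<open>p\<close> up to
  sign. The fourth power removes the sign, and a dimension divisible by 4 calls for exactly such
  powers.\<close>

lemma gauss1_power4:
  assumes "\<not> p dvd u"
  shows "gauss1 p u ^ 4 = of_int p ^ 2"
proof -
  have shift: "(\<Sum>x\<in>{0..<p}. unity p (u * x\<^sup>2)) = (\<Sum>x\<in>{0..<p}. unity p (u * (x + y)\<^sup>2))" for y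
  proof (rule sum_residues_reindex[symmetric])
    show "unity p (u * (x mod p)\<^sup>2) = unity p (u * x\<^sup>2)" for x
      using unity_mod[of u "x\<^sup>2"] unity_mod[of u "(x mod p)\<^sup>2"] by (simp add: power_mod)
  qed (use odd_prime_gt_2 in \<open>auto simp: cong_add_rcancel\<close>)
  have "gauss1 p u * gauss1 p (u * - 1) = (\<Sum>y\<in>{0..<p}. gauss1 p u * unity p (- (u * y\<^sup>2)))"
    by (simp add: gauss1_def sum_distrib_left)
  \<comment> \<open>The shift of \<open>x\<close> by \<open>y\<close> makes the exponent
    \<open>(x + y)^2 - y^2 = x^2 + 2 x y\<close> linear in \<open>y\<close>, so that the sum over
    \<open>y\<close> selects \<open>x = 0\<close>.\<close>
  also have "\<dots> = (\<Sum>y\<in>{0..<p}. \<Sum>x\<in>{0..<p}. unity p (u * (x + y)\<^sup>2) * unity p (- (u * y\<^sup>2)))"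
    by (simp add: gauss1_def shift[symmetric] flip: sum_distrib_right)
  also have "\<dots> = (\<Sum>y\<in>{0..<p}. \<Sum>x\<in>{0..<p}. unity p (u * x\<^sup>2) * unity p (y * (2 * u * x)))"
    unfolding unity_add[symmetric] by (simp add: power2_eq_square algebra_simps)
  also have "\<dots> = (\<Sum>x\<in>{0..<p}. unity p (u * x\<^sup>2) * (\<Sum>y\<in>{0..<p}. unity p (y * (2 * u * x))))"
    by (subst sum.swap) (simp add: sum_distrib_left)
  also have "\<dots> = (\<Sum>x\<in>{0..<p}. if x = 0 then of_int p else 0)"
  proof (intro sum.cong refl)
    fix x assume "x \<in> {0..<p}"
    moreover have "\<not> p dvd 2" using odd_prime_gt_2 by (auto dest: zdvd_imp_le)
    ultimately have "p dvd 2 * u * x \<longleftrightarrow> x = 0"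
      using assms p by (auto simp: prime_dvd_mult_iff dest: zdvd_imp_le)
    then show "unity p (u * x\<^sup>2) * (\<Sum>y\<in>{0..<p}. unity p (y * (2 * u * x))) = (if x = 0 then of_int p else 0)"
      using odd_prime_gt_2 by (simp add: sum_unity)
  qed
  also have "\<dots> = of_int p" using odd_prime_gt_2 by simp
  finally have "gauss1 p u * gauss1 p (u * - 1) = of_int p" .
  moreover have m1: "\<not> p dvd - 1" using odd_prime_gt_2 by (auto dest: zdvd_imp_le)
  ultimately have "of_int (Legendre (- 1) p) * (gauss1 p u * gauss1 p u) = of_int p"
    unfolding gauss1_mult[OF assms m1] by (simp only: mult_ac)
  then have "(of_int (Legendre (- 1) p) * (gauss1 p u * gauss1 p u))\<^sup>2 = (of_int p)\<^sup>2" by simp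
  moreover have "(of_int (Legendre (- 1) p) :: complex)\<^sup>2 = 1"
    using Legendre_cases[OF m1] by auto
  moreover have "(gauss1 p u * gauss1 p u)\<^sup>2 = gauss1 p u ^ 4"
    by (simp add: power2_eq_square power4_eq_xxxx mult.assoc)
  ultimately show ?thesis
    by (simp add: power_mult_distrib)
qed

end

section \<open>Elementary congruences, and elimination at an odd prime\<close>

lemma row_addition:
  assumes "even_symmetric_mat A" "A \<in> carrier_mat d d" "k < d" "l < d" "k \<noteq> l" "N > 0"
  obtains A' where "A' \<in> carrier_mat d d" "even_symmetric_mat A'" "det A' = det A"
    "\<And>u. gauss_sum A' u N = gauss_sum A u N"
    "\<And>i j. i < d \<Longrightarrow> j < d \<Longrightarrow> A' $$ (i, j) = A $$ (i, j) + (if i = k then a * A $$ (l, j) else 0) +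
       (if j = k then a * (A $$ (i, l) + (if i = k then a * A $$ (l, l) else 0)) else 0)"
proof -
  let ?P = "addrow_mat d a k l"
  define X where "X = ?P * A"
  have P: "?P \<in> carrier_mat d d" by simp
  have X: "X \<in> carrier_mat d d" "X = addrow a k l A"
    using assms P addrow_mat[OF assms(2,4)] by (auto simp: X_def)
  \<comment> \<open>A column operation is the row operation on the transpose. The entry
    \<open>(k, k)\<close> receives both operations, which accounts for the nested conditional in the
    formula.\<close>
  have "transpose_mat (?P * transpose_mat X) = X * transpose_mat ?P"
    using X transpose_mult[OF P, of "transpose_mat X" d] by simp
  then have Y: "X * transpose_mat ?P = transpose_mat (addrow a k l (transpose_mat X))"
    using X addrow_mat[of "transpose_mat X" d d l a k] assms by simp
  show thesis
  proof (rule that[of "?P * A * transpose_mat ?P"])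
    show "?P * A * transpose_mat ?P \<in> carrier_mat d d"
      unfolding X_def[symmetric] using X(1) by (simp add: mult_carrier_mat[of _ d d])
    show "even_symmetric_mat (?P * A * transpose_mat ?P)"
      by (rule even_symmetric_congruence[OF assms(1,2) P])
    show "gauss_sum (?P * A * transpose_mat ?P) u N = gauss_sum A u N" for u
      using assms by (intro gauss_sum_congruence[where d = d]) (auto simp: det_addrow_mat)
    have "det (X * transpose_mat ?P) = det X * det (transpose_mat ?P)"
      using X by (intro det_mult[where n = d]) auto
    also have "\<dots> = det A"
      unfolding X_def using assms P by (simp add: det_mult[OF P assms(2)] det_transpose[OF P] det_addrow_mat)
    finally show "det (?P * A * transpose_mat ?P) = det A"
      by (simp only: X_def)
    fix i j assume "i < d" "j < d"
    then show "(?P * A * transpose_mat ?P) $$ (i, j) = A $$ (i, j) + (if i = k then a * A $$ (l, j) else 0) +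
       (if j = k then a * (A $$ (i, l) + (if i = k then a * A $$ (l, l) else 0)) else 0)"
      unfolding X_def[symmetric] Y unfolding X(2) using assms by auto
  qed
qed

lemma first_row_nonzero:
  fixes A :: "int mat"
  assumes "A \<in> carrier_mat d d" "d > 0" "\<not> N dvd det A"
  obtains j where "j < d" "\<not> N dvd A $$ (0, j)"
proof -
  have "det A = (\<Sum>j<d. A $$ (0, j) * cofactor A 0 j)"
    using assms by (intro laplace_expansion_row)
  then have "\<not> (\<forall>j<d. N dvd A $$ (0, j))"
    using assms(3) by (auto intro!: dvd_sum)
  with that show thesis by blast
qed

lemma gauss_sum_dim0:
  assumes "A \<in> carrier_mat 0 0"
  shows "gauss_sum A u N = 1"
  using assms by (simp add: gauss_sum_def quad_def bil_def scalar_prod_def half_mat_def)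

lemma gauss_sum_dim1:
  assumes "A \<in> carrier_mat 1 1" "even_symmetric_mat A"
  shows "gauss_sum A u p = gauss1 p (u * (A $$ (0, 0) div 2))"
proof -
  have A: "A \<in> carrier_mat (Suc 0) (Suc 0)" using assms by simp
  have "quad A (vec (Suc 0) (\<lambda>_. x)) = A $$ (0, 0) div 2 * x\<^sup>2" for x :: int
    using A by (simp add: quad_def bil_def scalar_prod_def half_mat_def power2_eq_square)
  then have "(\<Sum>y\<in>cube (Suc 0) p. unity p (u * quad A y)) =
      (\<Sum>x\<in>{0..<p}. unity p (u * (A $$ (0, 0) div 2 * x\<^sup>2)))"
    by (subst sum.reindex_bij_betw[OF bij_cube_Suc_0, symmetric]) simp
  then show ?thesis
    using A by (simp add: gauss_sum_def gauss1_def mult.assoc)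
qed

text \<open>Over an odd prime, some entry on the diagonal becomes a unit after adding \<open>\<plusminus>\<close> one row to the
  first, because \<open>q(x + y) - q(x - y) = 2 b(x, y)\<close>.\<close>

lemma unit_pivot:
  fixes p :: int
  assumes p: "prime p" "odd p"
    and A: "even_symmetric_mat A" "A \<in> carrier_mat d d" "d > 0" "\<not> p dvd det A"
  obtains A' where "A' \<in> carrier_mat d d" "even_symmetric_mat A'" "det A' = det A"
    "\<And>u. gauss_sum A' u p = gauss_sum A u p" "\<not> p dvd A' $$ (0, 0)"
proof (cases "p dvd A $$ (0, 0)")
  case False
  then show thesis using that[of A] A by blast
next
  case True
  have "p > 0" using p(1) by (rule prime_gt_0_int)
  obtain j where j: "j < d" "\<not> p dvd A $$ (0, j)"
    using A by (auto elim: first_row_nonzero)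
  then have "j \<noteq> 0" using True by metis
  have sym: "A $$ (j, 0) = A $$ (0, j)"
    using even_symmetric_mat_index[OF A(1,2)] j A(3) by blast
  \<comment> \<open>The corner entry after \<open>a\<close> times row \<open>j\<close> has been
    added to row 0, with the matching column operation. It is twice a value of the form, so the
    difference between the choices \<open>a = 1\<close> and \<open>a = -1\<close> carries the factor
    4 instead of 2.\<close>
  define c where "c a = A $$ (0, 0) + a * A $$ (j, 0) + a * (A $$ (0, j) + a * A $$ (j, j))" for a
  have "\<not> p dvd 4"
  proof
    assume "p dvd 4"
    then have "p dvd 2 ^ 2" by simp
    then have "p dvd 2" using p(1) prime_dvd_power by blast
    then have "p \<le> 2" by (rule zdvd_imp_le) simp
    then show False using p prime_ge_2_int[of p] by auto
  qed
  moreover have "c 1 - c (- 1) = 4 * A $$ (0, j)"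
    by (simp add: c_def sym)
  ultimately have "\<not> p dvd c 1 - c (- 1)"
    using j p(1) by (simp add: prime_dvd_mult_iff)
  then obtain a where a: "\<not> p dvd c a"
    by (meson dvd_diff)
  obtain A' where "A' \<in> carrier_mat d d" "even_symmetric_mat A'" "det A' = det A"
    "\<And>u. gauss_sum A' u p = gauss_sum A u p"
    "\<And>i k. i < d \<Longrightarrow> k < d \<Longrightarrow> A' $$ (i, k) = A $$ (i, k) + (if i = 0 then a * A $$ (j, k) else 0) +
       (if k = 0 then a * (A $$ (i, j) + (if i = 0 then a * A $$ (j, j) else 0)) else 0)"
    by (rule row_addition[OF A(1,2) A(3) j(1) _ \<open>p > 0\<close>, of a]) (use \<open>j \<noteq> 0\<close> in auto)
  moreover from this(5)[of 0 0] have "A' $$ (0, 0) = c a"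
    using A(3) by (simp add: c_def)
  ultimately show thesis using that a by metis
qed

text \<open>Each unit pivot \<open>\<delta>\<close> splits off the one-variable form
  \<open>(\<delta>/2) x^2\<close>, whose sum is the Legendre symbol of \<open>\<delta>/2\<close>
  times \<open>gauss1 p u\<close>. This is the source of one factor \<open>Legendre 2 p\<close> per
  dimension; the symbols of the pivots multiply up to that of the determinant.\<close>

lemma gauss_sum_odd:
  fixes p :: int
  assumes p: "prime p" "odd p" and u: "\<not> p dvd u"
  shows "even_symmetric_mat A \<Longrightarrow> A \<in> carrier_mat d d \<Longrightarrow> \<not> p dvd det A \<Longrightarrow>
    gauss_sum A u p = of_int (Legendre (det A) p) * (of_int (Legendre 2 p) * gauss1 p u) ^ d"
proof (induction d arbitrary: A)
  case 0
  then show ?case by (simp add: gauss_sum_dim0 Legendre_1[OF p])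
next
  case (Suc c)
  note Leg_mult = Legendre_mult[OF p] and Leg_sq = Legendre_square[OF p]
  obtain B where B: "B \<in> carrier_mat (Suc c) (Suc c)" "even_symmetric_mat B" "det B = det A"
    "\<And>u. gauss_sum B u p = gauss_sum A u p" "\<not> p dvd B $$ (0, 0)"
    using unit_pivot[OF p Suc.prems(1,2) _ Suc.prems(3)] by blast
  define \<delta> where "\<delta> = B $$ (0, 0)"
  define M where "M = mat 1 1 (\<lambda>(i, j). B $$ (i, j))"
  have M: "M \<in> carrier_mat 1 1" "M $$ (0, 0) = \<delta>" "det M = \<delta>"
    by (auto simp: M_def \<delta>_def det_single)
  have ev\<delta>: "even \<delta>"
    using B unfolding \<delta>_def by (auto simp: even_symmetric_mat_iff)
  then have ev: "even_symmetric_mat M"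
    using M by (auto simp: even_symmetric_mat_iff)
  have p\<delta>: "\<not> p dvd \<delta>" using B by (simp add: \<delta>_def)
  then have "coprime \<delta> p"
    using prime_imp_coprime[OF p(1)] by (simp add: coprime_commute)
  have MI: "M = \<delta> \<cdot>\<^sub>m 1\<^sub>m 1"
    using M by (intro eq_matI) auto
  obtain C where C: "C \<in> carrier_mat c c" "even_symmetric_mat C" "\<delta> ^ (2 * c) * det B = det M * det C"
    "\<And>u. gauss_sum B u p = gauss_sum M u p * gauss_sum C u p"
    by (rule gauss_sum_schur[of B 1 c M "1\<^sub>m 1" \<delta> p])
      (use B MI \<open>coprime \<delta> p\<close> prime_gt_0_int[OF p(1)] in \<open>simp_all add: M_def\<close>)
  have nd: "\<not> p dvd \<delta> ^ (2 * c) * det B"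
    using p p\<delta> B Suc.prems by (simp add: prime_dvd_mult_iff prime_dvd_power_iff) (metis prime_dvd_power)
  then have "\<not> p dvd det C"
    unfolding C(3) by auto
  then have IH: "gauss_sum C u p = of_int (Legendre (det C) p) * (of_int (Legendre 2 p) * gauss1 p u) ^ c"
    using Suc.IH C by blast
  \<comment> \<open>The even power of \<open>\<delta>\<close> that comes from clearing denominators
    is a square and drops out of the Legendre symbol.\<close>
  have "Legendre (\<delta> ^ (2 * n)) p = 1" for n
  proof (induction n)
    case (Suc n)
    have "Legendre (\<delta> ^ (2 * Suc n)) p = (Legendre \<delta> p * Legendre \<delta> p) * Legendre (\<delta> ^ (2 * n)) p"
      by (simp add: Leg_mult mult.assoc)
    then show ?case using Suc by (simp add: Leg_sq[OF p\<delta>])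
  qed (simp add: Legendre_1[OF p])
  then have det: "Legendre (det A) p = Legendre \<delta> p * Legendre (det C) p"
    using arg_cong[OF C(3), of "\<lambda>x. Legendre x p"] by (simp add: Leg_mult B(3) M(3))
  have \<delta>: "\<delta> = 2 * (\<delta> div 2)" using ev\<delta> by simp
  then have "\<not> p dvd \<delta> div 2" "\<not> p dvd 2"
    using p\<delta> by (metis dvd_mult) (metis dvd_mult2 \<delta> p\<delta>)
  have "Legendre \<delta> p = Legendre 2 p * Legendre (\<delta> div 2) p"
    using \<delta> Leg_mult by metis
  then have half: "Legendre (\<delta> div 2) p = Legendre \<delta> p * Legendre 2 p"
    using Leg_sq[OF \<open>\<not> p dvd 2\<close>] by (simp add: mult_ac)
  have "gauss_sum M u p = of_int (Legendre (\<delta> div 2) p) * gauss1 p u"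
    using gauss_sum_dim1[OF M(1) ev] gauss1_mult[OF p u \<open>\<not> p dvd \<delta> div 2\<close>] by (simp add: M(2))
  then show ?case
    unfolding B(4)[symmetric] C(4) IH det half by (simp add: mult_ac)
qed

section \<open>The prime 2, and the evaluation for determinant 1\<close>

lemma gauss_sum_cong:
  assumes "[u = v] (mod N)" "N > 0"
  shows "gauss_sum A u N = gauss_sum A v N"
  unfolding gauss_sum_def
  by (intro sum.cong refl unity_cong assms cong_scalar_right)

text \<open>With odd mixed coefficient \<open>e\<close>, the form
  \<open>a x^2 + e x y + c y^2\<close> modulo 2 takes the value 1 at one or at three of the four
  points, according to its Arf invariant, the parity of \<open>a c\<close>. The absolute value
  provides a natural number as exponent.\<close>

lemma gauss_sum_dim2:
  assumes "A \<in> carrier_mat 2 2" "even_symmetric_mat A" "odd (A $$ (0, 1))"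
  shows "gauss_sum A 1 2 = 2 * (-1) ^ nat \<bar>A $$ (0, 0) div 2 * (A $$ (1, 1) div 2)\<bar>"
proof -
  have unity2: "unity 2 a = (if even a then 1 else -1)" for a
  proof (cases "even a")
    case True
    then show ?thesis by (simp add: unity_eq_1_iff)
  next
    case False
    then have "unity 2 a = unity 2 1"
      by (intro unity_cong) (auto simp: cong_def odd_iff_mod_2_eq_one)
    also have "\<dots> = - 1"
      by (simp add: unity_def)
    finally show ?thesis using False by simp
  qed
  have quad: "quad A (vec (Suc 0) (\<lambda>_. x) @\<^sub>v vec (Suc 0) (\<lambda>_. y)) =
      A $$ (0, 0) div 2 * x\<^sup>2 + A $$ (0, 1) * x * y + A $$ (1, 1) div 2 * y\<^sup>2" for x y :: int
    using assms(1)
    by (simp add: quad_def bil_def scalar_prod_def half_mat_def power2_eq_square numeral_2_eq_2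
        lessThan_Suc algebra_simps)
  have "gauss_sum A 1 2 = (\<Sum>y\<in>cube (Suc 0 + Suc 0) 2. unity 2 (quad A y))"
    using assms(1) by (simp add: gauss_sum_def numeral_2_eq_2)
  also have "\<dots> = (\<Sum>x\<in>{0..<2}. \<Sum>y\<in>{0..<2}.
      unity 2 (quad A (vec (Suc 0) (\<lambda>_. x) @\<^sub>v vec (Suc 0) (\<lambda>_. y))))"
    unfolding sum_cube_append by (simp only: sum.reindex_bij_betw[OF bij_cube_Suc_0, symmetric])
  also have "{0..<2} = {0, 1 :: int}" by auto
  finally show ?thesis
    unfolding quad using assms(3) by (auto simp: unity2 even_nat_iff)
qed

text \<open>The parity of \<open>s\<close> is the Arf invariant, and the congruence reads it off the
  determinant. It is multiplicative over binary blocks: a block of determinant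
  \<open>\<delta>\<close> satisfies \<open>-\<delta> = 1 + 4 t\<close> modulo 8, and
  \<open>(1 + 4 t) (1 + 4 s) = 1 + 4 (t + s)\<close> modulo 8. That the dimension is even comes out
  of the same induction.\<close>

lemma gauss_sum_2:
  "even_symmetric_mat A \<Longrightarrow> A \<in> carrier_mat d d \<Longrightarrow> odd (det A) \<Longrightarrow>
    \<exists>e s. d = 2 * e \<and> gauss_sum A 1 2 = (-1) ^ s * 2 ^ e \<and> [(-1) ^ e * det A = 1 + 4 * int s] (mod 8)"
proof (induction d arbitrary: A rule: less_induct)
  case (less d)
  show ?case
  proof (cases "d = 0")
    case True
    then show ?thesis using less.prems by (intro exI[of _ 0]) (simp add: gauss_sum_dim0)
  next
    case False
    then obtain j where j: "j < d" "odd (A $$ (0, j))"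
      using less.prems by (auto elim: first_row_nonzero[of A d 2])
    have "even (A $$ (0, 0))"
      using less.prems False by (auto simp: even_symmetric_mat_iff)
    then have "j \<noteq> 0" using j by metis
    then have "2 \<le> d" using j(1) by linarith
    then obtain c where d: "d = 2 + c" by (auto simp: le_iff_add)
    \<comment> \<open>All diagonal entries are even, so no single one of them can serve as a unit
      pivot. An odd entry at \<open>(0, 1)\<close> makes the leading 2 by 2 block invertible modulo
      2; if necessary, row \<open>j\<close> is added to row 1 to produce one.\<close>
    obtain B where B: "B \<in> carrier_mat d d" "even_symmetric_mat B" "det B = det A"
      "gauss_sum B 1 2 = gauss_sum A 1 2" "odd (B $$ (0, 1))"
    proof (cases "odd (A $$ (0, 1))")
      case True
      then show thesis using that[of A] less.prems by blast
    next
      case False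
      then have "j \<noteq> 1" using j by metis
      obtain A' where "A' \<in> carrier_mat d d" "even_symmetric_mat A'" "det A' = det A"
        "\<And>u. gauss_sum A' u 2 = gauss_sum A u 2"
        "\<And>i k. i < d \<Longrightarrow> k < d \<Longrightarrow> A' $$ (i, k) = A $$ (i, k) + (if i = 1 then 1 * A $$ (j, k) else 0) +
           (if k = 1 then 1 * (A $$ (i, j) + (if i = 1 then 1 * A $$ (j, j) else 0)) else 0)"
        by (rule row_addition[OF less.prems(1,2) _ j(1), of 1 2 1]) (use \<open>j \<noteq> 1\<close> d in auto)
      moreover from this(5)[of 0 1] have "odd (A' $$ (0, 1))"
        using False j d by simp
      ultimately show thesis using that by metis
    qed
    define x e f where "x = B $$ (0, 0)" and "e = B $$ (0, 1)" and "f = B $$ (1, 1)"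
    define \<delta> where "\<delta> = x * f - e * e"
    define M where "M = mat 2 2 (\<lambda>(i, j). B $$ (i, j))"
    \<comment> \<open>The adjugate of the leading block, so that the product of the two is
      \<open>\<delta>\<close> times the identity.\<close>
    define E where "E = mat 2 2 (\<lambda>(i, j). if i = j then (if i = 0 then f else x) else - e)"
    have B10: "B $$ (1, 0) = e"
      using even_symmetric_mat_index[OF B(2,1), of 1 0] d by (simp add: e_def)
    have xf: "even x" "even f" "odd e"
      using B d by (auto simp: x_def e_def f_def even_symmetric_mat_iff)
    then have "odd \<delta>" by (simp add: \<delta>_def)
    have M: "M \<in> carrier_mat 2 2" by (simp add: M_def)
    have M_ev: "even_symmetric_mat M"
      unfolding even_symmetric_mat_iff[OF M]
      using B d even_symmetric_mat_index[OF B(2,1)] by (auto simp: M_def even_symmetric_mat_iff[OF B(1)])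
    have E: "E \<in> carrier_mat 2 2" "transpose_mat E = E" "M * E = \<delta> \<cdot>\<^sub>m 1\<^sub>m 2" "E * M = \<delta> \<cdot>\<^sub>m 1\<^sub>m 2"
      using B10 by (auto simp: E_def M_def \<delta>_def x_def e_def f_def scalar_prod_def less_Suc_eq
          numeral_2_eq_2 intro!: eq_matI)
    have "det M = \<delta>"
    proof -
      have "det M = (\<Sum>j<2. M $$ (0, j) * cofactor M 0 j)"
        using M by (intro laplace_expansion_row) auto
      moreover have "mat_delete M 0 0 \<in> carrier_mat 1 1" "mat_delete M 0 1 \<in> carrier_mat 1 1"
        using M by auto
      ultimately show ?thesis
        using B10 by (simp add: numeral_2_eq_2 cofactor_def det_single M_def mat_delete_def \<delta>_def x_def e_def f_def)
    qed
    obtain C where C: "C \<in> carrier_mat c c" "even_symmetric_mat C" "\<delta> ^ (2 * c) * det B = det M * det C"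
      "\<And>u. gauss_sum B u 2 = gauss_sum M u 2 * gauss_sum C u 2"
      by (rule gauss_sum_schur[of B 2 c M E \<delta> 2]) (use B E \<open>odd \<delta>\<close> d in \<open>simp_all add: M_def\<close>)
    have "odd (\<delta> ^ (2 * c) * det B)"
      using B less.prems \<open>odd \<delta>\<close> by simp
    then have "odd (det C)" unfolding C(3) by simp
    then obtain e' s where IH: "c = 2 * e'" "gauss_sum C 1 2 = (-1) ^ s * 2 ^ e'"
      "[(-1) ^ e' * det C = 1 + 4 * int s] (mod 8)"
      using less.IH[of c C] C d by auto
    define t where "t = nat \<bar>x div 2 * (f div 2)\<bar>"
    have gM: "gauss_sum M 1 2 = 2 * (-1) ^ t"
      using gauss_sum_dim2[OF M M_ev] xf by (simp add: M_def x_def e_def f_def t_def)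
    have odd_sq: "[a * a = 1] (mod 8)" if "odd a" for a :: int
    proof -
      obtain b where "a = 2 * b + 1" by (rule oddE[OF \<open>odd a\<close>])
      moreover have "even (b * (b + 1))" by simp
      then obtain k where "b * (b + 1) = 2 * k" by (elim evenE)
      ultimately have "a * a - 1 = 8 * k" by (simp add: algebra_simps)
      then show ?thesis by (simp add: cong_iff_dvd_diff)
    qed
    \<comment> \<open>Here \<open>\<delta> = x f - e^2\<close> with \<open>x\<close>,
      \<open>f\<close> even and \<open>e^2 = 1\<close> modulo 8, hence \<open>-\<delta>\<close> is
      congruent to \<open>1 - 4 (x/2) (f/2)\<close>; modulo 8 the multiple of 4 may change its
      sign.\<close>
    have \<delta>8: "[- \<delta> = 1 + 4 * int t] (mod 8)"
    proof -
      have "even (int t + x div 2 * (f div 2))"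
        by (auto simp: t_def even_nat_iff)
      then obtain k where k: "int t + x div 2 * (f div 2) = 2 * k" by (elim evenE)
      have "x * f = 4 * (x div 2 * (f div 2))"
        using xf by (auto elim!: evenE)
      then have "- \<delta> - (1 + 4 * int t) = (e * e - 1) - 8 * k"
        using k by (simp add: \<delta>_def)
      moreover have "8 dvd (e * e - 1) - 8 * k"
        using odd_sq[OF xf(3)] by (simp add: cong_iff_dvd_diff)
      ultimately show ?thesis
        by (simp only: cong_iff_dvd_diff)
    qed
    have "[\<delta> ^ (2 * c) * det B = 1 ^ c * det B] (mod 8)"
      unfolding power_mult by (intro cong_mult cong_pow cong_refl) (simp add: power2_eq_square odd_sq \<open>odd \<delta>\<close>)
    then have "[det A = \<delta> * det C] (mod 8)"
      using C(3) B(3) \<open>det M = \<delta>\<close> by (simp add: cong_sym_eq)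
    then have "[(-1) ^ Suc e' * det A = (-1) ^ Suc e' * (\<delta> * det C)] (mod 8)"
      by (rule cong_scalar_left)
    also have "(-1) ^ Suc e' * (\<delta> * det C) = - \<delta> * ((-1) ^ e' * det C)"
      by simp
    also have "[\<dots> = (1 + 4 * int t) * (1 + 4 * int s)] (mod 8)"
      by (intro cong_mult \<delta>8 IH)
    also have "(1 + 4 * int t) * (1 + 4 * int s) = 1 + 4 * int (t + s) + 8 * (2 * int t * int s)"
      by (simp add: algebra_simps)
    also have "[\<dots> = 1 + 4 * int (t + s)] (mod 8)"
      by (simp add: cong_iff_dvd_diff)
    finally have "[(-1) ^ Suc e' * det A = 1 + 4 * int (t + s)] (mod 8)" .
    moreover have "gauss_sum A 1 2 = (-1) ^ (t + s) * 2 ^ Suc e'"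
      unfolding B(4)[symmetric] C(4) gM IH(2) by (simp add: power_add)
    moreover have "d = 2 * Suc e'" using d IH by simp
    ultimately show ?thesis by blast
  qed
qed

text \<open>At \<open>p = 2\<close> the determinant 1 and the even \<open>m\<close> force
  \<open>4 s\<close> to vanish modulo 8, so the Arf invariant is 0, and an odd \<open>u\<close> may
  be replaced by 1. At an odd prime the dimension \<open>2 * m\<close> is a multiple of 4, and the
  fourth powers of the Legendre symbol and of the Gauss sum are known.\<close>

lemma gauss_sum_unimodular:
  fixes p :: int
  assumes "prime p" "\<not> p dvd u" "even_symmetric_mat A" "A \<in> carrier_mat (2 * m) (2 * m)" "even m" "det A = 1"
  shows "gauss_sum A u p = of_int p ^ m"
proof (cases "p = 2")
  case True
  obtain e s where es: "2 * m = 2 * e" "gauss_sum A 1 2 = (-1) ^ s * 2 ^ e" "[(-1) ^ e * det A = 1 + 4 * int s] (mod 8)"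
    using gauss_sum_2[OF assms(3,4)] assms(6) by auto
  then have "8 dvd 4 * int s"
    using assms(5,6) by (simp add: cong_iff_dvd_diff)
  then have "even s" by presburger
  moreover have "[u = 1] (mod 2)"
    using assms True by (simp add: cong_def odd_iff_mod_2_eq_one)
  ultimately show ?thesis
    using es gauss_sum_cong[of u 1 2 A] True by simp
next
  case False
  then have "odd p" using assms(1) by (metis prime_odd_int order_le_less prime_ge_2_int)
  note p = assms(1) this
  obtain k where k: "m = 2 * k" using \<open>even m\<close> by auto
  have "\<not> p dvd 2"
    using prime_ge_2_int[OF p(1)] False by (auto dest: zdvd_imp_le)
  then have "(of_int (Legendre 2 p) :: complex) ^ 4 = 1"
    using Legendre_cases[OF p, of 2] by auto
  have "gauss_sum A u p = (of_int (Legendre 2 p) * gauss1 p u) ^ (2 * m)"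
    using gauss_sum_odd[OF p assms(2,3,4)] not_prime_unit[of p] assms(1,6)
    by (auto simp: Legendre_1[OF p])
  also have "\<dots> = ((of_int (Legendre 2 p) * gauss1 p u) ^ 4) ^ k"
    by (simp add: k flip: power_mult)
  also have "\<dots> = of_int p ^ m"
    using \<open>(of_int (Legendre 2 p) :: complex) ^ 4 = 1\<close>
    by (simp add: power_mult_distrib gauss1_power4[OF p assms(2)] k flip: power_mult)
  finally show ?thesis .
qed

section \<open>Exponential sums over the zeros of a quadratic form\<close>

lemma sum_cube_multiples:
  fixes f :: "int vec \<Rightarrow> 'a::comm_monoid_add"
  assumes "N > 0" "M > 0"
  shows "(\<Sum>y\<in>cube d (N * M). if \<forall>i<d. N dvd y $ i then f y else 0) = (\<Sum>w\<in>cube d M. f (N \<cdot>\<^sub>v w))"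
proof -
  have "(\<Sum>z\<in>cube d M. if \<forall>i<d. N dvd (y + N \<cdot>\<^sub>v z) $ i then f (y + N \<cdot>\<^sub>v z) else 0) =
      (if y = 0\<^sub>v d then \<Sum>w\<in>cube d M. f (N \<cdot>\<^sub>v w) else 0)" if y: "y \<in> cube d N" for y
  proof -
    have "(\<forall>i<d. N dvd (y + N \<cdot>\<^sub>v z) $ i) \<longleftrightarrow> y = 0\<^sub>v d" if "z \<in> cube d M" for z
    proof -
      have "(\<forall>i<d. N dvd (y + N \<cdot>\<^sub>v z) $ i) \<longleftrightarrow> (\<forall>i<d. N dvd y $ i)"
        using y that by (auto simp: cube_def dvd_add_left_iff)
      also have "\<dots> \<longleftrightarrow> (\<forall>i<d. y $ i = 0)"
        using y by (force simp: cube_def dest: zdvd_imp_le)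
      also have "\<dots> \<longleftrightarrow> y = 0\<^sub>v d"
        using y by (auto simp: cube_def)
      finally show ?thesis .
    qed
    then show ?thesis
      by (auto intro!: sum.cong dest!: cube_carrier)
  qed
  moreover have "0\<^sub>v d \<in> cube d N"
    using assms by (simp add: cube_def)
  ultimately show ?thesis
    unfolding sum_cube_mult[OF assms] by simp
qed

text \<open>Orthogonality for the linear form with coefficient vector \<open>A *\<^sub>v h\<close>.
  Because \<open>det A\<close> is prime to \<open>N\<close>, this vector is divisible by
  \<open>N\<close> just when \<open>h\<close> is.\<close>

lemma sum_cube_bil:
  assumes "even_symmetric_mat A" "A \<in> carrier_mat d d" "coprime (det A) N" "h \<in> carrier_vec d" "N > 0"
  shows "(\<Sum>z\<in>cube d N. unity N (bil A h z)) = (if \<forall>i<d. N dvd h $ i then of_int N ^ d else 0)"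
proof -
  have v: "A *\<^sub>v h \<in> carrier_vec d" using assms by simp
  have "bil A h z = (A *\<^sub>v h) \<bullet> z" if "z \<in> cube d N" for z
    using bil_sym[OF assms(1,2,4), of z] cube_carrier[OF that] comm_scalar_prod[OF v, of z]
    by (simp add: bil_int)
  then have "(\<Sum>z\<in>cube d N. unity N (bil A h z)) = (\<Sum>z\<in>cube d N. unity N ((A *\<^sub>v h) \<bullet> z))"
    by simp
  also have "\<dots> = (if \<forall>i<d. N dvd (A *\<^sub>v h) $ i then of_int N ^ d else 0)"
    by (rule sum_cube_linear[OF assms(5) v])
  also have "(\<forall>i<d. N dvd (A *\<^sub>v h) $ i) \<longleftrightarrow> (\<forall>i<d. N dvd h $ i)"
  proof
    show "\<forall>i<d. N dvd h $ i" if "\<forall>i<d. N dvd (A *\<^sub>v h) $ i"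
      by (rule mod_nonsingular[OF assms(2-4) that])
    show "\<forall>i<d. N dvd (A *\<^sub>v h) $ i" if "\<forall>i<d. N dvd h $ i"
      using that assms(2,4) by (auto simp: scalar_prod_def intro!: dvd_sum)
  qed
  finally show ?thesis .
qed

definition lin_gauss_sum :: "int mat \<Rightarrow> int \<Rightarrow> int vec \<Rightarrow> int \<Rightarrow> complex" where
  "lin_gauss_sum A c h N = (\<Sum>y\<in>cube (dim_row A) N. unity N (c * quad A y + bil A h y))"

text \<open>For \<open>N = p ^ r\<close> this is \<open>S(r, h)\<close>, the value of the
  \<open>r\<close>-th integral.\<close>

definition exp_sum :: "int mat \<Rightarrow> int vec \<Rightarrow> int \<Rightarrow> complex" where
  "exp_sum A h N = (\<Sum>y\<in>cube (dim_row A) N. of_bool (N dvd quad A y) * unity N (bil A h y))"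

lemma exp_sum_eq_lin_gauss_sum:
  assumes "N > 0"
  shows "of_int N * exp_sum A h N = (\<Sum>c\<in>{0..<N}. lin_gauss_sum A c h N)"
proof -
  have "(\<Sum>c\<in>{0..<N}. lin_gauss_sum A c h N) =
      (\<Sum>y\<in>cube (dim_row A) N. (\<Sum>c\<in>{0..<N}. unity N (c * quad A y)) * unity N (bil A h y))"
    unfolding lin_gauss_sum_def by (subst sum.swap) (simp add: unity_add sum_distrib_right)
  also have "\<dots> = of_int N * exp_sum A h N"
    unfolding exp_sum_def sum_distrib_left
    by (intro sum.cong refl) (simp add: sum_unity[OF assms])
  finally show ?thesis by simp
qed

text \<open>Completing the square by the shift \<open>w \<cdot>\<^sub>v h\<close>, where
  \<open>w\<close> inverts \<open>u\<close>. The cross term is \<open>u w (h, y)\<close> without a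
  factor 2, since \<open>bil\<close> is the polarization of \<open>quad\<close>, so the argument
  covers even \<open>N\<close> as well.\<close>

lemma lin_gauss_sum_unit:
  assumes "even_symmetric_mat A" "A \<in> carrier_mat d d" "h \<in> carrier_vec d" "N > 0" "[u * w = 1] (mod N)"
  shows "lin_gauss_sum A u h N = unity N (- w * quad A h) * gauss_sum A u N"
proof -
  obtain k where k: "u * w = 1 + N * k"
    using assms(5) by (metis cong_iff_lin cong_sym mult.commute)
  have "gauss_sum A u N = (\<Sum>y\<in>cube d N. unity N (u * quad A (y + w \<cdot>\<^sub>v h)))"
    using assms unfolding gauss_sum_def
    by (subst sum_cube_shift[OF assms(4) periodic_unity_quad'[OF assms(1,2,4)]]) auto
  also have "\<dots> = (\<Sum>y\<in>cube d N. unity N (w * quad A h) * unity N (u * quad A y + bil A h y))"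
  proof (intro sum.cong refl)
    fix y assume "y \<in> cube d N"
    then have y: "y \<in> carrier_vec d" by (rule cube_carrier)
    have "u * quad A (y + w \<cdot>\<^sub>v h) = u * quad A y + (u * w) * (w * quad A h) + (u * w) * bil A y h"
      using assms y by (simp add: quad_add[where d = d] quad_smult[where d = d] bil_smult[where d = d]
          power2_eq_square distrib_left mult_ac)
    also have "bil A y h = bil A h y"
      by (rule bil_sym[OF assms(1,2) y assms(3)])
    finally have "u * quad A (y + w \<cdot>\<^sub>v h) = w * quad A h + (u * quad A y + bil A h y) +
        N * (k * (w * quad A h) + k * bil A h y)"
      unfolding k by (simp add: algebra_simps)
    moreover have "unity N (N * (k * (w * quad A h) + k * bil A h y)) = 1"
      using assms(4) by (simp add: unity_eq_1_iff)
    ultimately show "unity N (u * quad A (y + w \<cdot>\<^sub>v h)) =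
        unity N (w * quad A h) * unity N (u * quad A y + bil A h y)"
      by (simp only: unity_add) simp
  qed
  also have "\<dots> = unity N (w * quad A h) * lin_gauss_sum A u h N"
    using assms(2) by (simp add: lin_gauss_sum_def sum_distrib_left)
  finally show ?thesis
    by (simp add: unity_add[symmetric] flip: mult.assoc)
qed

section \<open>Descent in the exponent of the modulus\<close>

context
  fixes p :: int and A :: "int mat" and m :: nat
  assumes p: "prime p"
    and A: "even_symmetric_mat A" "A \<in> carrier_mat (2 * m) (2 * m)" "coprime (det A) p"
    and gauss: "\<And>u. \<not> p dvd u \<Longrightarrow> gauss_sum A u p = of_int p ^ m"
begin

lemma prime_pos: "p > 0"
  using p by (rule prime_gt_0_int)

text \<open>At \<open>y + p^(t+1) z\<close> the exponent modulo \<open>p^(t+2)\<close> is linear in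
  the top digit \<open>z\<close>, so only \<open>y = p w\<close> survives. Then the form gains
  \<open>p^2\<close> and the modulus falls by two powers, which is why the induction has both
  \<open>t = 0\<close> and \<open>t = 1\<close> as base.\<close>

lemma gauss_sum_prime_power:
  assumes u: "\<not> p dvd u"
  shows "gauss_sum A u (p ^ t) = of_int p ^ (m * t)"
proof (induction t rule: induct_nat_012)
  case 0
  have "quad A (0\<^sub>v (2 * m) :: int vec) = 0"
    using scalar_prod_left_zero[OF mult_mat_vec_carrier[OF half_mat_carrier[OF A(2)] zero_carrier_vec]]
    by (simp add: quad_def bil_int)
  then show ?case using A by (simp add: gauss_sum_def cube_1)
next
  case 1
  then show ?case using gauss[OF u] by simp
next
  case (ge2 t)
  define d where "d = 2 * m"
  note Ad = A(1) A(2)[folded d_def]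
  let ?N = "p ^ Suc (Suc t)"
  have N: "?N = p ^ Suc t * p" "p ^ Suc t > 0" "p ^ t > 0"
    using prime_pos by simp_all
  have "gauss_sum A u ?N = (\<Sum>y\<in>cube d (p ^ Suc t). \<Sum>z\<in>cube d p.
      unity ?N (u * quad A (y + p ^ Suc t \<cdot>\<^sub>v z)))"
    unfolding gauss_sum_def N(1) using Ad prime_pos N by (subst sum_cube_mult) auto
  also have "\<dots> = (\<Sum>y\<in>cube d (p ^ Suc t). \<Sum>z\<in>cube d p.
      unity ?N (u * quad A y) * unity p (bil A (u \<cdot>\<^sub>v y) z))"
  proof (intro sum.cong refl)
    fix y z assume "y \<in> cube d (p ^ Suc t)" "z \<in> cube d p"
    then have yz: "y \<in> carrier_vec d" "z \<in> carrier_vec d" by (auto dest: cube_carrier)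
    have "u * quad A (y + p ^ Suc t \<cdot>\<^sub>v z) =
        u * quad A y + bil A (u \<cdot>\<^sub>v y) z * p ^ Suc t + ?N * (u * p ^ t * quad A z)"
      using Ad yz by (simp add: quad_add[where d = d] quad_smult[where d = d] bil_smult[where d = d]
          power2_eq_square algebra_simps)
    moreover have "unity ?N (bil A (u \<cdot>\<^sub>v y) z * p ^ Suc t) = unity p (bil A (u \<cdot>\<^sub>v y) z)"
      unfolding power_Suc[of p "Suc t"] by (rule unity_scale) (use prime_pos in simp)
    moreover have "unity ?N (?N * (u * p ^ t * quad A z)) = 1"
      using prime_pos by (subst unity_eq_1_iff) auto
    ultimately show "unity ?N (u * quad A (y + p ^ Suc t \<cdot>\<^sub>v z)) =
        unity ?N (u * quad A y) * unity p (bil A (u \<cdot>\<^sub>v y) z)"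
      by (simp only: unity_add) simp
  qed
  also have "\<dots> = (\<Sum>y\<in>cube d (p ^ Suc t).
      if \<forall>i<d. p dvd y $ i then of_int p ^ d * unity ?N (u * quad A y) else 0)"
  proof (intro sum.cong refl)
    fix y assume "y \<in> cube d (p ^ Suc t)"
    then have y: "y \<in> carrier_vec d" by (auto dest: cube_carrier)
    have "(\<Sum>z\<in>cube d p. unity p (bil A (u \<cdot>\<^sub>v y) z)) = (if \<forall>i<d. p dvd y $ i then of_int p ^ d else 0)"
      using y u p sum_cube_bil[OF Ad A(3) _ prime_pos, of "u \<cdot>\<^sub>v y"] by (simp add: prime_dvd_mult_iff)
    then show "(\<Sum>z\<in>cube d p. unity ?N (u * quad A y) * unity p (bil A (u \<cdot>\<^sub>v y) z)) =
        (if \<forall>i<d. p dvd y $ i then of_int p ^ d * unity ?N (u * quad A y) else 0)"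
      unfolding sum_distrib_left[symmetric]
      by (simp only: if_distrib[of "(*) (unity ?N (u * quad A y))"] mult_zero_right mult_zero_left mult.commute)
  qed
  also have "\<dots> = (\<Sum>w\<in>cube d (p ^ t). of_int p ^ d * unity ?N (u * quad A (p \<cdot>\<^sub>v w)))"
    unfolding power_Suc[of p t] sum_cube_multiples[OF prime_pos N(3)] by simp
  also have "\<dots> = (\<Sum>w\<in>cube d (p ^ t). of_int p ^ d * unity (p ^ t) (u * quad A w))"
  proof (intro sum.cong refl)
    fix w assume "w \<in> cube d (p ^ t)"
    then have w: "w \<in> carrier_vec d" by (auto dest: cube_carrier)
    have "unity ?N (u * quad A (p \<cdot>\<^sub>v w)) = unity (p ^ t * p\<^sup>2) (u * quad A w * p\<^sup>2)"
      using Ad w by (simp add: quad_smult[where d = d] power2_eq_square mult_ac)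
    then show "of_int p ^ d * unity ?N (u * quad A (p \<cdot>\<^sub>v w)) = of_int p ^ d * unity (p ^ t) (u * quad A w)"
      using prime_pos by (simp add: unity_scale)
  qed
  also have "\<dots> = of_int p ^ d * gauss_sum A u (p ^ t)"
    using Ad by (simp add: gauss_sum_def sum_distrib_left)
  finally show ?case
    unfolding ge2.IH by (simp add: d_def algebra_simps mult_2_right flip: power_add)
qed

text \<open>For a coefficient divisible by \<open>p\<close> the top digit \<open>z\<close> enters
  only through \<open>(h, z)\<close> modulo \<open>p\<close>, and its sum vanishes unless
  \<open>p\<close> divides \<open>h\<close>. In that case the whole exponent is divisible by
  \<open>p\<close>. The entries of \<open>h\<close> are divided with \<open>div\<close>, which is
  exact in the only branch where the quotient occurs.\<close>

lemma lin_gauss_sum_multiple: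
  assumes h: "h \<in> carrier_vec (2 * m)"
  shows "lin_gauss_sum A (p * c) h (p ^ Suc r) =
    (if \<forall>i<2 * m. p dvd h $ i
     then of_int p ^ (2 * m) * lin_gauss_sum A c (map_vec (\<lambda>a. a div p) h) (p ^ r) else 0)"
proof -
  define d where "d = 2 * m"
  note Ad = A(1) A(2)[folded d_def] and hd = h[folded d_def]
  let ?N = "p ^ Suc r" and ?h = "map_vec (\<lambda>a. a div p) h"
  have N: "?N = p ^ r * p" "p ^ r > 0" using prime_pos by simp_all
  have "lin_gauss_sum A (p * c) h ?N = (\<Sum>y\<in>cube d (p ^ r). \<Sum>z\<in>cube d p.
      unity ?N (p * c * quad A (y + p ^ r \<cdot>\<^sub>v z) + bil A h (y + p ^ r \<cdot>\<^sub>v z)))"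
    unfolding lin_gauss_sum_def N(1) using Ad prime_pos N by (subst sum_cube_mult) auto
  also have "\<dots> = (\<Sum>y\<in>cube d (p ^ r). \<Sum>z\<in>cube d p.
      unity ?N (p * c * quad A y + bil A h y) * unity p (bil A h z))"
  proof (intro sum.cong refl)
    fix y z assume "y \<in> cube d (p ^ r)" "z \<in> cube d p"
    then have yz: "y \<in> carrier_vec d" "z \<in> carrier_vec d" by (auto dest: cube_carrier)
    have "p * c * quad A (y + p ^ r \<cdot>\<^sub>v z) + bil A h (y + p ^ r \<cdot>\<^sub>v z) =
        (p * c * quad A y + bil A h y) + bil A h z * p ^ r + ?N * (c * p ^ r * quad A z + c * bil A y z)"
      using Ad hd yz by (simp add: quad_add[where d = d] quad_smult[where d = d] bil_smult[where d = d]
          bil_add[where d = d] power2_eq_square algebra_simps)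
    moreover have "unity ?N (bil A h z * p ^ r) = unity p (bil A h z)"
      unfolding power_Suc by (rule unity_scale) (use prime_pos in simp)
    moreover have "unity ?N (?N * (c * p ^ r * quad A z + c * bil A y z)) = 1"
      using prime_pos by (subst unity_eq_1_iff) auto
    ultimately show "unity ?N (p * c * quad A (y + p ^ r \<cdot>\<^sub>v z) + bil A h (y + p ^ r \<cdot>\<^sub>v z)) =
        unity ?N (p * c * quad A y + bil A h y) * unity p (bil A h z)"
      by (simp only: unity_add) simp
  qed
  also have "\<dots> = (\<Sum>y\<in>cube d (p ^ r). unity ?N (p * c * quad A y + bil A h y)) *
      (if \<forall>i<d. p dvd h $ i then of_int p ^ d else 0)"
    by (simp add: sum_cube_bil[OF Ad A(3) hd prime_pos] flip: sum_distrib_left sum_distrib_right)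
  also have "\<dots> = (if \<forall>i<d. p dvd h $ i then of_int p ^ d * lin_gauss_sum A c ?h (p ^ r) else 0)"
  proof (cases "\<forall>i<d. p dvd h $ i")
    case True
    then have h': "h = p \<cdot>\<^sub>v ?h"
      using hd by (intro eq_vecI) auto
    have "unity ?N (p * c * quad A y + bil A h y) = unity (p ^ r) (c * quad A y + bil A ?h y)"
      if "y \<in> cube d (p ^ r)" for y
    proof -
      have "bil A h y = p * bil A ?h y"
        using Ad hd cube_carrier[OF that] by (subst h') (simp add: bil_smult[where d = d])
      then have "unity ?N (p * c * quad A y + bil A h y) =
          unity (p ^ r * p) ((c * quad A y + bil A ?h y) * p)"
        by (simp add: algebra_simps)
      then show ?thesis using prime_pos by (simp only: unity_scale)
    qed
    then show ?thesis
      using True Ad by (simp add: lin_gauss_sum_def)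
  qed (simp only: if_False mult_zero_right)
  finally show ?thesis by (simp only: d_def)
qed

lemma sum_split_multiples:
  fixes f :: "int \<Rightarrow> 'a::comm_monoid_add"
  shows "(\<Sum>c\<in>{0..<p ^ Suc r}. f c) =
    (\<Sum>c\<in>{c\<in>{0..<p ^ Suc r}. \<not> p dvd c}. f c) + (\<Sum>c\<in>{0..<p ^ r}. f (p * c))"
proof -
  have "(\<Sum>c\<in>{0..<p ^ r}. f (p * c)) = (\<Sum>c\<in>{c\<in>{0..<p ^ Suc r}. p dvd c}. f c)"
    by (rule sum.reindex_bij_witness[of _ "\<lambda>c. c div p" "\<lambda>c. p * c"])
      (use prime_pos in \<open>auto simp: zero_le_mult_iff\<close>)
  moreover have "(\<Sum>c\<in>{0..<p ^ Suc r}. f c) =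
      (\<Sum>c\<in>{c\<in>{0..<p ^ Suc r}. \<not> p dvd c} \<union> {c\<in>{0..<p ^ Suc r}. p dvd c}. f c)"
    by (rule sum.cong) blast+
  moreover have "\<dots> = (\<Sum>c\<in>{c\<in>{0..<p ^ Suc r}. \<not> p dvd c}. f c) + (\<Sum>c\<in>{c\<in>{0..<p ^ Suc r}. p dvd c}. f c)"
    by (rule sum.union_disjoint) (blast intro: finite_subset[of _ "{0..<p ^ Suc r}"])+
  ultimately show ?thesis by (simp only:)
qed

text \<open>The map \<open>u \<mapsto> -1/u\<close> permutes the units modulo
  \<open>p^(r+1)\<close>. This turns the factors left by completing the square into a Ramanujan sum,
  for any choice \<open>w\<close> of the inverses.\<close>

lemma sum_units_inverse:
  fixes f :: "int \<Rightarrow> 'a::comm_monoid_add"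
  assumes f: "\<And>x. f (x mod p ^ Suc r) = f x"
    and w: "\<And>u. \<not> p dvd u \<Longrightarrow> [u * w u = 1] (mod p ^ Suc r)"
  shows "(\<Sum>u\<in>{c\<in>{0..<p ^ Suc r}. \<not> p dvd c}. f (- w u)) = (\<Sum>u\<in>{c\<in>{0..<p ^ Suc r}. \<not> p dvd c}. f u)"
proof -
  let ?N = "p ^ Suc r" and ?U = "{c\<in>{0..<p ^ Suc r}. \<not> p dvd c}"
  let ?g = "\<lambda>u. (- w u) mod ?N"
  have N: "?N > 0" using prime_pos by simp
  have "?g ` ?U \<subseteq> ?U"
  proof
    fix x assume "x \<in> ?g ` ?U"
    then obtain u where u: "\<not> p dvd u" "x = (- w u) mod ?N" by auto
    have "\<not> p dvd x"
    proof
      assume "p dvd x"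
      then have "p dvd - w u" unfolding u(2) by (subst (asm) dvd_mod_iff) simp_all
      then have "p dvd u * w u" by simp
      moreover have "?N dvd u * w u - 1"
        using w[OF u(1)] by (simp only: cong_iff_dvd_diff)
      then have "p dvd u * w u - 1"
        by (rule dvd_trans[rotated]) simp
      ultimately have "p dvd u * w u - (u * w u - 1)"
        by (rule dvd_diff)
      then have "p dvd 1" by simp
      then show False using p not_prime_unit by blast
    qed
    then show "x \<in> ?U" using u N by auto
  qed
  moreover have inj: "inj_on ?g ?U"
  proof (rule inj_onI)
    fix u v assume uv: "u \<in> ?U" "v \<in> ?U" "?g u = ?g v"
    then have "[- w u = - w v] (mod ?N)" by (simp add: cong_def)
    then have c: "[w u = w v] (mod ?N)" by (simp only: cong_minus_minus_iff)
    have "[u = u * (v * w v)] (mod ?N)"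
      using w[of v] uv cong_scalar_left[of "v * w v" 1 ?N u] by (simp add: cong_sym_eq)
    also have "u * (v * w v) = v * (u * w v)" by (simp add: mult_ac)
    also have "[v * (u * w v) = v * (u * w u)] (mod ?N)"
      by (intro cong_scalar_left cong_sym[OF c])
    also have "[v * (u * w u) = v] (mod ?N)"
      using w[of u] uv cong_scalar_left[of "u * w u" 1 ?N v] by simp
    finally show "u = v" using uv by (simp add: cong_def)
  qed
  moreover have "finite ?U" by (rule finite_subset[of _ "{0..<?N}"]) auto
  ultimately have "?g ` ?U = ?U"
    by (intro endo_inj_surj)
  then have "bij_betw ?g ?U ?U"
    using inj unfolding bij_betw_def by blast
  then have "(\<Sum>u\<in>?U. f (?g u)) = (\<Sum>u\<in>?U. f u)"
    by (rule sum.reindex_bij_betw)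
  then show ?thesis by (simp only: f)
qed

text \<open>The sum over all characters is \<open>p^(r+1)\<close> times the left side. Division by
  this number gives the two terms of the Ramanujan sum the weights \<open>1\<close> and
  \<open>1/p\<close>, and turns the factor \<open>p^(2m) p^r\<close> of the sum for
  \<open>h / p\<close> into \<open>p^(2m-1)\<close>.\<close>

lemma exp_sum_Suc:
  assumes h: "h \<in> carrier_vec (2 * m)"
  shows "exp_sum A h (p ^ Suc r) =
    of_int p ^ (m * Suc r) * (of_bool (p ^ Suc r dvd quad A h) - of_bool (p ^ r dvd quad A h) / of_int p) +
    (if \<forall>i<2 * m. p dvd h $ i
     then of_int p ^ (2 * m) / of_int p * exp_sum A (map_vec (\<lambda>a. a div p) h) (p ^ r) else 0)"
proof -
  let ?N = "p ^ Suc r" and ?h = "map_vec (\<lambda>a. a div p) h" and ?a = "quad A h"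
  let ?U = "{c\<in>{0..<p ^ Suc r}. \<not> p dvd c}"
  have N: "?N > 0" "p ^ r > 0" using prime_pos by simp_all
  have "\<exists>w. [u * w = 1] (mod ?N)" if "\<not> p dvd u" for u
    using that prime_imp_coprime[OF p that] by (intro cong_solve_coprime_int) (simp add: coprime_commute)
  then obtain w where w: "\<And>u. \<not> p dvd u \<Longrightarrow> [u * w u = 1] (mod ?N)"
    by metis
  have "(\<Sum>u\<in>?U. lin_gauss_sum A u h ?N) = (\<Sum>u\<in>?U. unity ?N (- w u * ?a) * of_int p ^ (m * Suc r))"
    by (intro sum.cong refl)
      (auto simp: lin_gauss_sum_unit[OF A(1,2) h N(1) w] gauss_sum_prime_power simp del: power_Suc)
  also have "\<dots> = of_int p ^ (m * Suc r) * (\<Sum>u\<in>?U. unity ?N (- w u * ?a))"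
    by (simp add: sum_distrib_left mult.commute)
  also have "(\<Sum>u\<in>?U. unity ?N (- w u * ?a)) = (\<Sum>u\<in>?U. unity ?N (u * ?a))"
  proof (rule sum_units_inverse[OF _ w])
    show "unity ?N (x mod ?N * ?a) = unity ?N (x * ?a)" for x
      by (rule unity_cong[OF N(1)]) (simp add: cong_def mod_simps)
  qed
  \<comment> \<open>A Ramanujan sum is the full character sum modulo \<open>p^(r+1)\<close> minus
    the part over the multiples of \<open>p\<close>, which is a full sum modulo
    \<open>p^r\<close>.\<close>
  also have "(\<Sum>u\<in>?U. unity ?N (u * ?a)) = of_int ?N * of_bool (?N dvd ?a) - of_int (p ^ r) * of_bool (p ^ r dvd ?a)"
  proof -
    have "(\<Sum>c\<in>{0..<p ^ r}. unity ?N (p * c * ?a)) = (\<Sum>c\<in>{0..<p ^ r}. unity (p ^ r) (c * ?a))"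
    proof (intro sum.cong refl)
      show "unity ?N (p * c * ?a) = unity (p ^ r) (c * ?a)" for c
        using unity_scale[of p "p ^ r" "c * ?a"] prime_pos by (simp add: mult_ac)
    qed
    moreover have "(\<Sum>u\<in>?U. unity ?N (u * ?a)) =
        (\<Sum>c\<in>{0..<?N}. unity ?N (c * ?a)) - (\<Sum>c\<in>{0..<p ^ r}. unity ?N (p * c * ?a))"
      unfolding sum_split_multiples[of "\<lambda>u. unity ?N (u * ?a)" r] by simp
    ultimately show ?thesis
      by (simp add: sum_unity[OF N(1)] sum_unity[OF N(2)] del: power_Suc)
  qed
  finally have units: "(\<Sum>u\<in>?U. lin_gauss_sum A u h ?N) =
      of_int p ^ (m * Suc r) * (of_int ?N * of_bool (?N dvd ?a) - of_int (p ^ r) * of_bool (p ^ r dvd ?a))" .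
  have rest: "(\<Sum>c\<in>{0..<p ^ r}. lin_gauss_sum A (p * c) h ?N) =
      (if \<forall>i<2 * m. p dvd h $ i then of_int p ^ (2 * m) * (of_int (p ^ r) * exp_sum A ?h (p ^ r)) else 0)"
    unfolding lin_gauss_sum_multiple[OF h] exp_sum_eq_lin_gauss_sum[OF N(2)]
    by (cases "\<forall>i<2 * m. p dvd h $ i", simp add: sum_distrib_left, simp only: if_False sum.neutral_const)
  define q where "q = complex_of_int p"
  define a b where "a = (of_bool (?N dvd ?a) :: complex)" and "b = (of_bool (p ^ r dvd ?a) :: complex)"
  define e where "e = (if \<forall>i<2 * m. p dvd h $ i then exp_sum A ?h (p ^ r) else 0)"
  have "q \<noteq> 0" using prime_pos by (simp add: q_def)
  have "of_int ?N * exp_sum A h ?N =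
      q ^ (m * Suc r) * (of_int ?N * a - of_int (p ^ r) * b) + q ^ (2 * m) * (of_int (p ^ r) * e)"
    unfolding exp_sum_eq_lin_gauss_sum[OF N(1)] sum_split_multiples units rest q_def a_def b_def e_def
    by (simp only: if_distrib[of "(*) x" for x] mult_zero_right)
  then have "q ^ r * (q * exp_sum A h ?N) = q ^ r * (q ^ (m * Suc r) * (q * a - b) + q ^ (2 * m) * e)"
    by (simp add: q_def algebra_simps)
  then have "q * exp_sum A h ?N = q ^ (m * Suc r) * (q * a - b) + q ^ (2 * m) * e"
    using \<open>q \<noteq> 0\<close> by (metis mult_cancel_left power_not_zero)
  then have "exp_sum A h ?N = q ^ (m * Suc r) * (a - b / q) + q ^ (2 * m) / q * e"
    using \<open>q \<noteq> 0\<close> by (simp add: field_simps)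
  then show ?thesis
    unfolding q_def a_def b_def e_def
    by (simp only: if_distrib[of "(*) x" for x] mult_zero_right)
qed

end

section \<open>The generating function\<close>

text \<open>The recursion follows the passage from \<open>h\<close> to \<open>h / p\<close>, which
  lowers \<open>k\<close> by 1 and the valuation \<open>D\<close> of the form by 2. With
  \<open>X = p^m x\<close> the weight \<open>p^(2m-1) x\<close> of that passage becomes
  \<open>p^(m-1) X\<close>, hence the \<open>smult\<close> and the shift by
  \<open>pCons 0\<close>.\<close>

fun Q_poly :: "nat \<Rightarrow> nat \<Rightarrow> nat \<Rightarrow> nat \<Rightarrow> int poly" where
  "Q_poly p m D 0 = (\<Sum>i\<le>D. monom 1 i)"
| "Q_poly p m D (Suc k) = (\<Sum>i\<le>D. monom 1 i) + smult (int p ^ (m - 1)) (pCons 0 (Q_poly p m (D - 2) k))"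

text \<open>The value of the exponential sum \<open>exp_sum A h (p\<^sup>r)\<close> for \<open>p\<^sup>k\<close> exactly dividing \<open>h\<close> and
  \<open>p\<^sup>D\<close> exactly dividing \<open>quad A h\<close>.\<close>

fun coef :: "nat \<Rightarrow> nat \<Rightarrow> nat \<Rightarrow> nat \<Rightarrow> nat \<Rightarrow> complex" where
  "coef p m D k 0 = 1"
| "coef p m D 0 (Suc r) = of_nat p ^ (m * Suc r) * (of_bool (Suc r \<le> D) - of_bool (r \<le> D) / of_nat p)"
| "coef p m D (Suc k) (Suc r) =
     of_nat p ^ (m * Suc r) * (of_bool (Suc r \<le> D) - of_bool (r \<le> D) / of_nat p) +
     of_nat p ^ (2 * m) / of_nat p * coef p m (D - 2) k r"

lemma coeff_sum_monom: "coeff (\<Sum>i\<le>D. monom 1 i) j = (if j \<le> D then 1 else (0 :: int))"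
  by (simp add: coeff_sum)

lemma degree_sum_monom: "degree (\<Sum>i\<le>D. monom 1 i :: int poly) = D"
  by (rule antisym) (auto intro!: degree_le le_degree simp: coeff_sum_monom)

lemma degree_Q_poly:
  "2 * k \<le> D \<Longrightarrow> degree (Q_poly p m D k) = D"
proof (induction k arbitrary: D)
  case 0
  then show ?case by (simp add: degree_sum_monom)
next
  case (Suc k)
  let ?R = "smult (int p ^ (m - 1)) (pCons 0 (Q_poly p m (D - 2) k))"
  have "degree ?R \<le> Suc (degree (Q_poly p m (D - 2) k))"
    by (rule order.trans[OF degree_smult_le degree_pCons_le])
  also have "\<dots> < D" using Suc by simp
  finally show ?case
    by (simp add: degree_add_eq_left degree_sum_monom)
qed

lemma poly_sum_monom:
  "poly (map_poly of_int (\<Sum>i\<le>D. monom 1 i)) X = (\<Sum>i\<le>D. X ^ i :: complex)"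
  by (simp add: of_int_poly_hom.hom_sum poly_sum poly_monom)

lemma poly_Q_poly_Suc:
  "poly (map_poly of_int (Q_poly p m D (Suc k))) X =
    (\<Sum>i\<le>D. X ^ i) + of_nat p ^ (m - 1) * X * poly (map_poly of_int (Q_poly p m (D - 2) k)) (X :: complex)"
proof -
  have "map_poly of_int (smult (int p ^ (m - 1)) (pCons 0 (Q_poly p m (D - 2) k))) =
      smult (of_nat p ^ (m - 1)) (pCons 0 (map_poly of_int (Q_poly p m (D - 2) k) :: complex poly))"
    by (intro poly_eqI) (simp add: coeff_map_poly coeff_pCons split: nat.split)
  then show ?thesis
    by (simp only: Q_poly.simps of_int_poly_hom.hom_add poly_add poly_sum_monom) simp
qed

lemma sum_powers_reversed:
  fixes X :: complex
  assumes "X \<noteq> 0"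
  shows "X ^ D * (\<Sum>i\<le>D. inverse X ^ i) = (\<Sum>i\<le>D. X ^ i)"
proof -
  have "X ^ D * (\<Sum>i\<le>D. inverse X ^ i) = (\<Sum>i\<le>D. X ^ (D - i))"
    unfolding sum_distrib_left using assms
    by (intro sum.cong) (auto simp: power_diff field_simps)
  also have "\<dots> = (\<Sum>i\<le>D. X ^ i)"
    by (rule sum.reindex_bij_witness[of _ "\<lambda>i. D - i" "\<lambda>i. D - i"]) auto
  finally show ?thesis .
qed

text \<open>The polynomial for \<open>D - 2\<close> multiplied by \<open>X\<close> is symmetric
  about the same centre \<open>D / 2\<close> as the geometric sum, so the symmetry passes through
  the recursion.\<close>

lemma Q_poly_reversed:
  fixes X :: complex
  assumes "X \<noteq> 0"
  shows "2 * k \<le> D \<Longrightarrow>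
    X ^ D * poly (map_poly of_int (Q_poly p m D k)) (inverse X) = poly (map_poly of_int (Q_poly p m D k)) X"
proof (induction k arbitrary: D)
  case 0
  then show ?case using sum_powers_reversed[OF assms] by (simp only: Q_poly.simps poly_sum_monom)
next
  case (Suc k)
  obtain D' where D: "D = D' + 2"
    using Suc.prems by (metis add.commute le_add_diff_inverse le_trans mult_2 add_2_eq_Suc' le_add1 mult_Suc_right)
  let ?P = "\<lambda>X. poly (map_poly of_int (Q_poly p m D' k)) X"
  have "X ^ D * (of_nat p ^ (m - 1) * inverse X * ?P (inverse X)) =
      of_nat p ^ (m - 1) * X * (X ^ D' * ?P (inverse X))"
    using assms by (simp add: D power2_eq_square)
  also have "\<dots> = of_nat p ^ (m - 1) * X * ?P X"
    using Suc by (simp add: D)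
  finally show ?case
    unfolding poly_Q_poly_Suc distrib_left sum_powers_reversed[OF assms] by (simp add: D)
qed

text \<open>At each level of the recursion the explicit terms form a finite sum, so the identity
  holds for every complex \<open>x\<close>. It is applied with \<open>x = p^(-s)\<close>.\<close>

lemma coef_sums:
  assumes "p > 0" "m > 0"
  shows "(\<lambda>r. x ^ r * coef p m D k r) sums
    ((1 - of_nat p ^ m * x / of_nat p) * poly (map_poly of_int (Q_poly p m D k)) (of_nat p ^ m * x))"
proof (induction k arbitrary: D)
  define X where "X = of_nat p ^ m * x"
  define g where "g D r = X ^ Suc r * (of_bool (Suc r \<le> D) - of_bool (r \<le> D) / of_nat p)" for D r :: nat
  have pm: "of_nat p ^ (2 * m) / of_nat p * x = of_nat p ^ (m - 1) * X"
    using assms by (cases m) (simp_all add: X_def power_add field_simps mult_2 mult_2_right)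
  have X_power: "X ^ n = of_nat p ^ (m * n) * x ^ n" for n
    by (simp add: X_def power_mult_distrib power_mult)
  \<comment> \<open>The two geometric sums combine to \<open>1 - X/p\<close> times the full one,
    except that the first of them lacks the term \<open>X^0\<close>. The missing 1 is the
    coefficient at \<open>r = 0\<close>.\<close>
  have base: "g D sums ((1 - X / of_nat p) * (\<Sum>i\<le>D. X ^ i) - 1)" for D
  proof -
    have "g D sums (\<Sum>r\<le>D. g D r)"
      by (rule sums_finite) (auto simp: g_def)
    also have "(\<Sum>r\<le>D. g D r) = (\<Sum>r\<le>D. X ^ Suc r * of_bool (Suc r \<le> D)) - X / of_nat p * (\<Sum>r\<le>D. X ^ r)"
      by (simp add: g_def right_diff_distrib sum_subtractf sum_distrib_left)
    also have "(\<Sum>r\<le>D. X ^ Suc r * of_bool (Suc r \<le> D)) = (\<Sum>r\<le>D. X ^ r) - 1"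
    proof (cases D)
      case (Suc D')
      have "(\<Sum>r\<le>D. X ^ Suc r * of_bool (Suc r \<le> D)) = (\<Sum>r\<le>D'. X ^ Suc r)"
        by (simp add: Suc)
      then show ?thesis
        unfolding Suc by (subst sum.atMost_Suc_shift) simp
    qed simp
    finally show ?thesis by (simp add: left_diff_distrib algebra_simps)
  qed
  {
    case 0
    have "(\<lambda>r. x ^ Suc r * coef p m D 0 (Suc r)) = g D"
      by (rule ext) (simp add: g_def X_power mult_ac del: power_Suc mult_Suc_right)
    then show ?case
      using sums_Suc[of "\<lambda>r. x ^ r * coef p m D 0 r"] base[of D]
      unfolding X_def[symmetric] by (fastforce simp add: poly_sum_monom)
  next
    case (Suc k)
    have "(\<lambda>r. x ^ Suc r * coef p m D (Suc k) (Suc r)) =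
        (\<lambda>r. g D r + of_nat p ^ (m - 1) * X * (x ^ r * coef p m (D - 2) k r))"
      unfolding pm[symmetric] by (rule ext) (simp add: g_def X_power mult_ac distrib_left del: power_Suc mult_Suc_right, simp add: mult_ac)
    moreover have "(\<lambda>r. g D r + of_nat p ^ (m - 1) * X * (x ^ r * coef p m (D - 2) k r)) sums
       ((1 - X / of_nat p) * (\<Sum>i\<le>D. X ^ i) - 1 +
        of_nat p ^ (m - 1) * X * ((1 - X / of_nat p) * poly (map_poly of_int (Q_poly p m (D - 2) k)) X))"
      using Suc.IH[of "D - 2"] unfolding X_def[symmetric] by (intro sums_add base sums_mult)
    ultimately show ?case
      using sums_Suc[of "\<lambda>r. x ^ r * coef p m D (Suc k) r"]
      unfolding X_def[symmetric] poly_Q_poly_Suc by (fastforce simp add: algebra_simps)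
  }
qed

lemma power_dvd_iff_le:
  fixes p a :: int
  assumes "p ^ D dvd a" "\<not> p ^ Suc D dvd a"
  shows "p ^ j dvd a \<longleftrightarrow> j \<le> D"
  using assms by (meson dvd_trans le_imp_power_dvd not_less_eq_eq)

text \<open>The value depends on \<open>h\<close> only through \<open>k\<close> and
  \<open>D\<close>, which permits a different integral approximation \<open>h\<close> for each
  \<open>r\<close>. In the induction \<open>h / p\<close> carries the data \<open>k - 1\<close> and
  \<open>D - 2\<close>.\<close>

lemma exp_sum_eq_coef:
  fixes p :: nat
  assumes p: "prime (int p)"
    and A: "even_symmetric_mat A" "A \<in> carrier_mat (2 * m) (2 * m)" "coprime (det A) (int p)"
    and gauss: "\<And>u. \<not> int p dvd u \<Longrightarrow> gauss_sum A u (int p) = of_int (int p) ^ m"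
  shows "h \<in> carrier_vec (2 * m) \<Longrightarrow>
    \<forall>i<2 * m. int p ^ k dvd h $ i \<Longrightarrow> \<not> (\<forall>i<2 * m. int p ^ Suc k dvd h $ i) \<Longrightarrow>
    int p ^ D dvd quad A h \<Longrightarrow> \<not> int p ^ Suc D dvd quad A h \<Longrightarrow>
    exp_sum A h (int p ^ r) = coef p m D k r"
proof (induction r arbitrary: h k D)
  case 0
  have "unity 1 a = 1" for a by (simp add: unity_eq_1_iff)
  then show ?case
    using A by (simp add: exp_sum_def cube_1)
next
  case (Suc r)
  have p0: "int p > 0" using p by (rule prime_gt_0_int)
  let ?h = "map_vec (\<lambda>a. a div int p) h"
  have rec: "exp_sum A h (int p ^ Suc r) = of_int (int p) ^ (m * Suc r) *
      (of_bool (Suc r \<le> D) - of_bool (r \<le> D) / of_int (int p)) +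
      (if \<forall>i<2 * m. int p dvd h $ i
       then of_int (int p) ^ (2 * m) / of_int (int p) * exp_sum A ?h (int p ^ r) else 0)"
    unfolding power_dvd_iff_le[OF Suc.prems(4,5), symmetric]
    by (rule exp_sum_Suc[OF p A gauss Suc.prems(1)])
  show ?case
  proof (cases k)
    case 0
    then have "\<not> (\<forall>i<2 * m. int p dvd h $ i)" using Suc.prems(3) by simp
    then show ?thesis
      unfolding rec 0 by (simp only: if_False coef.simps of_int_of_nat_eq) simp
  next
    case (Suc k')
    then have all: "\<forall>i<2 * m. int p dvd h $ i"
      using Suc.prems(2) by (metis dvd_trans dvd_triv_left power_Suc)
    then have hp: "h = int p \<cdot>\<^sub>v ?h"
      using Suc.prems(1) by (intro eq_vecI) auto
    have h': "?h \<in> carrier_vec (2 * m)" using Suc.prems(1) by simp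
    have comp: "h $ i = int p * ?h $ i" if "i < 2 * m" for i
      using all that Suc.prems(1) by simp
    have q: "quad A h = (int p)\<^sup>2 * quad A ?h"
      by (subst hp) (rule quad_smult[OF A(2) h'])
    then have "int p ^ 2 dvd quad A h" by simp
    \<comment> \<open>This makes the truncated subtraction \<open>D - 2\<close> in
      \<open>coef\<close> exact.\<close>
    then have "2 \<le> D"
      by (simp only: power_dvd_iff_le[OF Suc.prems(4,5)])
    then obtain D' where D: "D = D' + 2" by (metis le_add_diff_inverse2)
    have "int p ^ (j + 2) dvd quad A h \<longleftrightarrow> int p ^ j dvd quad A ?h" for j
      unfolding q power_add mult.commute[of _ "int p ^ 2"] using p0 by simp
    then have D': "int p ^ D' dvd quad A ?h" "\<not> int p ^ Suc D' dvd quad A ?h"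
      using Suc.prems(4,5) D by (metis, metis add_Suc)
    have step: "int p ^ Suc j dvd h $ i \<longleftrightarrow> int p ^ j dvd ?h $ i" if "i < 2 * m" for i j
      unfolding comp[OF that] using p0 by simp
    have "exp_sum A ?h (int p ^ r) = coef p m D' k' r"
    proof (rule Suc.IH[OF h' _ _ D'])
      show "\<forall>i<2 * m. int p ^ k' dvd ?h $ i"
        using Suc.prems(2) step unfolding \<open>k = Suc k'\<close> by blast
      show "\<not> (\<forall>i<2 * m. int p ^ Suc k' dvd ?h $ i)"
        using Suc.prems(3) step unfolding \<open>k = Suc k'\<close> by blast
    qed
    then show ?thesis
      unfolding rec \<open>k = Suc k'\<close> using all by (simp only: if_True coef.simps of_int_of_nat_eq D) simp
  qed
qed

section \<open>\<open>p\<close>-adic integers and the additive character\<close>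

lemma comm_ring_hom_to_fract: "comm_ring_hom (to_fract :: 'a::idom \<Rightarrow> 'a fract)"
  by unfold_locales auto

lemma comm_ring_hom_of_int: "comm_ring_hom (of_int :: int \<Rightarrow> 'a::comm_ring_1)"
  by unfold_locales auto

lemma residue_of_nat: "residue (of_nat n :: 'p::prime_card padic_int) k = int n mod int CARD('p) ^ k"
  by (induction n) (simp_all add: zero_padic_int.rep_eq plus_padic_int.rep_eq one_padic_int.rep_eq mod_simps)

lemma residue_of_int: "residue (of_int n :: 'p::prime_card padic_int) k = n mod int CARD('p) ^ k"
proof (cases n)
  case (nonneg a)
  then show ?thesis by (simp add: residue_of_nat)
next
  case (neg a)
  then have "of_int n = - (of_nat (Suc a) :: 'p padic_int)" by simp
  then have "residue (of_int n :: 'p padic_int) k = (- (int (Suc a) mod int CARD('p) ^ k)) mod int CARD('p) ^ k"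
    by (simp only: uminus_padic_int.rep_eq residue_of_nat diff_0)
  then show ?thesis
    by (simp add: neg mod_minus_eq)
qed

text \<open>Division by \<open>p^r\<close> on residues: the quotient at level \<open>k\<close> is
  read off level \<open>r + k\<close>, where the \<open>r\<close> additional digits are
  available.\<close>

lemma residue_0_imp_dvd:
  fixes z :: "'p::prime_card padic_int"
  assumes "residue z r = 0"
  shows "\<exists>w. z = of_nat CARD('p) ^ r * w"
proof -
  let ?p = "int CARD('p)"
  have p: "?p > 0" using prime_card_int[where 'a = 'p] by (rule prime_gt_0_int)
  have dvd: "?p ^ r dvd residue z (r + k)" for k
    using residue_mod[of z r k] assms by (simp add: dvd_eq_mod_eq_0)
  define b where "b k = residue z (r + k) div ?p ^ r" for k
  have b: "residue z (r + k) = ?p ^ r * b k" for k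
    using dvd[of k] by (simp add: b_def)
  have "b (Suc k) mod ?p ^ k = b k" for k
  proof -
    have "?p ^ r * (b (Suc k) mod ?p ^ k) = residue z (r + Suc k) mod ?p ^ (r + k)"
      by (simp only: b mult_mod_right power_add)
    also have "\<dots> = residue z (r + k)"
      using residue_mod[of z "r + k" 1] by simp
    also have "\<dots> = ?p ^ r * b k" by (rule b)
    finally show ?thesis using p by simp
  qed
  then have b_mem: "b \<in> {a. \<forall>k. a (Suc k) mod ?p ^ k = a k}"
    by simp
  define w :: "'p padic_int" where "w = Abs_padic_int b"
  have w: "residue w = b"
    unfolding w_def by (rule Abs_padic_int_inverse[OF b_mem])
  have "residue z k = residue (of_nat CARD('p) ^ r * w) k" for k
  proof -
    have "residue (of_nat CARD('p) ^ r * w) k = ((?p ^ r mod ?p ^ k) * b k) mod ?p ^ k"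
      using residue_of_nat[where 'p = 'p, of "CARD('p) ^ r" k]
      by (simp add: times_padic_int.rep_eq w)
    also have "\<dots> = residue z (r + k) mod ?p ^ k"
      by (simp add: mod_simps b)
    also have "\<dots> = residue z k"
      using residue_mod[of z k r] by (simp add: add.commute)
    finally show ?thesis ..
  qed
  then show ?thesis
    by (metis residue_inject ext)
qed

lemma padic_int_approx:
  fixes z :: "'p::prime_card padic_int"
  obtains w where "z = of_int (residue z r) + of_nat CARD('p) ^ r * w"
proof -
  have "residue (z - of_int (residue z r)) r = 0"
    by (simp add: minus_padic_int.rep_eq residue_of_int mod_simps)
  then obtain w where "z - of_int (residue z r) = of_nat CARD('p) ^ r * w"
    using residue_0_imp_dvd by blast
  with that show thesis by (simp add: algebra_simps)
qed

lemma of_int_padic_int_dvd: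
  assumes "of_int n = (of_nat CARD('p) ^ r * w :: 'p::prime_card padic_int)"
  shows "int CARD('p) ^ r dvd n"
proof -
  have "residue (of_nat CARD('p) ^ r :: 'p padic_int) r = 0"
    using residue_of_nat[where 'p = 'p, of "CARD('p) ^ r" r] by simp
  then have "residue (of_nat CARD('p) ^ r * w) r = 0"
    by (simp add: times_padic_int.rep_eq)
  then show ?thesis
    using assms residue_of_int[where 'p = 'p, of n r] by (simp add: dvd_eq_mod_eq_0)
qed

text \<open>Characteristic zero: a nonzero \<open>n\<close> is not divisible by
  \<open>p^|n|\<close>, which exceeds \<open>|n|\<close>. Divisions by 2 and by \<open>p\<close> in
  the field rest on this.\<close>

lemma of_int_padic_int_eq_0_iff: "(of_int n :: 'p::prime_card padic_int) = 0 \<longleftrightarrow> n = 0"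
proof
  assume "(of_int n :: 'p padic_int) = 0"
  then have "residue (of_int n :: 'p padic_int) (nat \<bar>n\<bar>) = 0"
    by (simp add: zero_padic_int.rep_eq)
  then have dvd: "int CARD('p) ^ nat \<bar>n\<bar> dvd n"
    by (simp add: residue_of_int dvd_eq_mod_eq_0)
  have "nat \<bar>n\<bar> < CARD('p) ^ nat \<bar>n\<bar>"
    using prime_gt_1_nat[OF prime_card[where 'a = 'p]] by (simp add: power_gt_expt)
  then have "\<bar>n\<bar> < int CARD('p) ^ nat \<bar>n\<bar>"
    by (metis of_nat_less_iff of_nat_power abs_ge_zero nat_0_le)
  moreover have "\<bar>int CARD('p) ^ nat \<bar>n\<bar>\<bar> \<le> \<bar>n\<bar>" if "n \<noteq> 0"
    using that dvd by (rule dvd_imp_le_int)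
  ultimately show "n = 0"
    by (cases "n = 0") (simp_all add: abs_of_nonneg)
qed simp

lemma of_int_padic: "(of_int n :: 'p::prime_card padic) = to_fract (of_int n)"
proof -
  interpret comm_ring_hom "to_fract :: 'p padic_int \<Rightarrow> 'p padic"
    by (rule comm_ring_hom_to_fract)
  show ?thesis by (simp add: hom_of_int)
qed

lemma of_int_padic_eq_0_iff: "(of_int n :: 'p::prime_card padic) = 0 \<longleftrightarrow> n = 0"
  by (simp add: of_int_padic of_int_padic_int_eq_0_iff)

lemma padic_prime_nonzero: "(of_nat CARD('p) :: 'p::prime_card padic) \<noteq> 0"
  using of_int_padic_eq_0_iff[where 'p = 'p, of "int CARD('p)"] by simp

lemma padic_integers_of_int [simp]: "of_int n \<in> padic_integers"
  by (auto simp: padic_integers_def of_int_padic)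

lemma padic_integers_closed:
  assumes "x \<in> padic_integers" "y \<in> padic_integers"
  shows padic_integers_add: "x + y \<in> padic_integers"
    and padic_integers_diff: "x - y \<in> padic_integers"
    and padic_integers_mult: "x * y \<in> padic_integers"
  using assms unfolding padic_integers_def
  by (auto simp flip: to_fract_add to_fract_diff to_fract_mult)

lemma padic_integers_power [simp]: "of_nat CARD('p) ^ r \<in> (padic_integers :: 'p::prime_card padic set)"
  using padic_integers_of_int[of "int CARD('p) ^ r"] by simp

lemma padic_integers_add_iff:
  assumes "y \<in> padic_integers"
  shows "x + y \<in> padic_integers \<longleftrightarrow> x \<in> padic_integers"
  using assms padic_integers_add padic_integers_diff by (metis add_diff_cancel_right')

lemma of_int_div_power_in_padic_integers_iff:
  "of_int n / of_nat CARD('p) ^ r \<in> (padic_integers :: 'p::prime_card padic set) \<longleftrightarrow> int CARD('p) ^ r dvd n"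
proof
  let ?P = "of_nat CARD('p) :: 'p padic"
  have P: "?P = to_fract (of_nat CARD('p))"
    using of_int_padic[where 'p = 'p, of "int CARD('p)"] by simp
  have "to_fract (of_nat CARD('p) ^ r * w) = ?P ^ r * to_fract w" for w :: "'p padic_int"
    unfolding P by (induction r) (simp_all add: mult.assoc)
  moreover assume "of_int n / ?P ^ r \<in> padic_integers"
  then obtain w where "of_int n / ?P ^ r = to_fract w" by (auto simp: padic_integers_def)
  then have "of_int n = ?P ^ r * to_fract w"
    using padic_prime_nonzero[where 'p = 'p] by (simp add: field_simps)
  ultimately have "to_fract (of_int n) = to_fract (of_nat CARD('p) ^ r * w)"
    by (simp only: of_int_padic)
  then have "of_int n = of_nat CARD('p) ^ r * w"
    by (simp only: to_fract_eq_iff)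
  then show "int CARD('p) ^ r dvd n"
    by (rule of_int_padic_int_dvd)
next
  assume "int CARD('p) ^ r dvd n"
  then obtain k where "n = int CARD('p) ^ r * k" by auto
  then have "of_int n / of_nat CARD('p) ^ r = (of_int k :: 'p padic)"
    using padic_prime_nonzero[where 'p = 'p] by simp
  then show "of_int n / of_nat CARD('p) ^ r \<in> (padic_integers :: 'p padic set)"
    by simp
qed

text \<open>Uniqueness, on which the definite description depends: two candidates differ by a
  fraction with a power of \<open>p\<close> as denominator that is also a \<open>p\<close>-adic
  integer, hence by an integer, and both lie in \<open>[0, 1)\<close>.\<close>

lemma padic_frac_eq:
  fixes x :: "'p::prime_card padic"
  assumes "x - of_int a / of_nat CARD('p) ^ r \<in> padic_integers"
  shows "padic_frac x = of_int (a mod int CARD('p) ^ r) / of_nat CARD('p) ^ r"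
  unfolding padic_frac_def
proof (rule the_equality)
  let ?p = "int CARD('p)" and ?P = "of_nat CARD('p) :: 'p padic"
  have p: "?p > 0" using prime_card_int[where 'a = 'p] by (rule prime_gt_0_int)
  have P: "?P \<noteq> 0" by (rule padic_prime_nonzero)
  have eq: "x - of_int (a mod ?p ^ r) / ?P ^ r = x - of_int a / ?P ^ r + of_int (a div ?p ^ r)"
  proof -
    have "(of_int a :: 'p padic) = of_int (a div ?p ^ r) * ?P ^ r + of_int (a mod ?p ^ r)"
      by (metis div_mult_mod_eq of_int_add of_int_mult of_int_of_nat_eq of_int_power)
    then show ?thesis using P by (simp add: field_simps)
  qed
  have "x - of_int (a mod ?p ^ r) / ?P ^ r \<in> padic_integers"
    unfolding eq by (intro padic_integers_add assms padic_integers_of_int)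
  moreover have "real_of_int (a mod ?p ^ r) < of_nat CARD('p) ^ r"
    using pos_mod_bound[of "?p ^ r" a] p
    by (metis of_int_less_iff of_int_of_nat_eq of_int_power zero_less_power)
  moreover have "0 \<le> a mod ?p ^ r" using p by simp
  ultimately show "0 \<le> real_of_int (a mod ?p ^ r) / of_nat CARD('p) ^ r \<and>
      real_of_int (a mod ?p ^ r) / of_nat CARD('p) ^ r < 1 \<and>
      (\<exists>(b::int) (k::nat). real_of_int (a mod ?p ^ r) / of_nat CARD('p) ^ r = of_int b / of_nat CARD('p) ^ k \<and>
        x - of_int b / ?P ^ k \<in> padic_integers)"
    using p by (auto simp: divide_less_eq)
  fix t :: real
  assume t: "0 \<le> t \<and> t < 1 \<and> (\<exists>(b::int) (k::nat). t = of_int b / of_nat CARD('p) ^ k \<and>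
        x - of_int b / ?P ^ k \<in> padic_integers)"
  then obtain b k where b: "t = of_int b / of_nat CARD('p) ^ k" "x - of_int b / ?P ^ k \<in> padic_integers"
    by blast
  define c where "c = b * ?p ^ r - a * ?p ^ k"
  have "of_int c / ?P ^ (k + r) = of_int b / ?P ^ k - of_int a / ?P ^ r"
    using P by (simp add: c_def field_simps power_add)
  also have "\<dots> = (x - of_int a / ?P ^ r) - (x - of_int b / ?P ^ k)"
    by simp
  finally have "of_int c / ?P ^ (k + r) \<in> padic_integers"
    using padic_integers_diff[OF assms b(2)] by (simp only:)
  then obtain e where "c = ?p ^ (k + r) * e"
    by (auto simp: of_int_div_power_in_padic_integers_iff)
  then have e: "b * ?p ^ r = (a + ?p ^ r * e) * ?p ^ k"
    by (simp add: c_def power_add algebra_simps)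
  define q where "q = real CARD('p)"
  have q: "q > 0" using p by (simp add: q_def)
  have "real_of_int b * q ^ r = (of_int a + q ^ r * of_int e) * q ^ k"
    using arg_cong[OF e, of real_of_int] by (simp add: q_def)
  then have "t = (of_int a + q ^ r * of_int e) / q ^ r"
    using q by (simp add: b(1) field_simps flip: q_def)
  then have t2: "t * q ^ r = of_int (a + ?p ^ r * e)"
    using q by (simp add: q_def)
  have "0 \<le> t * q ^ r" "t * q ^ r < q ^ r"
    using t q by (auto simp: mult_less_cancel_right1)
  then have "0 \<le> real_of_int (a + ?p ^ r * e)" "real_of_int (a + ?p ^ r * e) < of_int (?p ^ r)"
    unfolding t2 by (simp_all add: q_def)
  then have "0 \<le> a + ?p ^ r * e" "a + ?p ^ r * e < ?p ^ r"
    by (simp_all only: of_int_0_le_iff of_int_less_iff)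
  then have "(a + ?p ^ r * e) mod ?p ^ r = a + ?p ^ r * e"
    by (rule mod_pos_pos_trivial)
  then have "a mod ?p ^ r = a + ?p ^ r * e"
    by (simp only: mod_mult_self2)
  then show "t = of_int (a mod ?p ^ r) / of_nat CARD('p) ^ r"
    using t2 q by (simp add: field_simps flip: q_def)
qed

lemma padic_char_eq:
  fixes x :: "'p::prime_card padic"
  assumes "x - of_int a / of_nat CARD('p) ^ r \<in> padic_integers"
  shows "padic_char x = unity (int CARD('p) ^ r) a"
proof -
  let ?p = "int CARD('p)"
  have p: "?p ^ r > 0" using prime_card_int[where 'a = 'p] by (simp add: prime_gt_0_int)
  have "padic_char x = unity (?p ^ r) (a mod ?p ^ r)"
    by (simp add: padic_char_def padic_frac_eq[OF assms] unity_def cis_conv_exp mult_ac)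
  also have "\<dots> = unity (?p ^ r) a"
    by (rule unity_cong[OF p]) (simp add: cong_def)
  finally show ?thesis .
qed

section \<open>Integration over \<open>p\<^sup>-\<^sup>r \<int>\<^sub>p\<^sup>N\<close>\<close>

lemma padic_lattice_eq: "padic_lattice N = (map_vec to_fract ` carrier_vec N :: 'p::prime_card padic vec set)"
proof (intro equalityI subsetI)
  fix x :: "'p padic vec" assume x: "x \<in> padic_lattice N"
  then have "\<forall>i<N. \<exists>z. x $ i = to_fract z"
    by (auto simp: padic_lattice_def padic_integers_def)
  then obtain z where "\<forall>i<N. x $ i = to_fract (z i)" by metis
  then have "x = map_vec to_fract (vec N z)"
    using x by (intro eq_vecI) (auto simp: padic_lattice_def)
  then show "x \<in> map_vec to_fract ` carrier_vec N" by auto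
qed (auto simp: padic_lattice_def padic_integers_def)

lemma scaled_lattice_iff:
  assumes "c \<noteq> 0"
  shows "x \<in> scaled_lattice N c \<longleftrightarrow> x \<in> carrier_vec N \<and> (\<forall>i<N. x $ i / c \<in> padic_integers)"
proof
  assume "x \<in> scaled_lattice N c"
  then show "x \<in> carrier_vec N \<and> (\<forall>i<N. x $ i / c \<in> padic_integers)"
    using assms by (auto simp: scaled_lattice_def padic_lattice_def)
next
  assume x: "x \<in> carrier_vec N \<and> (\<forall>i<N. x $ i / c \<in> padic_integers)"
  then have "x = c \<cdot>\<^sub>v vec N (\<lambda>i. x $ i / c)"
    using assms by (intro eq_vecI) auto
  moreover have "vec N (\<lambda>i. x $ i / c) \<in> padic_lattice N"
    using x by (auto simp: padic_lattice_def)
  ultimately show "x \<in> scaled_lattice N c"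
    unfolding scaled_lattice_def by blast
qed

lemma coset_iff:
  fixes v :: "'p::prime_card padic vec"
  assumes "v \<in> carrier_vec N"
  shows "x \<in> (\<lambda>w. v + w) ` padic_lattice N \<longleftrightarrow>
    x \<in> carrier_vec N \<and> (\<forall>i<N. x $ i - v $ i \<in> padic_integers)"
proof
  assume "x \<in> (\<lambda>w. v + w) ` padic_lattice N"
  then show "x \<in> carrier_vec N \<and> (\<forall>i<N. x $ i - v $ i \<in> padic_integers)"
    using assms by (auto simp: padic_lattice_def)
next
  assume x: "x \<in> carrier_vec N \<and> (\<forall>i<N. x $ i - v $ i \<in> padic_integers)"
  then have "x = v + (x - v)" "x - v \<in> padic_lattice N"
    using assms by (auto simp: padic_lattice_def)
  then show "x \<in> (\<lambda>w. v + w) ` padic_lattice N" by blast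
qed

text \<open>A coset of the lattice is open because it is stable under translation by the lattice,
  with \<open>r = 0\<close> in \<open>padic_open\<close>. For the volume, translation invariance is
  applied to the lattice itself, which is measurable as the coset of the zero vector.\<close>

lemma padic_haar_coset:
  fixes v :: "'p::prime_card padic vec"
  assumes "padic_haar N M" "v \<in> carrier_vec N"
  shows "(\<lambda>w. v + w) ` padic_lattice N \<in> sets M" "emeasure M ((\<lambda>w. v + w) ` padic_lattice N) = 1"
proof -
  have coset: "(\<lambda>w. v + w) ` padic_lattice N \<in> sets M" if v: "v \<in> carrier_vec N" for v :: "'p padic vec"
  proof -
    have closed: "x + y \<in> (\<lambda>w. v + w) ` padic_lattice N"
      if "x \<in> (\<lambda>w. v + w) ` padic_lattice N" "y \<in> scaled_lattice N (of_nat CARD('p) ^ 0)" for x y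
    proof -
      have eq: "x $ i + y $ i - v $ i = (x $ i - v $ i) + y $ i" for i by simp
      show ?thesis
        using that by (auto simp: coset_iff[OF v] scaled_lattice_iff eq intro!: padic_integers_add)
    qed
    have "padic_open N ((\<lambda>w. v + w) ` padic_lattice N)"
      unfolding padic_open_def
    proof (intro conjI ballI exI[of _ 0])
      show "(\<lambda>w. v + w) ` padic_lattice N \<subseteq> carrier_vec N"
        by (rule subsetI) (simp add: coset_iff[OF v])
    qed (rule closed)
    then show ?thesis
      using assms(1) by (auto simp: padic_haar_def)
  qed
  show "(\<lambda>w. v + w) ` padic_lattice N \<in> sets M" by (rule coset[OF assms(2)])
  have "(\<lambda>w. 0\<^sub>v N + w) ` padic_lattice N = (padic_lattice N :: 'p padic vec set)"
    by (force simp: padic_lattice_def image_iff)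
  then have "padic_lattice N \<in> sets M"
    using coset[of "0\<^sub>v N"] by simp
  then show "emeasure M ((\<lambda>w. v + w) ` padic_lattice N) = 1"
    using assms by (simp add: padic_haar_def)
qed

text \<open>The cosets of the \<open>p\<close>-adic integers in their multiple by
  \<open>p^-r\<close> are represented by the fractions \<open>a / p^r\<close>. The double fraction
  is the form in which membership in \<open>scaled_lattice\<close> speaks of a coordinate.\<close>

lemma padic_int_digits:
  fixes x :: "'p::prime_card padic"
  shows "x / (1 / of_nat CARD('p) ^ r) \<in> padic_integers \<longleftrightarrow>
    (\<exists>a\<in>{0..<int CARD('p) ^ r}. x - of_int a / of_nat CARD('p) ^ r \<in> padic_integers)"
proof
  let ?P = "of_nat CARD('p) :: 'p padic"
  have P: "?P \<noteq> 0" by (rule padic_prime_nonzero)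
  assume "x / (1 / ?P ^ r) \<in> padic_integers"
  then obtain z where z: "x * ?P ^ r = to_fract z" by (auto simp: padic_integers_def)
  obtain w where w: "z = of_int (residue z r) + of_nat CARD('p) ^ r * w"
    by (rule padic_int_approx)
  have "?P = to_fract (of_nat CARD('p))"
    using of_int_padic[where 'p = 'p, of "int CARD('p)"] by simp
  then have "to_fract (of_nat CARD('p) ^ r) = ?P ^ r"
    by (induction r) simp_all
  then have "x * ?P ^ r = of_int (residue z r) + ?P ^ r * to_fract w"
    unfolding z by (subst w) (simp add: of_int_padic)
  then have "x - of_int (residue z r) / ?P ^ r = to_fract w"
    using P by (simp add: field_simps)
  moreover have "residue z r \<in> {0..<int CARD('p) ^ r}"
    using residue_mod[of z r 0] pos_mod_bound[of "int CARD('p) ^ r"] pos_mod_sign[of "int CARD('p) ^ r"]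
      prime_gt_0_int[OF prime_card_int[where 'a = 'p]]
    by (metis add_0_right atLeastLessThan_iff zero_less_power)
  ultimately show "\<exists>a\<in>{0..<int CARD('p) ^ r}. x - of_int a / ?P ^ r \<in> padic_integers"
    by (metis padic_integers_def rangeI)
next
  let ?P = "of_nat CARD('p) :: 'p padic"
  assume "\<exists>a\<in>{0..<int CARD('p) ^ r}. x - of_int a / ?P ^ r \<in> padic_integers"
  then obtain a where a: "x - of_int a / ?P ^ r \<in> padic_integers" by blast
  have "x / (1 / ?P ^ r) = (x - of_int a / ?P ^ r) * ?P ^ r + of_int a"
    using padic_prime_nonzero[where 'p = 'p] by (simp add: field_simps)
  then show "x / (1 / ?P ^ r) \<in> padic_integers"
    using a by (simp add: padic_integers_add padic_integers_mult)
qed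

text \<open>The hypothesis makes \<open>f\<close> constant on each coset of the lattice, so on the
  domain it is a finite combination of indicators of measurable sets of volume 1; integrability
  follows from the same description.\<close>

lemma integral_scaled_lattice:
  fixes f :: "'p::prime_card padic vec \<Rightarrow> complex"
  assumes haar: "padic_haar N M"
    and f: "\<And>y w. y \<in> carrier_vec N \<Longrightarrow> w \<in> padic_lattice N \<Longrightarrow>
      f ((1 / of_nat CARD('p) ^ r) \<cdot>\<^sub>v map_vec of_int y + w) = c y"
  shows "(LINT x:scaled_lattice N (1 / of_nat CARD('p) ^ r)|M. f x) = (\<Sum>y\<in>cube N (int CARD('p) ^ r). c y)"
proof -
  let ?P = "of_nat CARD('p) :: 'p padic" and ?Y = "cube N (int CARD('p) ^ r)"
  define v where "v y = (1 / ?P ^ r) \<cdot>\<^sub>v map_vec of_int y" for y :: "int vec"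
  define C where "C y = (\<lambda>w. v y + w) ` padic_lattice N" for y
  have c0: "1 / ?P ^ r \<noteq> 0" using padic_prime_nonzero[where 'p = 'p] by simp
  have v: "v y \<in> carrier_vec N" if "y \<in> ?Y" for y
    using cube_carrier[OF that] by (simp add: v_def)
  have C: "x \<in> C y \<longleftrightarrow> x \<in> carrier_vec N \<and> (\<forall>i<N. x $ i - of_int (y $ i) / ?P ^ r \<in> padic_integers)"
    if "y \<in> ?Y" for x y
    unfolding C_def coset_iff[OF v[OF that]] using cube_carrier[OF that] by (auto simp: v_def)
  have ind: "indicator (scaled_lattice N (1 / ?P ^ r)) x *\<^sub>R f x = (\<Sum>y\<in>?Y. indicator (C y) x *\<^sub>R c y)" for x
  proof (cases "\<exists>y\<in>?Y. x \<in> C y")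
    case True
    then obtain y where y: "y \<in> ?Y" "x \<in> C y" by blast
    \<comment> \<open>The cosets are disjoint: two digits in \<open>[0, p^r)\<close> whose
      difference is divisible by \<open>p^r\<close> are equal.\<close>
    have uniq: "y' = y" if y': "y' \<in> ?Y" "x \<in> C y'" for y'
    proof (rule eq_vecI)
      show "dim_vec y' = dim_vec y"
        using y y' by (auto dest!: cube_carrier)
      fix i assume "i < dim_vec y"
      then have i: "i < N" using y by (auto dest!: cube_carrier)
      have "of_int (y $ i - y' $ i) / ?P ^ r =
          (x $ i - of_int (y' $ i) / ?P ^ r) - (x $ i - of_int (y $ i) / ?P ^ r)"
        by (simp add: diff_divide_distrib)
      also have "\<dots> \<in> padic_integers"
        using y y' i by (intro padic_integers_diff[of "a - b" "c - d" for a b c d]) (auto simp: C)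
      finally have "int CARD('p) ^ r dvd y $ i - y' $ i"
        by (simp only: of_int_div_power_in_padic_integers_iff)
      then have "y $ i mod int CARD('p) ^ r = y' $ i mod int CARD('p) ^ r"
        by (simp only: mod_eq_dvd_iff)
      then show "y' $ i = y $ i"
        using y y' i by (simp add: cube_def)
    qed
    have "x \<in> scaled_lattice N (1 / ?P ^ r)"
      unfolding scaled_lattice_iff[OF c0] padic_int_digits using y C[OF y(1)] by (auto simp: cube_def)
    moreover have "f x = c y"
      using y f[of y] cube_carrier[OF y(1)] by (auto simp: C_def v_def)
    moreover have "(\<Sum>y\<in>?Y. indicator (C y) x *\<^sub>R c y) = (\<Sum>y'\<in>?Y. if y' = y then c y else 0)"
    proof (intro sum.cong refl)
      fix y' assume y': "y' \<in> ?Y"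
      show "indicator (C y') x *\<^sub>R c y' = (if y' = y then c y else 0)"
      proof (cases "x \<in> C y'")
        case True
        then show ?thesis using uniq[OF y' True] by simp
      next
        case False
        then have "y' \<noteq> y" using y(2) by metis
        then show ?thesis using False by simp
      qed
    qed
    ultimately show ?thesis using y by simp
  next
    case False
    have "x \<notin> scaled_lattice N (1 / ?P ^ r)"
    proof
      assume "x \<in> scaled_lattice N (1 / ?P ^ r)"
      then have x: "x \<in> carrier_vec N"
        "\<forall>i<N. \<exists>a\<in>{0..<int CARD('p) ^ r}. x $ i - of_int a / ?P ^ r \<in> padic_integers"
        unfolding scaled_lattice_iff[OF c0] padic_int_digits by blast+
      then obtain a where a: "\<forall>i<N. a i \<in> {0..<int CARD('p) ^ r} \<and> x $ i - of_int (a i) / ?P ^ r \<in> padic_integers"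
        by metis
      then have "vec N a \<in> ?Y" by (simp add: cube_def)
      moreover have "x \<in> C (vec N a)"
        using x a \<open>vec N a \<in> ?Y\<close> by (simp add: C)
      ultimately show False using False by blast
    qed
    then show ?thesis using False by simp
  qed
  have meas: "C y \<in> sets M" "emeasure M (C y) = 1" if "y \<in> ?Y" for y
    unfolding C_def using padic_haar_coset[OF haar v[OF that]] by simp_all
  have int: "integrable M (\<lambda>x. indicator (C y) x *\<^sub>R c y)" if "y \<in> ?Y" for y
    using meas[OF that] by (intro integrable_scaleR_left) simp
  have val: "(LINT x|M. indicator (C y) x *\<^sub>R c y) = c y" if "y \<in> ?Y" for y
    using meas[OF that] sets.sets_into_space[OF meas(1)[OF that]] by (simp add: measure_def Int_absorb2)
  have "(LINT x|M. (\<Sum>y\<in>?Y. indicator (C y) x *\<^sub>R c y)) = (\<Sum>y\<in>?Y. LINT x|M. indicator (C y) x *\<^sub>R c y)"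
    by (rule Bochner_Integration.integral_sum[OF int])
  also have "\<dots> = (\<Sum>y\<in>?Y. c y)"
    by (rule sum.cong[OF refl val])
  finally show ?thesis
    unfolding set_lebesgue_integral_def ind .
qed

section \<open>The quadratic space\<close>

lemma hyperbolic_border_carrier:
  assumes "B \<in> carrier_mat d d"
  shows "hyperbolic_border B \<in> carrier_mat (d + 2) (d + 2)"
  using assms by (simp add: hyperbolic_border_def Let_def)

lemma even_symmetric_hyperbolic_border:
  assumes "B \<in> carrier_mat d d" "even_symmetric_mat B"
  shows "even_symmetric_mat (hyperbolic_border B)"
  unfolding even_symmetric_mat_iff[OF hyperbolic_border_carrier[OF assms(1)]]
  using assms(1) assms(2)[unfolded even_symmetric_mat_iff[OF assms(1)]]
  by (auto simp: hyperbolic_border_def Let_def)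

text \<open>Expansion along the first row and then along the last row leaves \<open>B\<close>, with
  the signs \<open>(-1)^(d+1)\<close> and \<open>(-1)^d\<close>.\<close>

lemma det_hyperbolic_border:
  assumes B: "B \<in> carrier_mat d d"
  shows "det (hyperbolic_border B) = - det B"
proof -
  let ?H = "hyperbolic_border B"
  have H: "?H \<in> carrier_mat (d + 2) (d + 2)" by (rule hyperbolic_border_carrier[OF B])
  define D where "D = mat_delete ?H 0 (d + 1)"
  have D: "D \<in> carrier_mat (d + 1) (d + 1)"
    using mat_delete_carrier[OF H, of 0 "d + 1"] by (simp add: D_def)
  have "det ?H = (\<Sum>j<d + 2. ?H $$ (0, j) * cofactor ?H 0 j)"
    by (rule laplace_expansion_row[OF H]) simp
  also have "\<dots> = (\<Sum>j<d + 2. if j = d + 1 then cofactor ?H 0 j else 0)"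
    using B by (intro sum.cong) (auto simp: hyperbolic_border_def Let_def)
  also have "\<dots> = (-1) ^ (d + 1) * det D"
    by (simp add: cofactor_def D_def)
  also have "det D = (\<Sum>j<d + 1. D $$ (d, j) * cofactor D d j)"
    by (rule laplace_expansion_row[OF D]) simp
  also have "\<dots> = (\<Sum>j<d + 1. if j = 0 then cofactor D d j else 0)"
    using B by (intro sum.cong) (auto simp: D_def mat_delete_def hyperbolic_border_def Let_def)
  also have "\<dots> = (-1) ^ d * det (mat_delete D d 0)"
    by (simp add: cofactor_def)
  also have "mat_delete D d 0 = B"
    using B by (intro eq_matI) (auto simp: D_def mat_delete_def hyperbolic_border_def Let_def)
  also have "(-1) ^ (d + 1) * ((-1) ^ d * det B) = - det B"
    by (simp flip: power_add mult.assoc)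
  finally show ?thesis .
qed

text \<open>The two borders contribute two signs that cancel, and the sign of \<open>- A\<close>
  disappears because \<open>d\<close> is even.\<close>

lemma J2_mat_properties:
  assumes "A \<in> carrier_mat d d" "even_symmetric_mat A" "even d"
  shows J2_mat_carrier: "J2_mat A \<in> carrier_mat (d + 4) (d + 4)"
    and even_symmetric_J2_mat: "even_symmetric_mat (J2_mat A)"
    and det_J2_mat: "det (J2_mat A) = det A"
proof -
  have A: "- A \<in> carrier_mat d d" "even_symmetric_mat (- A)"
    using assms(1) assms(2)[unfolded even_symmetric_mat_iff[OF assms(1)]]
    by (auto simp: even_symmetric_mat_iff)
  note J1 = hyperbolic_border_carrier[OF A(1)]
  show "J2_mat A \<in> carrier_mat (d + 4) (d + 4)"
    using hyperbolic_border_carrier[OF J1] by (simp add: J2_mat_def J1_mat_def numeral_eq_Suc)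
  show "even_symmetric_mat (J2_mat A)"
    unfolding J2_mat_def J1_mat_def
    by (intro even_symmetric_hyperbolic_border[OF J1] even_symmetric_hyperbolic_border[OF A])
  have "- A = (- 1) \<cdot>\<^sub>m A" by (intro eq_matI) auto
  then have "det (- A) = det A"
    using assms by (simp add: det_smult)
  then show "det (J2_mat A) = det A"
    unfolding J2_mat_def J1_mat_def
    by (simp add: det_hyperbolic_border[OF J1] det_hyperbolic_border[OF A(1)])
qed

section \<open>Replacing p-adic vectors by integral approximations\<close>

lemma padic_prime_eq_to_fract: "(of_nat CARD('p) :: 'p::prime_card padic) = to_fract (of_nat CARD('p))"
  using of_int_padic[where 'p = 'p, of "int CARD('p)"] by simp

lemma bil_padic_integers:
  assumes "A \<in> carrier_mat d d" "x \<in> padic_lattice d" "y \<in> padic_lattice d"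
  shows "bil A x y \<in> padic_integers"
  using assms
  by (auto simp: padic_lattice_eq padic_integers_def bil_map_vec[OF comm_ring_hom_to_fract assms(1)])

lemma quad_padic_integers:
  assumes "A \<in> carrier_mat d d" "x \<in> padic_lattice d"
  shows "quad A x \<in> padic_integers"
  using assms by (simp add: quad_def bil_padic_integers[where d = d])

lemma of_int_lattice: "h \<in> carrier_vec d \<Longrightarrow> map_vec of_int h \<in> padic_lattice d"
  by (auto simp: padic_lattice_def)

lemma padic_lattice_carrier: "x \<in> padic_lattice d \<Longrightarrow> x \<in> carrier_vec d"
  by (simp add: padic_lattice_def)

lemma padic_lattice_approx:
  fixes \<eta> :: "'p::prime_card padic vec"
  assumes "\<eta> \<in> padic_lattice d"
  obtains h w where "h \<in> carrier_vec d" "w \<in> padic_lattice d"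
    "\<eta> = map_vec of_int h + of_nat CARD('p) ^ R \<cdot>\<^sub>v w"
proof -
  obtain z where z: "z \<in> carrier_vec d" "\<eta> = map_vec to_fract z"
    using assms by (auto simp: padic_lattice_eq)
  have "\<forall>i. \<exists>w. z $ i = of_int (residue (z $ i) R) + of_nat CARD('p) ^ R * w"
    by (metis padic_int_approx)
  then obtain w where w: "\<And>i. z $ i = of_int (residue (z $ i) R) + of_nat CARD('p) ^ R * w i"
    by metis
  have P: "to_fract (of_nat CARD('p) ^ R) = (of_nat CARD('p) ^ R :: 'p padic)"
    unfolding padic_prime_eq_to_fract by (induction R) simp_all
  show thesis
  proof (rule that[of "map_vec (\<lambda>a. residue a R) z" "map_vec to_fract (vec d w)"])
    show "map_vec to_fract (vec d w) \<in> padic_lattice d"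
      unfolding padic_lattice_eq by auto
    show "\<eta> = map_vec of_int (map_vec (\<lambda>a. residue a R) z) + of_nat CARD('p) ^ R \<cdot>\<^sub>v map_vec to_fract (vec d w)"
    proof (rule eq_vecI)
      fix i assume "i < dim_vec (map_vec of_int (map_vec (\<lambda>a. residue a R) z) +
        of_nat CARD('p) ^ R \<cdot>\<^sub>v map_vec to_fract (vec d w) :: 'p padic vec)"
      then have i: "i < d" using z by simp
      have "to_fract (z $ i) = of_int (residue (z $ i) R) + of_nat CARD('p) ^ R * to_fract (w i)"
        by (subst w) (simp add: of_int_padic P)
      then show "\<eta> $ i = (map_vec of_int (map_vec (\<lambda>a. residue a R) z) +
        of_nat CARD('p) ^ R \<cdot>\<^sub>v map_vec to_fract (vec d w)) $ i"
        using z i by simp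
    qed (use z in simp)
  qed (use z in simp)
qed

text \<open>The division by 2 takes place in a field of characteristic zero, so it agrees with the
  halved integral matrix.\<close>

lemma qform_eq_quad:
  fixes x :: "'p::prime_card padic vec"
  assumes "even_symmetric_mat (J2_mat A)" "J2_mat A \<in> carrier_mat d d" "x \<in> carrier_vec d"
  shows "qform A x = quad (J2_mat A) x"
  using two_quad[OF assms] of_int_padic_eq_0_iff[where 'p = 'p, of 2]
  by (simp add: qform_def bil_def field_simps)

lemma bform_eq_bil:
  fixes x y :: "'p::prime_card padic vec"
  assumes "even_symmetric_mat (J2_mat A)" "J2_mat A \<in> carrier_mat d d" "x \<in> carrier_vec d" "y \<in> carrier_vec d"
  shows "bform A x y = bil (J2_mat A) x y"
  using assms by (simp add: bform_def qform_eq_quad[where d = d] quad_add[where d = d])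

text \<open>An approximation modulo \<open>p^R\<close> decides divisibility by \<open>p^j\<close>
  for all \<open>j\<close> up to \<open>R\<close>, since the error stays integral after division by
  \<open>p^j\<close>.\<close>

lemma divisible_approx_iff:
  assumes "x - of_int a \<in> (\<lambda>z. of_nat CARD('p) ^ R * z) ` (padic_integers :: 'p::prime_card padic set)" "j \<le> R"
  shows "x / of_nat CARD('p) ^ j \<in> padic_integers \<longleftrightarrow> int CARD('p) ^ j dvd a"
proof -
  let ?P = "of_nat CARD('p) :: 'p padic"
  have P: "?P \<noteq> 0" by (rule padic_prime_nonzero)
  obtain z where z: "z \<in> padic_integers" "x - of_int a = ?P ^ R * z"
    using assms(1) by blast
  have "x = of_int a + ?P ^ j * (?P ^ (R - j) * z)"
    using z(2) assms(2) by (simp add: algebra_simps flip: power_add)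
  then have "x / ?P ^ j = of_int a / ?P ^ j + ?P ^ (R - j) * z"
    using P by (simp add: add_divide_distrib)
  moreover have "?P ^ (R - j) * z \<in> padic_integers"
    by (rule padic_integers_mult[OF padic_integers_power z(1)])
  ultimately show ?thesis
    by (simp only: padic_integers_add_iff of_int_div_power_in_padic_integers_iff)
qed

lemma exactly_divides_iff:
  fixes x :: "'p::prime_card padic"
  shows "exactly_divides e x \<longleftrightarrow> x / of_nat CARD('p) ^ e \<in> padic_integers \<and>
    x / of_nat CARD('p) ^ Suc e \<notin> padic_integers"
proof -
  have "x \<in> (\<lambda>z. of_nat CARD('p) ^ j * z) ` padic_integers \<longleftrightarrow> x / of_nat CARD('p) ^ j \<in> padic_integers" for j
    using padic_prime_nonzero[where 'p = 'p]
    by (auto simp: image_iff intro!: bexI[of _ "x / of_nat CARD('p) ^ j"])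
  then show ?thesis by (simp only: exactly_divides_def)
qed

text \<open>For \<open>x = y / p^r + v\<close> with \<open>v\<close> in the lattice,
  \<open>(\<eta>, x)\<close> agrees with \<open>(h, y) / p^r\<close> and \<open>p^r q(x)\<close>
  with \<open>q(y) / p^r\<close>, both up to \<open>p\<close>-adic integers;
  \<open>r \<le> R\<close> controls the error of \<open>h\<close> in the first. The integrand is
  therefore constant on cosets.\<close>

lemma integral_eq_exp_sum:
  fixes \<eta> w :: "'p::prime_card padic vec"
  assumes J: "even_symmetric_mat (J2_mat A)" "J2_mat A \<in> carrier_mat d d"
    and haar: "padic_haar d M"
    and h: "h \<in> carrier_vec d" "w \<in> padic_lattice d" "\<eta> = map_vec of_int h + of_nat CARD('p) ^ R \<cdot>\<^sub>v w"
    and "r \<le> R"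
  shows "(LINT x:scaled_lattice d (1 / of_nat CARD('p) ^ r)|M.
      padic_char (bform A \<eta> x) * of_bool (of_nat CARD('p) ^ r * qform A x \<in> padic_integers)) =
    exp_sum (J2_mat A) h (int CARD('p) ^ r)"
proof -
  let ?P = "of_nat CARD('p) :: 'p padic" and ?p = "int CARD('p)" and ?J = "J2_mat A"
  have P: "?P \<noteq> 0" by (rule padic_prime_nonzero)
  have w: "w \<in> carrier_vec d" using h(2) by (rule padic_lattice_carrier)
  have \<eta>: "\<eta> \<in> carrier_vec d" using h w by simp
  have \<eta>L: "\<eta> \<in> padic_lattice d"
    using h w by (auto simp: padic_lattice_def intro!: padic_integers_add padic_integers_mult)
  have "padic_char (bform A \<eta> ((1 / ?P ^ r) \<cdot>\<^sub>v map_vec of_int y + v)) *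
        of_bool (?P ^ r * qform A ((1 / ?P ^ r) \<cdot>\<^sub>v map_vec of_int y + v) \<in> padic_integers) =
      of_bool (?p ^ r dvd quad ?J y) * unity (?p ^ r) (bil ?J h y)"
    if y: "y \<in> carrier_vec d" and v: "v \<in> padic_lattice d" for y v
  proof -
    let ?y = "map_vec of_int y :: 'p padic vec"
    let ?x = "(1 / ?P ^ r) \<cdot>\<^sub>v ?y + v"
    have yc: "?y \<in> carrier_vec d" using y by simp
    have vc: "v \<in> carrier_vec d" using v by (rule padic_lattice_carrier)
    have xc: "?x \<in> carrier_vec d" using yc vc by simp
    have yL: "?y \<in> padic_lattice d" using y by (rule of_int_lattice)
    have hy: "bil ?J (map_vec of_int h) ?y = of_int (bil ?J h y)"
      by (rule bil_map_vec[OF comm_ring_hom_of_int J(2) h(1) y])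
    have qy: "quad ?J ?y = of_int (quad ?J y)"
      by (rule quad_map_vec[OF comm_ring_hom_of_int J(2) y])
    have "bform A \<eta> ?x = 1 / ?P ^ r * bil ?J \<eta> ?y + bil ?J \<eta> v"
      using yc vc \<eta> by (simp add: bform_eq_bil[OF J \<eta> xc] bil_add_right[OF J(2)] bil_smult_right[OF J(2)])
    also have "bil ?J \<eta> ?y = of_int (bil ?J h y) + ?P ^ R * bil ?J w ?y"
      unfolding h(3) using yc w h(1) by (simp add: bil_add_left[OF J(2)] bil_smult_left[OF J(2)] hy)
    also have "?P ^ R = ?P ^ r * ?P ^ (R - r)"
      using \<open>r \<le> R\<close> by (simp flip: power_add)
    finally have "bform A \<eta> ?x - of_int (bil ?J h y) / ?P ^ r = ?P ^ (R - r) * bil ?J w ?y + bil ?J \<eta> v"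
      using P by (simp add: field_simps)
    also have "\<dots> \<in> padic_integers"
      by (intro padic_integers_add padic_integers_mult padic_integers_power
          bil_padic_integers[OF J(2)] h(2) yL \<eta>L v)
    finally have char: "padic_char (bform A \<eta> ?x) = unity (?p ^ r) (bil ?J h y)"
      by (rule padic_char_eq)
    have "?P ^ r * qform A ?x = of_int (quad ?J y) / ?P ^ r + (?P ^ r * quad ?J v + bil ?J ?y v)"
      using P yc vc by (simp add: qform_eq_quad[OF J xc] quad_add[OF J] quad_smult[OF J(2)]
          bil_smult_left[OF J(2)] qy power2_eq_square field_simps)
    moreover have "?P ^ r * quad ?J v + bil ?J ?y v \<in> padic_integers"
      by (intro padic_integers_add padic_integers_mult padic_integers_power
          bil_padic_integers[OF J(2)] quad_padic_integers[OF J(2)] yL v)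
    ultimately have "?P ^ r * qform A ?x \<in> padic_integers \<longleftrightarrow> ?p ^ r dvd quad ?J y"
      by (simp only: padic_integers_add_iff of_int_div_power_in_padic_integers_iff)
    then show ?thesis by (simp add: char)
  qed
  then show ?thesis
    using J(2) unfolding exp_sum_def by (subst integral_scaled_lattice[OF haar]) auto
qed

theorem theorem4p2:
  fixes n m p k k' :: nat
    and A :: "int mat"
    and \<eta> :: "'p::prime_card padic vec"
    and \<mu> :: "'p padic vec measure"
  assumes "n \<ge> 4" and "even n" and "m = (n + 2) div 2"
    and "A \<in> carrier_mat (n - 2) (n - 2)"
    and "pos_def_mat A" and "even_symmetric_mat A"
    and "det A = 1" and "n mod 8 = 2"
    and "prime p" and "p = CARD('p)"
    and "padic_haar (n + 2) \<mu>"
    and "\<eta> \<in> padic_lattice (n + 2)" and "qform A \<eta> \<noteq> 0"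
    and "exactly_divides_vec k \<eta>"
    and "exactly_divides (2 * k + k') (qform A \<eta>)"
  shows "\<exists>Q :: int poly.
           degree Q = 2 * k + k' \<and>
           (\<forall>X::complex. X \<noteq> 0 \<longrightarrow>
              X ^ (2 * k + k') * poly (map_poly of_int Q) (inverse X) =
              poly (map_poly of_int Q) X) \<and>
           (\<forall>s::complex.
              summable (J_term A \<mu> s \<eta>) \<and>
              J_series A \<mu> s \<eta> =
                (1 - of_nat p powr (of_nat m - 1 - s)) *
                poly (map_poly of_int Q) (of_nat p powr (of_nat m - s)))"
proof -
  define J where "J = J2_mat A"
  define D where "D = 2 * k + k'"
  let ?P = "of_nat CARD('p) :: 'p padic"
  \<comment> \<open>From \<open>n mod 8 = 2\<close> one gets \<open>m mod 4 = 2\<close>, so the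
    dimension \<open>n + 2\<close> is a multiple of 4.\<close>
  have d: "n + 2 = 2 * m" and "even m" and "m > 0" and p0: "p > 0"
    using assms(1-3,8,9) by (presburger, presburger, presburger, simp add: prime_gt_0_nat)
  have "even (n - 2)" "n - 2 + 4 = 2 * m" using assms(1,2) d by auto
  then have J: "even_symmetric_mat J" "J \<in> carrier_mat (2 * m) (2 * m)" "det J = 1"
    using J2_mat_properties[OF assms(4,6)] assms(7) by (simp_all add: J_def)
  have pi: "prime (int p)" using assms(9) by simp
  have gauss: "gauss_sum J u (int p) = of_int (int p) ^ m" if "\<not> int p dvd u" for u
    by (rule gauss_sum_unimodular[OF pi that J(1,2) \<open>even m\<close> J(3)])
  have \<eta>: "\<eta> \<in> carrier_vec (2 * m)" "\<eta> \<in> padic_lattice (2 * m)"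
    using assms(12) d by (simp_all add: padic_lattice_carrier)
  have integral: "(LINT x:scaled_lattice (dim_vec \<eta>) (1 / ?P ^ r)|\<mu>.
      padic_char (bform A \<eta> x) * of_bool (?P ^ r * qform A x \<in> padic_integers)) = coef p m D k r" for r
  proof -
    \<comment> \<open>\<open>r \<le> R\<close> serves the integral, and \<open>Suc D \<le> R\<close>
      keeps the exact power of \<open>p\<close> in the value of the form visible at
      \<open>h\<close>. Since \<open>k \<le> D\<close>, the exact power in the vector is then
      visible too.\<close>
    define R where "R = max r (Suc D)"
    obtain h w where h: "h \<in> carrier_vec (2 * m)" "w \<in> padic_lattice (2 * m)"
      "\<eta> = map_vec of_int h + ?P ^ R \<cdot>\<^sub>v w"
      by (rule padic_lattice_approx[OF \<eta>(2)])
    have w: "w \<in> carrier_vec (2 * m)" using h(2) by (rule padic_lattice_carrier)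
    have comp: "\<eta> $ i - of_int (h $ i) \<in> (\<lambda>z. ?P ^ R * z) ` padic_integers" if "i < 2 * m" for i
      using that h w by (auto simp: padic_lattice_def)
    have scaled: "\<eta> \<in> scaled_lattice (dim_vec \<eta>) (?P ^ j) \<longleftrightarrow> (\<forall>i<2 * m. int p ^ j dvd h $ i)" if "j \<le> R" for j
      using \<eta>(1) padic_prime_nonzero[where 'p = 'p] divisible_approx_iff[OF comp that]
      by (subst scaled_lattice_iff) (auto simp: assms(10))
    have hdiv: "\<forall>i<2 * m. int p ^ k dvd h $ i" "\<not> (\<forall>i<2 * m. int p ^ Suc k dvd h $ i)"
      using assms(14) scaled[of k] scaled[of "Suc k"] unfolding exactly_divides_vec_def
      by (auto simp: R_def D_def)
    have "qform A \<eta> - of_int (quad J h) = ?P ^ R * (?P ^ R * quad J w + bil J (map_vec of_int h) w)"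
    proof -
      have "qform A \<eta> = quad J (map_vec of_int h + ?P ^ R \<cdot>\<^sub>v w)"
        using qform_eq_quad[OF J(1,2)[unfolded J_def] \<eta>(1)] by (simp only: J_def h(3))
      then show ?thesis
        using h(1) w by (simp add: quad_add[OF J(1,2)] quad_smult[OF J(2)] bil_smult_right[OF J(2)]
            quad_map_vec[OF comm_ring_hom_of_int J(2)] power2_eq_square algebra_simps)
    qed
    moreover have "?P ^ R * quad J w + bil J (map_vec of_int h) w \<in> padic_integers"
      by (intro padic_integers_add padic_integers_mult padic_integers_power
          bil_padic_integers[OF J(2)] quad_padic_integers[OF J(2)] h(2) of_int_lattice h(1))
    ultimately have q: "qform A \<eta> - of_int (quad J h) \<in> (\<lambda>z. ?P ^ R * z) ` padic_integers"
      by blast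
    have qdiv: "int p ^ D dvd quad J h" "\<not> int p ^ Suc D dvd quad J h"
      using assms(15) divisible_approx_iff[OF q, of D] divisible_approx_iff[OF q, of "Suc D"]
      unfolding exactly_divides_iff D_def[symmetric] by (simp_all add: R_def assms(10) del: power_Suc)
    have "exp_sum J h (int p ^ r) = coef p m D k r"
      by (rule exp_sum_eq_coef[OF pi J(1,2) _ gauss h(1) hdiv qdiv]) (simp add: J(3))
    moreover have "r \<le> R" by (simp add: R_def)
    ultimately show ?thesis
      using integral_eq_exp_sum[OF J(1,2)[unfolded J_def] assms(11)[unfolded d] h] \<eta>(1)
      by (simp add: J_def assms(10))
  qed
  show ?thesis
  proof (intro exI conjI allI impI)
    show "degree (Q_poly p m D k) = 2 * k + k'"
      by (simp add: degree_Q_poly D_def)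
    show "X ^ (2 * k + k') * poly (map_poly of_int (Q_poly p m D k)) (inverse X) =
        poly (map_poly of_int (Q_poly p m D k)) X" if "X \<noteq> 0" for X :: complex
      using Q_poly_reversed[OF that, of k D] by (simp add: D_def)
    fix s :: complex
    \<comment> \<open>With this choice \<open>p^m x = p^(m-s)\<close> is the argument of the
      polynomial and \<open>p^m x / p = p^(m-1-s)\<close> is the subtracted term.\<close>
    define x where "x = (of_nat p :: complex) powr (- s)"
    have "J_term A \<mu> s \<eta> r = x ^ r * coef p m D k r" for r
    proof -
      have "(of_nat p :: complex) powr (- (of_nat r * s)) = x ^ r"
        using p0 by (simp add: x_def powr_def exp_of_nat_mult[symmetric] mult_ac)
      then show ?thesis
        unfolding J_term_def integral by (simp add: assms(10))
    qed
    then have "J_term A \<mu> s \<eta> = (\<lambda>r. x ^ r * coef p m D k r)" by (rule ext)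
    moreover have "of_nat p ^ m * x = (of_nat p :: complex) powr (of_nat m - s)"
      using p0 by (simp add: x_def powr_diff powr_minus powr_nat' divide_inverse)
    moreover have "(of_nat p :: complex) powr (of_nat m - s) / of_nat p = of_nat p powr (of_nat m - 1 - s)"
      using p0 by (simp add: powr_diff mult_ac)
    ultimately have sums: "J_term A \<mu> s \<eta> sums ((1 - of_nat p powr (of_nat m - 1 - s)) *
        poly (map_poly of_int (Q_poly p m D k)) (of_nat p powr (of_nat m - s)))"
      using coef_sums[OF p0 \<open>m > 0\<close>, of x D k] by simp
    then show "summable (J_term A \<mu> s \<eta>)" by (rule sums_summable)
    show "J_series A \<mu> s \<eta> = (1 - of_nat p powr (of_nat m - 1 - s)) *
        poly (map_poly of_int (Q_poly p m D k)) (of_nat p powr (of_nat m - s))"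
      unfolding J_series_def using sums by (rule sums_unique[symmetric])
  qed
qed

end
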